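(* Let $f\colon \mathcal{X}\to\mathcal{X}$ be a piecewise expanding interval map with an ergodic probability measure $\mu$ which is absolutely continuous with respect to Lebesgue measure. For $\tilde{x}\in\mathcal{X}$ consider the observable $\phi(x)=\psi(\mathrm{dist}(x,\tilde{x}))$, where $\psi(y)\to\infty$ as $y\to 0$. Let $(r_n)$ be a non-increasing sequence of positive numbers such that $r_n=O(n^{-\sigma})$ for some $\sigma>\frac45$ and such that for any $t>0$ $$\limsup_{k\to\infty}\frac{r_{k^t}}{r_{(k+1)^t}}<\infty .$$ Then for $\mu$-a.e. $\tilde{x}$ for which $n\mapsto n\mu(B(\tilde{x},r_n))$ is non-decreasing, the following dichotomy holds. (1) If $$\sum_{n=1}^\infty \mu(B(\tilde{x},r_n))\,e^{-n\mu(B(\tilde{x},r_n))}<\infty \quad\text{and}\quad \sum_{n=1}^\infty\mu(B(\tilde{x},r_n))=\infty,$$ then $\mu(\mathcal{H}_{\mathrm{ea}})=\mu(\psi(r_n)\le M_n \text{ ev.})=1$. (2) If $$\sum_{n=1}^\infty \mu(B(\tilde{x},r_n))\,e^{-n\mu(B(\tilde{x},r_n))}=\infty,$$ then $\mu(\mathcal{H}_{\mathrm{ea}})=\mu(\psi(r_n)\le M_n\text{ ev.})=0$.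
   Context: $\mathcal{X}\subset\mathbb{R}$ is a bounded interval, $\mathrm{dist}$ the usual distance, $B(x,r)=\{y:\mathrm{dist}(x,y)<r\}$, and $\mu$ is an $f$-invariant probability measure. The function $\psi\colon[0,\infty)\to\mathbb{R}\cup\{+\infty\}$ is (strictly) decreasing and continuous. Put $X_i=\phi\circ f^{i-1}$, $i\ge1$, and $M_n=\max(X_1,\dots,X_n)$. An event $(E_n\text{ ev.})$ is the set of points belonging to $E_n$ for all sufficiently large $n$. With $B_m=B(\tilde{x},r_m)$, $$\mathcal{H}_{\mathrm{ea}}=\bigcup_{n=1}^\infty\bigcap_{m=n}^\infty\bigcup_{k=0}^{m-1}f^{-k}(B_m).$$ Non-integer indices such as $k^t$ in $r_{k^t}$ are understood as integer parts. Piecewise expanding interval map: there is a partition $\mathscr{P}$ of $\mathcal{X}$ into intervals such that $f$ is differentiable (and monotone) on each element; let $\mathscr{P}_n$ be the corresponding partition for $f^n$. Either $\mathscr{P}$ is finite, or $\mathscr{P}$ is countable and there is $\delta_0>0$ with $|f^n(I)|\ge\delta_0$ for all $n$ and all $I\in\mathscr{P}_n$ ($|\cdot|$ is length). There is $\Lambda>1$ with $|f'|\ge\Lambda$. The map has bounded distortion: there is $C$ with $C^{-1}\le \frac{Df^n(x)}{Df^n(y)}\le C$ whenever $x,y\in I\in\mathscr{P}_n$, $n\geq 1$. Finally, $\mu$ has exponential decay of correlations for functions of bounded variation against $L^1(\mu)$: there are $C,\tau>0$ with $|\int\phi_1\cdot\phi_2\circ f^j\,\mathrm{d}\mu-\int\phi_1\,\mathrm{d}\mu\int\phi_2\,\mathrm{d}\mu|\le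 Ce^{-\tau j}\|\phi_1\|_{\mathrm{BV}}\|\phi_2\|_1$ for all $j$, where $\|\phi\|_{\mathrm{BV}}=\mathrm{var}(\phi)+\sup|\phi|$ ($\mathrm{var}$ is total variation). *)

theory Defs
  imports "HOL-Probability.Probability" "HOL-Library.Landau_Symbols"
begin

text \<open>
  Maps \<open>f : X \<rightarrow> X\<close> are total functions of type \<^typ>\<open>real \<Rightarrow> real\<close> of which only the values on
  \<open>X\<close> matter; preimages and balls are therefore always taken relative to \<open>X\<close>.
\<close>

subsection \<open>Invariant and ergodic measures\<close>

definition invariant_measure :: "'a measure \<Rightarrow> ('a \<Rightarrow> 'a) \<Rightarrow> bool" where
  "invariant_measure \<mu> f \<longleftrightarrow> f \<in> measurable \<mu> \<mu> \<and> distr \<mu> \<mu> f = \<mu>"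

definition ergodic_measure :: "'a measure \<Rightarrow> ('a \<Rightarrow> 'a) \<Rightarrow> bool" where
  "ergodic_measure \<mu> f \<longleftrightarrow> prob_space \<mu> \<and> invariant_measure \<mu> f \<and>
     (\<forall>A\<in>sets \<mu>. f -` A \<inter> space \<mu> = A \<longrightarrow> measure \<mu> A = 0 \<or> measure \<mu> A = 1)"

subsection \<open>Piecewise expanding interval maps\<close>

text \<open>
  The partition \<open>P\<^sub>n\<close> belonging to \<open>f ^^ n\<close>: all nonempty sets
  \<open>I\<^sub>0 \<inter> f\<^sup>-\<^sup>1 I\<^sub>1 \<inter> \<dots> \<inter> f\<^sup>-\<^sup>(\<^sup>n\<^sup>-\<^sup>1\<^sup>) I\<^sub>n\<^sub>-\<^sub>1\<close> with \<open>I\<^sub>0, \<dots>, I\<^sub>n\<^sub>-\<^sub>1 \<in> P\<close>.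
\<close>
definition iterated_partition ::
    "real set \<Rightarrow> (real \<Rightarrow> real) \<Rightarrow> real set set \<Rightarrow> nat \<Rightarrow> real set set" where
  "iterated_partition X f P n =
     {{x \<in> X. \<forall>i<n. (f ^^ i) x \<in> J i} | J. \<forall>i<n. J i \<in> P} - {{}}"

text \<open>
  Derivatives on a partition element \<open>I\<close> are taken within \<open>I\<close>, hence one-sided at an endpoint of
  \<open>I\<close> that belongs to \<open>I\<close>.  The derivative is given as a function \<open>D\<close>, which is
  uniquely determined on \<open>I\<close> unless \<open>I\<close> is a single point, where it carries no information.
\<close>
definition expanding_on :: "(real \<Rightarrow> real) \<Rightarrow> real \<Rightarrow> real set \<Rightarrow> bool" where
  "expanding_on f \<Lambda> I \<longleftrightarrow>
     (\<exists>D. (\<forall>x\<in>I. (f has_real_derivative D x) (at x within I)) \<and> (\<forall>x\<in>I. \<bar>D x\<bar> \<ge> \<Lambda>))"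

definition distortion_bounded_on :: "(real \<Rightarrow> real) \<Rightarrow> real \<Rightarrow> real set \<Rightarrow> bool" where
  "distortion_bounded_on g C I \<longleftrightarrow>
     (\<exists>D. (\<forall>x\<in>I. (g has_real_derivative D x) (at x within I)) \<and>
          (\<forall>x\<in>I. \<forall>y\<in>I. inverse C \<le> D x / D y \<and> D x / D y \<le> C))"

definition piecewise_expanding :: "real set \<Rightarrow> (real \<Rightarrow> real) \<Rightarrow> bool" where
  "piecewise_expanding X f \<longleftrightarrow>
     f \<in> X \<rightarrow> X \<and>
     (\<exists>P. partition_on X P \<and>
        (\<forall>I\<in>P. is_interval I \<and> f differentiable_on I \<and> (mono_on I f \<or> antimono_on I f)) \<and>
        (finite P \<or>
         countable P \<and>
         (\<exists>\<delta>>0. \<forall>n\<ge>1. \<forall>I\<in>iterated_partition X f P n. measure lborel ((f ^^ n) ` I) \<ge> \<delta>)) \<and>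
        (\<exists>\<Lambda>>1. \<forall>I\<in>P. expanding_on f \<Lambda> I) \<and>
        (\<exists>C>0. \<forall>n\<ge>1. \<forall>I\<in>iterated_partition X f P n. distortion_bounded_on (f ^^ n) C I))"

subsection \<open>Decay of correlations\<close>

definition variation_sums :: "real set \<Rightarrow> (real \<Rightarrow> real) \<Rightarrow> real set" where
  "variation_sums X g =
     {\<Sum>i<n. \<bar>g (x (Suc i)) - g (x i)\<bar> | (n::nat) x. (\<forall>i\<le>n. x i \<in> X) \<and> (\<forall>i<n. x i < x (Suc i))}"

definition bounded_variation :: "real set \<Rightarrow> (real \<Rightarrow> real) \<Rightarrow> bool" where
  "bounded_variation X g \<longleftrightarrow> bdd_above (variation_sums X g)"

definition BV_norm :: "real set \<Rightarrow> (real \<Rightarrow> real) \<Rightarrow> real" where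
  "BV_norm X g = Sup (variation_sums X g) + (SUP x\<in>X. \<bar>g x\<bar>)"

definition exp_decay_BV_L1 :: "real set \<Rightarrow> real measure \<Rightarrow> (real \<Rightarrow> real) \<Rightarrow> bool" where
  "exp_decay_BV_L1 X \<mu> f \<longleftrightarrow>
     (\<exists>C>0. \<exists>\<tau>>0. \<forall>g h. bounded_variation X g \<longrightarrow> integrable \<mu> h \<longrightarrow>
        (\<forall>j::nat. \<bar>(\<integral>x. g x * h ((f ^^ j) x) \<partial>\<mu>) - (\<integral>x. g x \<partial>\<mu>) * (\<integral>x. h x \<partial>\<mu>)\<bar>
                 \<le> C * exp (- \<tau> * real j) * BV_norm X g * (\<integral>x. \<bar>h x\<bar> \<partial>\<mu>)))"

subsection \<open>Observables, maxima and eventually always hitting points\<close>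

definition observable :: "(real \<Rightarrow> ereal) \<Rightarrow> real \<Rightarrow> real \<Rightarrow> ereal" where
  "observable \<psi> xt x = \<psi> (dist x xt)"

definition obs_process :: "(real \<Rightarrow> real) \<Rightarrow> (real \<Rightarrow> ereal) \<Rightarrow> nat \<Rightarrow> real \<Rightarrow> ereal" where
  "obs_process f \<phi> i x = \<phi> ((f ^^ (i - 1)) x)"

text \<open>The indices start at 1; \<open>running_max f \<phi> 0\<close> is unspecified and never matters.\<close>
definition running_max :: "(real \<Rightarrow> real) \<Rightarrow> (real \<Rightarrow> ereal) \<Rightarrow> nat \<Rightarrow> real \<Rightarrow> ereal" where
  "running_max f \<phi> n x = Max ((\<lambda>i. obs_process f \<phi> i x) ` {1..n})"

definition max_event ::
    "real set \<Rightarrow> (real \<Rightarrow> real) \<Rightarrow> (real \<Rightarrow> ereal) \<Rightarrow> (nat \<Rightarrow> real) \<Rightarrow> real \<Rightarrow> real set" where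
  "max_event X f \<psi> r xt =
     {x \<in> X. eventually (\<lambda>n. \<psi> (r n) \<le> running_max f (observable \<psi> xt) n x) sequentially}"

definition ball_in :: "real set \<Rightarrow> real \<Rightarrow> real \<Rightarrow> real set" where
  "ball_in X x \<rho> = ball x \<rho> \<inter> X"

definition eah_set ::
    "real set \<Rightarrow> (real \<Rightarrow> real) \<Rightarrow> (nat \<Rightarrow> real) \<Rightarrow> real \<Rightarrow> real set" where
  "eah_set X f r xt =
     (\<Union>n\<in>{1..}. \<Inter>m\<in>{n..}. \<Union>k\<in>{0..m-1}. (f ^^ k) -` ball_in X xt (r m) \<inter> X)"

end

theory Submission
  imports Defs "HOL-Real_Asymp.Real_Asymp"
begin

text \<open>
  Write \<open>b\<^sub>n = \<mu>(B\<^sub>n)\<close>, \<open>c\<^sub>n = n b\<^sub>n\<close> and let \<open>A\<^sub>n\<close> be the set of points whose first \<open>n\<close> iterates avoid \<open>B\<^sub>n\<close>;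
  the complement of \<open>H\<^sub>e\<^sub>a\<close> is the limit superior of the \<open>A\<^sub>n\<close>.  By stationarity the probability of avoiding
  \<open>B\<close> during \<open>m\<close> steps decreases in step \<open>m\<close> by the probability of starting in \<open>B\<close> and then avoiding it.
  Decorrelating only the indicator of \<open>B\<close>, whose variation is at most 2, and using that almost every
  centre has few short returns gives \<open>\<mu>(A\<^sub>n) \<approx> exp (- c\<^sub>n)\<close>, and likewise bounds for
  \<open>\<mu>(A\<^sub>m \<inter> f\<^sup>-\<^sup>kF)\<close> relative to \<open>\<mu>(F)\<close>.  If \<open>\<Sum> b\<^sub>n exp (- c\<^sub>n)\<close> converges, a weighted Borel-Cantelli
  argument shows that almost every point lies in finitely many \<open>A\<^sub>n\<close>; if it diverges, the second moment
  of \<open>\<Sum> b\<^sub>n 1\<^bsub>A\<^sub>n\<^esub>\<close> is comparable to the square of its mean, so that the limit superior has positive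
  measure, hence full measure by ergodicity.

  Short returns: on a branch of \<open>f\<^sup>j\<close> the points that \<open>f\<^sup>j\<close> moves by less than \<open>2r\<close> fill an interval of
  length \<open>O(r)\<close>.  Borel-Cantelli over dyadic \<open>r\<close> excludes such returns on all branches (finite
  partition) or on all branches longer than \<open>\<surd>r\<close> (countable partition).  In the countable case the short
  branches are spread out by bounded distortion and large images, which also make the density of
  \<open>\<mu>\<close> bounded, and bounded away from zero near almost every point.
\<close>

section \<open>Avoiding a set in a stationary system\<close>

text \<open>The indicator of an avoidance event may have a variation that grows with the number of
  steps, so it cannot serve as the BV factor in the decay of correlations. It only ever appears as
  the L^1 factor, and one indicator of a ball at a time is decorrelated from it. As the L^1 norm
  enters linearly, errors come out relative to the probability of the future event; an additive
  error could exceed the product \<open>exp (- c m) * exp (- c n)\<close> with which the second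
  moment has to be compared. The remaining errors are of order \<open>n powr (- \<kappa>)\<close>,
  so \<open>exp (- c n)\<close> is resolved only as long as
  \<open>c n \<le> \<kappa> * ln n\<close>. The other indices contribute a convergent part of the
  series: in the convergent case the weights are capped there, in the divergent case these indices
  are dropped. Monotonicity of \<open>c\<close> does two jobs: it gives
  \<open>b n \<ge> b 1 / n\<close>, which beats the mixing error after a logarithmic gap, and it
  keeps \<open>b\<close> comparable between \<open>m\<close> and \<open>2 * m\<close>, which
  controls the dependence of neighbouring events.\<close>

locale measure_preserving_system = prob_space M for M :: "'a measure" +
  fixes f :: "'a \<Rightarrow> 'a"
  assumes f_measurable [measurable]: "f \<in> measurable M M"
    and f_preserves: "distr M M f = M"
begin

abbreviation pre :: "nat \<Rightarrow> 'a set \<Rightarrow> 'a set" where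
  "pre j A \<equiv> (f ^^ j) -` A \<inter> space M"

lemma funpow_measurable [measurable]: "f ^^ j \<in> measurable M M"
proof (induction j)
  case 0
  then show ?case by (simp add: id_def)
next
  case (Suc j)
  show ?case unfolding funpow.simps by (rule measurable_comp[OF Suc f_measurable])
qed

lemma funpow_funpow: "(f ^^ i) ((f ^^ j) x) = (f ^^ (i + j)) x"
  by (simp add: funpow_add)

lemma funpow_f: "(f ^^ i) (f x) = (f ^^ Suc i) x"
  by (simp only: funpow_Suc_right comp_apply)

lemma funpow_space: "x \<in> space M \<Longrightarrow> (f ^^ j) x \<in> space M"
  by (rule measurable_space[OF funpow_measurable])

lemma pre_sets [measurable, intro]: "A \<in> sets M \<Longrightarrow> pre j A \<in> sets M"
  by (rule measurable_sets[OF funpow_measurable])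

lemma never_sets:
  assumes "B \<in> sets M"
  shows "{x \<in> space M. \<forall>k\<in>I. (f ^^ k) x \<notin> B} \<in> sets M"
proof -
  have "{x \<in> space M. \<forall>k\<in>I. (f ^^ k) x \<notin> B} = space M - (\<Union>k\<in>I. pre k B)"
    by auto
  then show ?thesis using assms by auto
qed

lemma distr_funpow: "distr M M (f ^^ j) = M"
proof (induction j)
  case 0
  then show ?case by (simp add: distr_id2 id_def)
next
  case (Suc j)
  have "distr M M (f ^^ Suc j) = distr (distr M M (f ^^ j)) M f"
    by (subst distr_distr) auto
  then show ?case by (simp only: Suc f_preserves)
qed

lemma prob_pre: "A \<in> sets M \<Longrightarrow> prob (pre j A) = prob A"
  using measure_distr[OF funpow_measurable, of A j] distr_funpow[of j] by simp

lemma AE_funpow: "AE x in M. P x \<Longrightarrow> AE x in M. P ((f ^^ j) x)"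
proof -
  assume "AE x in M. P x"
  then obtain N where N: "N \<in> null_sets M" "{x \<in> space M. \<not> P x} \<subseteq> N"
    by (auto simp: eventually_ae_filter)
  have "pre j N \<in> null_sets M"
  proof (rule null_setsI)
    have "prob N = 0" using N(1) by (simp add: null_sets_def measure_def)
    then show "emeasure M (pre j N) = 0"
      using prob_pre[of N j] null_setsD2[OF N(1)] by (simp add: emeasure_eq_measure)
  qed (use null_setsD2[OF N(1)] in auto)
  moreover have "{x \<in> space M. \<not> P ((f ^^ j) x)} \<subseteq> pre j N"
    using N(2) funpow_space by auto
  ultimately show ?thesis by (rule AE_I')
qed

lemma AE_all_funpow: "AE x in M. P x \<Longrightarrow> AE x in M. \<forall>j. P ((f ^^ j) x)"
  using AE_funpow by (simp add: AE_all_countable)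

text \<open>The eventually-in-\<open>A\<close> set is strictly invariant and differs from \<open>A\<close> by a null set.\<close>
lemma zero_one_law:
  assumes ergodic: "\<And>A. A \<in> sets M \<Longrightarrow> f -` A \<inter> space M = A \<Longrightarrow> prob A = 0 \<or> prob A = 1"
    and A [measurable]: "A \<in> sets M" and inv: "AE x in M. x \<in> A \<longrightarrow> f x \<in> A"
  shows "prob A = 0 \<or> prob A = 1"
proof -
  define E where "E n = {x \<in> space M. \<forall>k\<ge>n. (f ^^ k) x \<in> A}" for n
  have E_sets [measurable]: "E n \<in> sets M" for n
  proof -
    have "E n = {x \<in> space M. \<forall>k\<in>{n..}. (f ^^ k) x \<notin> space M - A}"
      using funpow_space by (auto simp: E_def)
    then show ?thesis by (simp only:) (rule never_sets, auto)
  qed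
  define A' where "A' = (\<Union>n. E n)"
  have A'_sets [measurable]: "A' \<in> sets M" unfolding A'_def by measurable
  have "f -` A' \<inter> space M = A'"
  proof (intro set_eqI iffI)
    fix x assume "x \<in> f -` A' \<inter> space M"
    then obtain n where x: "x \<in> space M" and n: "\<forall>k\<ge>n. (f ^^ k) (f x) \<in> A"
      by (auto simp: A'_def E_def)
    have "(f ^^ k) x \<in> A" if "k \<ge> Suc n" for k
      using n that by (cases k) (auto simp: funpow_f simp del: funpow.simps)
    then show "x \<in> A'" using x by (auto simp: A'_def E_def)
  next
    fix x assume "x \<in> A'"
    then obtain n where x: "x \<in> space M" and n: "\<forall>k\<ge>n. (f ^^ k) x \<in> A"
      by (auto simp: A'_def E_def)
    have "\<forall>k\<ge>n. (f ^^ k) (f x) \<in> A"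
      using n by (metis funpow_Suc_right comp_apply le_SucI)
    then show "x \<in> f -` A' \<inter> space M"
      using x measurable_space[OF f_measurable] by (auto simp: A'_def E_def)
  qed
  then have *: "prob A' = 0 \<or> prob A' = 1" using ergodic A'_sets by blast
  have "(\<lambda>n. prob (E n)) \<longlonglongrightarrow> prob A'"
    unfolding A'_def by (rule finite_Lim_measure_incseq) (auto simp: incseq_def E_def)
  moreover have "prob (E n) \<le> prob A" for n
  proof -
    have "prob (E n) \<le> prob (pre n A)"
      by (rule finite_measure_mono) (auto simp: E_def)
    then show ?thesis by (simp add: prob_pre)
  qed
  ultimately have "prob A' \<le> prob A" by (meson LIMSEQ_le_const2)
  moreover have "prob A \<le> prob A'"
  proof (rule finite_measure_mono_AE)
    show "AE x in M. x \<in> A \<longrightarrow> x \<in> A'"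
      using AE_all_funpow[OF inv]
    proof eventually_elim
      case (elim x)
      show ?case
      proof
        assume "x \<in> A"
        have "(f ^^ k) x \<in> A" for k
          using elim \<open>x \<in> A\<close> by (induction k) auto
        then show "x \<in> A'" using sets.sets_into_space[OF A] \<open>x \<in> A\<close> by (auto simp: A'_def E_def)
      qed
    qed
  qed simp
  ultimately show ?thesis using * by simp
qed

definition avoids :: "'a set \<Rightarrow> nat \<Rightarrow> 'a set" where
  "avoids B m = {x \<in> space M. \<forall>i<m. (f ^^ i) x \<notin> B}"

lemma avoids_sets [measurable]: "B \<in> sets M \<Longrightarrow> avoids B m \<in> sets M"
  using never_sets[of B "{..<m}"] by (simp add: avoids_def)

lemma avoids_mono: "B \<subseteq> B' \<Longrightarrow> m \<le> m' \<Longrightarrow> avoids B' m' \<subseteq> avoids B m"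
  by (auto simp: avoids_def)

lemma avoids_0 [simp]: "avoids B 0 = space M"
  by (auto simp: avoids_def)

text \<open>Decay of correlations for the indicator of \<open>B\<close> against arbitrary events.
  The factor \<open>prob H\<close> is the L^1 norm of the indicator of \<open>H\<close>; the BV norm
  of the indicator of \<open>B\<close> is hidden in \<open>K\<close>.\<close>

definition exp_mixing_set :: "real \<Rightarrow> real \<Rightarrow> 'a set \<Rightarrow> bool" where
  "exp_mixing_set K \<tau> B \<longleftrightarrow> B \<in> sets M \<and> (\<forall>H\<in>sets M. \<forall>j.
     \<bar>prob (B \<inter> pre j H) - prob B * prob H\<bar> \<le> K * exp (- \<tau> * real j) * prob H)"

lemma exp_mixing_setD:
  assumes "exp_mixing_set K \<tau> B" "H \<in> sets M" "J \<le> j" "K \<ge> 0" "\<tau> \<ge> 0"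
  shows "prob (B \<inter> pre j H) \<le> (prob B + K * exp (- \<tau> * real J)) * prob H"
    and "prob (B \<inter> pre j H) \<ge> (prob B - K * exp (- \<tau> * real J)) * prob H"
proof -
  have "K * exp (- \<tau> * real j) * prob H \<le> K * exp (- \<tau> * real J) * prob H"
    using assms(3-5) by (intro mult_right_mono mult_left_mono) (auto intro: mult_left_mono)
  moreover have "\<bar>prob (B \<inter> pre j H) - prob B * prob H\<bar> \<le> K * exp (- \<tau> * real j) * prob H"
    using assms(1,2) by (auto simp: exp_mixing_set_def)
  ultimately have "\<bar>prob (B \<inter> pre j H) - prob B * prob H\<bar> \<le> K * exp (- \<tau> * real J) * prob H"
    by linarith
  then show "prob (B \<inter> pre j H) \<le> (prob B + K * exp (- \<tau> * real J)) * prob H"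
    and "prob (B \<inter> pre j H) \<ge> (prob B - K * exp (- \<tau> * real J)) * prob H"
    unfolding distrib_right left_diff_distrib by linarith+
qed

text \<open>Stationarity turns the decrement of the avoidance probability from \<open>i\<close> to \<open>i + 1\<close> steps into
  the probability of being in \<open>B\<close> now and avoiding it during the next \<open>i\<close> steps; only the indicator
  of \<open>B\<close> itself, which has bounded variation, has to be decorrelated from the future.\<close>
lemma avoids_upper_bound:
  assumes B: "exp_mixing_set K \<tau> B" and K: "K \<ge> 0" "\<tau> \<ge> 0"
    and e: "e = K * exp (- \<tau> * real J)" "2 * e \<le> prob B" and J: "J \<ge> 1"
    and short: "\<And>j G. 1 \<le> j \<Longrightarrow> G \<in> sets M \<Longrightarrow> G \<subseteq> B \<Longrightarrow> prob (B \<inter> pre j G) \<le> \<delta> * prob G"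
    and \<delta>: "\<delta> \<ge> 0" and F [measurable]: "F \<in> sets M"
  shows "prob (avoids B m \<inter> pre (m + 2 * J) F)
           \<le> ((1 - (prob B - e)) ^ m + 3 * real J * \<delta>) * prob F"
proof -
  have B_sets [measurable]: "B \<in> sets M" using B by (auto simp: exp_mixing_set_def)
  define b where "b = prob B"
  have e0: "e \<ge> 0" using K e by simp
  have b01: "0 \<le> b" "b \<le> 1" by (auto simp: b_def)
  \<comment> \<open>The gap \<open>2 * J\<close> still leaves at least \<open>J\<close> steps
    between a return to \<open>B\<close> at a time \<open>j < J\<close> and the event
    \<open>F\<close>; the bound on \<open>prob (G j)\<close> needs them.\<close>
  define u where "u i = prob (avoids B i \<inter> pre (i + 2 * J) F)" for i
  have u_nonneg: "u i \<ge> 0" for i by (simp add: u_def)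
  have rec: "u (Suc i) \<le> (1 - (b - e)) * u i + real J * \<delta> * (b + e) * prob F" for i
  proof -
    define V where "V = pre (Suc i + 2 * J) F"
    define W where "W = {x \<in> space M. \<forall>k\<in>{1..i}. (f ^^ k) x \<notin> B} \<inter> V"
    have V_sets [measurable]: "V \<in> sets M" unfolding V_def by auto
    have W_sets [measurable]: "W \<in> sets M" unfolding W_def using never_sets[OF B_sets] by auto
    have "W = pre 1 (avoids B i \<inter> pre (i + 2 * J) F)"
    proof -
      have "(\<forall>k\<in>{1..i}. (f ^^ k) x \<notin> B) = (\<forall>k<i. (f ^^ k) (f x) \<notin> B)" for x
      proof
        assume *: "\<forall>k<i. (f ^^ k) (f x) \<notin> B"
        show "\<forall>k\<in>{1..i}. (f ^^ k) x \<notin> B"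
        proof
          fix k assume "k \<in> {1..i}"
          then obtain k' where "k = Suc k'" "k' < i" by (cases k) auto
          then show "(f ^^ k) x \<notin> B" using * by (metis funpow_f)
        qed
      next
        assume *: "\<forall>k\<in>{1..i}. (f ^^ k) x \<notin> B"
        show "\<forall>k<i. (f ^^ k) (f x) \<notin> B"
        proof (intro allI impI)
          fix k assume "k < i"
          then have "Suc k \<in> {1..i}" by auto
          then show "(f ^^ k) (f x) \<notin> B" using * by (metis funpow_f)
        qed
      qed
      then show ?thesis
        using measurable_space[OF f_measurable]
        by (auto simp: W_def V_def avoids_def funpow_f funpow_funpow
            simp del: funpow.simps intro: funpow_space)
    qed
    moreover have "avoids B i \<inter> pre (i + 2 * J) F \<in> sets M" by auto
    ultimately have W_prob: "prob W = u i"
      unfolding u_def by (simp only: prob_pre)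
    have "avoids B (Suc i) \<inter> V = W - (B \<inter> W)"
    proof -
      have "(\<forall>k<Suc i. (f ^^ k) x \<notin> B) = (x \<notin> B \<and> (\<forall>k\<in>{1..i}. (f ^^ k) x \<notin> B))" for x
      proof -
        have "{..<Suc i} = insert 0 {1..i}" by auto
        then have "(\<forall>k\<in>{..<Suc i}. (f ^^ k) x \<notin> B) = (x \<notin> B \<and> (\<forall>k\<in>{1..i}. (f ^^ k) x \<notin> B))"
          by auto
        then show ?thesis by auto
      qed
      then show ?thesis by (auto simp: avoids_def W_def)
    qed
    then have dec: "u (Suc i) = u i - prob (B \<inter> W)"
      unfolding u_def V_def[symmetric] W_prob[unfolded u_def, symmetric]
      by (simp add: finite_measure_Diff)
    \<comment> \<open>Forgetting the times \<open>1..<J\<close> puts a gap of \<open>J\<close> steps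
      between \<open>B\<close> and the rest. The price is the returns at exactly these times, which
      the sets \<open>G j\<close> collect.\<close>
    define H where "H = {x \<in> space M. \<forall>k. k + J \<le> i \<longrightarrow> (f ^^ k) x \<notin> B} \<inter> pre (Suc i + J) F"
    have H_sets [measurable]: "H \<in> sets M" unfolding H_def using never_sets[OF B_sets, of "{k. k + J \<le> i}"] by auto
    define G where "G j = B \<inter> pre (Suc i + 2 * J - j) F" for j
    have G_sets [measurable]: "G j \<in> sets M" for j unfolding G_def by auto
    have H_prob: "u i \<le> prob H"
    proof -
      have "W \<subseteq> pre J H"
      proof
        fix x assume x: "x \<in> W"
        then have xs: "x \<in> space M" and xV: "(f ^^ (Suc i + 2 * J)) x \<in> F"
          and xB: "\<And>k. k \<in> {1..i} \<Longrightarrow> (f ^^ k) x \<notin> B" by (auto simp: W_def V_def)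
        show "x \<in> pre J H"
        proof -
          have "(f ^^ k) ((f ^^ J) x) \<notin> B" if "k + J \<le> i" for k
            using xB[of "k + J"] that J by (simp add: funpow_funpow)
          moreover have "(f ^^ (Suc i + J)) ((f ^^ J) x) \<in> F"
            using xV by (simp add: funpow_funpow mult_2 add.assoc del: funpow.simps)
          ultimately show ?thesis using xs funpow_space[OF xs] by (auto simp: H_def)
        qed
      qed
      then have "prob W \<le> prob (pre J H)" by (intro finite_measure_mono) auto
      then show ?thesis by (simp add: prob_pre W_prob)
    qed
    have "B \<inter> pre J H \<subseteq> (B \<inter> W) \<union> (\<Union>j\<in>{1..<J}. B \<inter> pre j (G j))"
    proof
      fix x assume x: "x \<in> B \<inter> pre J H"
      then have xs: "x \<in> space M" by auto
      have V: "(f ^^ (Suc i + 2 * J)) x \<in> F"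
        using x by (simp add: H_def funpow_funpow mult_2 add.assoc del: funpow.simps)
      have late: "(f ^^ (k + J)) x \<notin> B" if "k + J \<le> i" for k
        using x that by (simp add: H_def funpow_funpow)
      show "x \<in> (B \<inter> W) \<union> (\<Union>j\<in>{1..<J}. B \<inter> pre j (G j))"
      proof (cases "x \<in> W")
        case False
        then obtain k where k: "k \<in> {1..i}" "(f ^^ k) x \<in> B"
          using xs V by (auto simp: W_def V_def)
        then have "k < J" using late[of "k - J"] by (cases "k < J") auto
        have "(f ^^ (Suc i + 2 * J - k)) ((f ^^ k) x) \<in> F"
          using V \<open>k < J\<close> by (simp add: funpow_funpow del: funpow.simps)
        then have "x \<in> B \<inter> pre k (G k)"
          using x k funpow_space[OF xs] by (auto simp: G_def)
        then show ?thesis using k \<open>k < J\<close> by auto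
      qed (use x in auto)
    qed
    then have "prob (B \<inter> pre J H) \<le> prob ((B \<inter> W) \<union> (\<Union>j\<in>{1..<J}. B \<inter> pre j (G j)))"
      by (intro finite_measure_mono) auto
    also have "\<dots> \<le> prob (B \<inter> W) + prob (\<Union>j\<in>{1..<J}. B \<inter> pre j (G j))"
      by (intro measure_Un_le) auto
    also have "prob (\<Union>j\<in>{1..<J}. B \<inter> pre j (G j)) \<le> (\<Sum>j\<in>{1..<J}. prob (B \<inter> pre j (G j)))"
      by (intro measure_UNION_le) auto
    also have "\<dots> \<le> (\<Sum>j\<in>{1..<J}. \<delta> * ((b + e) * prob F))"
    proof (rule sum_mono)
      fix j assume j: "j \<in> {1..<J}"
      have "prob (B \<inter> pre j (G j)) \<le> \<delta> * prob (G j)"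
        using j by (intro short) (auto simp: G_def)
      also have "prob (G j) \<le> (b + e) * prob F"
        unfolding G_def b_def e(1) using j K by (intro exp_mixing_setD(1)[OF B]) auto
      finally show "prob (B \<inter> pre j (G j)) \<le> \<delta> * ((b + e) * prob F)"
        using \<delta> by (simp add: mult_left_mono)
    qed
    also have "\<dots> \<le> real J * (\<delta> * ((b + e) * prob F))"
      using \<delta> b01 e0 by (auto intro!: mult_right_mono)
    finally have "prob (B \<inter> pre J H) - real J * (\<delta> * ((b + e) * prob F)) \<le> prob (B \<inter> W)"
      by linarith
    moreover have "(b - e) * u i \<le> prob (B \<inter> pre J H)"
    proof -
      have "(b - e) * u i \<le> (b - e) * prob H"
        using H_prob e(2) e0 by (intro mult_left_mono) (auto simp: b_def)
      also have "\<dots> \<le> prob (B \<inter> pre J H)"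
        unfolding b_def e(1) by (rule exp_mixing_setD(2)[OF B]) (use K in auto)
      finally show ?thesis .
    qed
    ultimately show ?thesis using dec by (simp add: algebra_simps)
  qed
  have "u i \<le> ((1 - (b - e)) ^ i + 3 * real J * \<delta>) * prob F" for i
  proof (induction i)
    case 0
    have "u 0 \<le> prob (pre (2 * J) F)" unfolding u_def by (intro finite_measure_mono) auto
    also have "\<dots> = prob F" by (rule prob_pre) simp
    finally have "u 0 \<le> 1 * prob F" by simp
    also have "\<dots> \<le> (1 + 3 * real J * \<delta>) * prob F"
      using \<delta> by (intro mult_right_mono) auto
    finally show ?case by simp
  next
    case (Suc i)
    define q where "q = b - e"
    \<comment> \<open>From \<open>2 * e \<le> b\<close> one gets
      \<open>b + e \<le> 3 * (b - e)\<close>; this makes \<open>3 * real J * \<delta>\<close> a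
      fixed point of the additive part of the recursion.\<close>
    have q: "0 \<le> q" "q \<le> 1" "b + e \<le> 3 * q" using e(2) e0 b01 by (auto simp: q_def b_def[symmetric])
    have "u (Suc i) \<le> (1 - q) * u i + real J * \<delta> * (b + e) * prob F"
      using rec by (simp add: q_def)
    also have "\<dots> \<le> (1 - q) * (((1 - q) ^ i + 3 * real J * \<delta>) * prob F) + real J * \<delta> * (3 * q) * prob F"
      using Suc q \<delta> by (intro add_mono mult_left_mono mult_right_mono) (auto simp: q_def)
    also have "\<dots> = ((1 - q) ^ Suc i + 3 * real J * \<delta>) * prob F"
      by (simp add: algebra_simps)
    finally show ?case by (simp add: q_def)
  qed
  then show ?thesis by (simp add: u_def b_def)
qed

text \<open>Here short returns only help: the event whose probability is subtracted grows when the
  times \<open>1..<J\<close> are forgotten, so mixing alone suffices. The term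
  \<open>real J * prob B\<close> pays for comparing avoidance over \<open>Suc i - J\<close> and over
  \<open>i\<close> steps, and it is reproduced by the recursion.\<close>

lemma avoids_lower_bound:
  assumes B: "exp_mixing_set K \<tau> B" and K: "K \<ge> 0" "\<tau> \<ge> 0"
    and e: "e = K * exp (- \<tau> * real J)" "prob B + e \<le> 1" and J: "J \<ge> 1"
  shows "prob (avoids B m) \<ge> (1 - (prob B + e)) ^ m - real J * prob B"
proof -
  have B_sets [measurable]: "B \<in> sets M" using B by (auto simp: exp_mixing_set_def)
  define b where "b = prob B"
  define a where "a i = prob (avoids B i)" for i
  have e0: "e \<ge> 0" using K e by simp
  have b0: "0 \<le> b" by (auto simp: b_def)
  have shift: "a k \<le> a (k + l) + real l * b" for k l
  proof -
    have "avoids B k \<subseteq> avoids B (k + l) \<union> (\<Union>j\<in>{k..<k + l}. pre j B)"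
      by (fastforce simp: avoids_def not_less)
    then have "a k \<le> prob (avoids B (k + l) \<union> (\<Union>j\<in>{k..<k + l}. pre j B))"
      unfolding a_def by (intro finite_measure_mono) auto
    also have "\<dots> \<le> a (k + l) + prob (\<Union>j\<in>{k..<k + l}. pre j B)"
      unfolding a_def by (intro measure_Un_le) auto
    also have "prob (\<Union>j\<in>{k..<k + l}. pre j B) \<le> (\<Sum>j\<in>{k..<k + l}. prob (pre j B))"
      by (intro measure_UNION_le) auto
    also have "\<dots> = real l * b" by (simp add: prob_pre b_def)
    finally show ?thesis by simp
  qed
  have rec: "a (Suc i) \<ge> (1 - (b + e)) * a i - (b + e) * (real J * b)" for i
  proof -
    \<comment> \<open>A point that avoids \<open>B\<close> at times \<open>1..i\<close> but not at
      \<open>0..i\<close> starts in \<open>B\<close>. For \<open>Suc i \<le> J\<close> the truncated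
      difference \<open>Suc i - J\<close> is 0 and no condition on the future is left.\<close>
    have "pre 1 (avoids B i) - avoids B (Suc i) \<subseteq> B \<inter> pre J (avoids B (Suc i - J))"
    proof
      fix x assume x: "x \<in> pre 1 (avoids B i) - avoids B (Suc i)"
      then have xs: "x \<in> space M" by auto
      have later: "(f ^^ Suc k) x \<notin> B" if "k < i" for k
        using x that by (auto simp: avoids_def funpow_funpow simp del: funpow.simps)
      obtain k where "k < Suc i" "(f ^^ k) x \<in> B"
        using x xs by (auto simp: avoids_def)
      then have xB: "x \<in> B" using later[of "k - 1"] by (cases k) auto
      have "(f ^^ k) ((f ^^ J) x) \<notin> B" if "k < Suc i - J" for k
        using later[of "k + J - 1"] that J by (simp add: funpow_funpow del: funpow.simps(2))
      then show "x \<in> B \<inter> pre J (avoids B (Suc i - J))"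
        using xB xs funpow_space by (auto simp: avoids_def)
    qed
    then have "prob (pre 1 (avoids B i)) \<le> prob (avoids B (Suc i) \<union> (B \<inter> pre J (avoids B (Suc i - J))))"
      by (intro finite_measure_mono) auto
    also have "\<dots> \<le> a (Suc i) + prob (B \<inter> pre J (avoids B (Suc i - J)))"
      unfolding a_def by (intro measure_Un_le) auto
    also have "prob (B \<inter> pre J (avoids B (Suc i - J))) \<le> (b + e) * a (Suc i - J)"
      unfolding b_def e(1) a_def using K by (intro exp_mixing_setD(1)[OF B]) auto
    also have "a (Suc i - J) \<le> a i + real (i - (Suc i - J)) * b"
      using shift[of "Suc i - J" "i - (Suc i - J)"] J by simp
    also have "real (i - (Suc i - J)) * b \<le> real J * b"
      using b0 by (intro mult_right_mono) auto
    finally have "a i \<le> a (Suc i) + (b + e) * (a i + real J * b)"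
      using b0 e0 prob_pre[of "avoids B i" 1] avoids_sets[OF B_sets, of i]
      by (simp add: a_def mult_left_mono)
    then show ?thesis by (simp add: algebra_simps)
  qed
  have "a i \<ge> (1 - (b + e)) ^ i - real J * b" for i
  proof (induction i)
    case 0
    then show ?case using b0 by (simp add: a_def prob_space)
  next
    case (Suc i)
    define q where "q = b + e"
    have "(1 - q) * ((1 - q) ^ i - real J * b) \<le> (1 - q) * a i"
      using Suc e(2) by (intro mult_left_mono) (auto simp: q_def b_def)
    then show ?case using rec[of i] by (simp add: q_def[symmetric] algebra_simps)
  qed
  then show ?thesis by (simp add: a_def b_def)
qed

end

section \<open>Shrinking targets\<close>

lemma mult_exp_neg_antimono:
  fixes x y :: real assumes "1 \<le> x" "x \<le> y"
  shows "y * exp (- y) \<le> x * exp (- x)"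
proof -
  have "y \<le> x * (1 + (y - x))"
    using mult_nonneg_nonneg[of "x - 1" "y - x"] assms by (simp add: algebra_simps)
  also have "\<dots> \<le> x * exp (y - x)"
    using assms exp_ge_add_one_self[of "y - x"] by (intro mult_left_mono) auto
  finally have "y * exp (- y) \<le> x * exp (y - x) * exp (- y)"
    by (intro mult_right_mono) auto
  also have "\<dots> = x * exp ((y - x) + (- y))" by (simp only: exp_add mult.assoc)
  finally show ?thesis by simp
qed

text \<open>A Riemann sum with mesh \<open>x\<close> for the integral of the decaying exponential,
  hence bounded independently of \<open>I\<close>; \<open>x / (1 - exp (- x)) \<le> 1 + x\<close> is
  a form of \<open>1 + x \<le> exp x\<close>.\<close>

lemma sum_exp_neg_le:
  fixes x :: real assumes "x > 0" "finite I"
  shows "x * (\<Sum>i\<in>I. exp (- (real i * x))) \<le> 1 + x"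
proof -
  define q where "q = exp (- x)"
  have q: "0 < q" "q < 1" using assms by (auto simp: q_def)
  have "(\<Sum>i\<in>I. exp (- (real i * x))) = (\<Sum>i\<in>I. q ^ i)"
    by (intro sum.cong) (auto simp: q_def exp_of_nat_mult[symmetric])
  also have "\<dots> \<le> (\<Sum>i. q ^ i)"
    using q assms by (intro sum_le_suminf summable_geometric) auto
  also have "\<dots> = 1 / (1 - q)" using q by (intro suminf_geometric) auto
  finally have *: "(\<Sum>i\<in>I. exp (- (real i * x))) \<le> 1 / (1 - q)" .
  have "x \<le> (1 + x) * (1 - q)"
    using exp_ge_add_one_self[of x] assms by (simp add: q_def exp_minus field_simps)
  then have "x * (1 / (1 - q)) \<le> 1 + x" using q by (simp add: field_simps)
  with * assms show ?thesis by (smt (verit) mult_left_mono)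
qed

lemma one_minus_power_ge_exp:
  fixes q :: real assumes "0 \<le> q" "q \<le> 1 / 2"
  shows "(1 - q) ^ n \<ge> exp (- (real n * (q + 2 * q\<^sup>2)))"
proof -
  have "exp (- (q + 2 * q\<^sup>2)) \<le> 1 - q"
  proof -
    have "1 \<le> (1 - q) * (1 + (q + 2 * q\<^sup>2))"
    proof -
      have "(1 - q) * (1 + (q + 2 * q\<^sup>2)) - 1 = q\<^sup>2 * (1 - 2 * q)"
        by (simp add: algebra_simps power2_eq_square)
      also have "\<dots> \<ge> 0" using assms by (intro mult_nonneg_nonneg) auto
      finally show ?thesis by simp
    qed
    also have "\<dots> \<le> (1 - q) * exp (q + 2 * q\<^sup>2)"
      using assms exp_ge_add_one_self[of "q + 2 * q\<^sup>2"] by (intro mult_left_mono) auto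
    finally show ?thesis by (simp only: exp_minus) (simp add: field_simps)
  qed
  then have "exp (- (q + 2 * q\<^sup>2)) ^ n \<le> (1 - q) ^ n" by (intro power_mono) auto
  then show ?thesis by (simp add: exp_of_nat_mult[symmetric] algebra_simps)
qed

text \<open>The bound on short returns is uniform in \<open>G\<close>: this is what makes avoiding \<open>B m\<close> early and
  avoiding \<open>B n\<close> much later quasi-independent with a multiplicative error.\<close>
locale shrinking_targets = measure_preserving_system M f for M :: "'a measure" and f +
  fixes B :: "nat \<Rightarrow> 'a set" and K \<tau> D \<theta> :: real
  assumes K_pos: "K > 0" and \<tau>_pos: "\<tau> > 0" and D_nonneg: "D \<ge> 0" and \<theta>_pos: "\<theta> > 0"
    and mixing: "\<And>n. n \<ge> 1 \<Longrightarrow> exp_mixing_set K \<tau> (B n)"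
    and decreasing: "\<And>m n. 1 \<le> m \<Longrightarrow> m \<le> n \<Longrightarrow> B n \<subseteq> B m"
    and short_returns: "eventually (\<lambda>n. \<forall>j\<ge>1. \<forall>G\<in>sets M. G \<subseteq> B n \<longrightarrow>
       prob (B n \<inter> pre j G) \<le> D * real n powr (- \<theta>) * prob G) sequentially"
    and monotone: "mono_on {1..} (\<lambda>n. real n * prob (B n))"
    and B1_pos: "prob (B 1) > 0"
begin

definition b where "b n = prob (B n)"
definition c where "c n = real n * b n"
text \<open>Long enough for \<open>exp (- \<tau> * gap n) \<le> 1 / n^2\<close>. The square keeps
  \<open>n * e n\<close> bounded and makes \<open>e n\<close> negligible against \<open>b n\<close>,
  which is at least \<open>b 1 / n\<close>.\<close>

definition gap where "gap n = nat \<lceil>2 / \<tau> * ln (real n)\<rceil> + 1"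
definition e where "e n = K * exp (- \<tau> * real (gap n))"
text \<open>The exponent of the final errors. Being smaller than \<open>\<theta>\<close> it lets
  \<open>n powr (\<theta> - \<kappa>)\<close> absorb the logarithmic factor \<open>gap n\<close>;
  being smaller than 1 it does the same for the loss \<open>gap n * b n\<close> when
  \<open>c n \<le> \<kappa> * ln n\<close>.\<close>

definition \<kappa> where "\<kappa> = min (\<theta> / 2) (1 / 2)"

lemma \<kappa>: "0 < \<kappa>" "\<kappa> \<le> 1 / 2" "\<kappa> < \<theta>"
  using \<theta>_pos by (auto simp: \<kappa>_def)

lemma B_sets: "n \<ge> 1 \<Longrightarrow> B n \<in> sets M"
  using mixing by (auto simp: exp_mixing_set_def)

lemma b_nonneg: "b n \<ge> 0" by (simp add: b_def)

lemma b_decreasing: "1 \<le> m \<Longrightarrow> m \<le> n \<Longrightarrow> b n \<le> b m"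
  unfolding b_def using B_sets decreasing by (intro finite_measure_mono) auto

lemma c_mono: "1 \<le> m \<Longrightarrow> m \<le> n \<Longrightarrow> c m \<le> c n"
  using monotone by (auto simp: c_def b_def monotone_on_def)

lemma c_ge: "1 \<le> n \<Longrightarrow> b 1 \<le> c n" and b1_pos: "b 1 > 0"
  using c_mono[of 1 n] B1_pos by (auto simp: c_def b_def)

lemma b_eq: "n \<ge> 1 \<Longrightarrow> b n = c n / real n"
  by (simp add: c_def)

lemma b_pos: "n \<ge> 1 \<Longrightarrow> b n > 0"
  using c_ge[of n] b1_pos b_eq[of n] by simp

lemma gap_bounds: "n \<ge> 1 \<Longrightarrow> 2 / \<tau> * ln (real n) \<le> real (gap n)"
  "n \<ge> 1 \<Longrightarrow> real (gap n) \<le> 2 / \<tau> * ln (real n) + 2"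
proof -
  assume "n \<ge> 1"
  then have "0 \<le> 2 / \<tau> * ln (real n)" using \<tau>_pos by simp
  then show "2 / \<tau> * ln (real n) \<le> real (gap n)" "real (gap n) \<le> 2 / \<tau> * ln (real n) + 2"
    unfolding gap_def by linarith+
qed

lemma e_nonneg: "e n \<ge> 0" using K_pos by (simp add: e_def)

lemma e_le: assumes "n \<ge> 1" shows "e n \<le> K / (real n)\<^sup>2"
proof -
  have "2 * ln (real n) \<le> \<tau> * real (gap n)"
    using gap_bounds(1)[OF assms] \<tau>_pos by (simp add: field_simps)
  then have "exp (- \<tau> * real (gap n)) \<le> exp (- (2 * ln (real n)))" by simp
  also have "\<dots> = 1 / (real n)\<^sup>2"
    using assms exp_of_nat_mult[of 2 "ln (real n)"] by (simp add: exp_minus field_simps)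
  finally show ?thesis using K_pos mult_left_mono[of _ "1 / (real n)\<^sup>2" K] by (simp add: e_def)
qed

text \<open>Collects the finitely many asymptotic inequalities behind the estimates below, so that
  each estimate can be stated for one index instead of eventually.\<close>

definition large where
  "large n \<longleftrightarrow> n \<ge> 3 \<and> real n * e n \<le> 1 \<and> 2 * e n \<le> b n \<and>
     3 * real (gap n) * (D * real n powr (- \<theta>)) \<le> real n powr (- \<kappa>) \<and>
     2 * real (gap n) * (\<kappa> * ln (real n) / real n) \<le> 1 \<and>
     real (gap n) * (\<kappa> * ln (real n) / real n) \<le> real n powr (- \<kappa>) / 4 \<and>
     \<kappa> * ln (real n) / real n + K / (real n)\<^sup>2 \<le> 1 / 2 \<and>
     K / real n + 2 * real n * (\<kappa> * ln (real n) / real n + K / (real n)\<^sup>2)\<^sup>2 \<le> 1 / 2 \<and>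
     1 \<le> \<kappa> * ln (real n) \<and>
     (\<forall>j\<ge>1. \<forall>G\<in>sets M. G \<subseteq> B n \<longrightarrow>
       prob (B n \<inter> pre j G) \<le> D * real n powr (- \<theta>) * prob G)"

lemma largeD:
  assumes "large n"
  shows "n \<ge> 3" "real n * e n \<le> 1" "2 * e n \<le> b n"
    "3 * real (gap n) * (D * real n powr (- \<theta>)) \<le> real n powr (- \<kappa>)"
    "2 * real (gap n) * (\<kappa> * ln (real n) / real n) \<le> 1"
    "real (gap n) * (\<kappa> * ln (real n) / real n) \<le> real n powr (- \<kappa>) / 4"
    "\<kappa> * ln (real n) / real n + K / (real n)\<^sup>2 \<le> 1 / 2"
    "K / real n + 2 * real n * (\<kappa> * ln (real n) / real n + K / (real n)\<^sup>2)\<^sup>2 \<le> 1 / 2"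
    "1 \<le> \<kappa> * ln (real n)"
    "\<And>j G. j \<ge> 1 \<Longrightarrow> G \<in> sets M \<Longrightarrow> G \<subseteq> B n \<Longrightarrow>
       prob (B n \<inter> pre j G) \<le> D * real n powr (- \<theta>) * prob G"
  using assms unfolding large_def by blast+

lemma eventually_large: "eventually large sequentially"
proof -
  note k = \<kappa> K_pos \<tau>_pos D_nonneg \<theta>_pos
  have 1: "eventually (\<lambda>n::nat. K / real n \<le> 1) sequentially" using k by real_asymp
  have "eventually (\<lambda>n::nat. 2 * K / real n \<le> \<beta>) sequentially" if "\<beta> > 0" for \<beta>
    using k that by real_asymp
  then have 2: "eventually (\<lambda>n::nat. 2 * K / real n \<le> b 1) sequentially" using b1_pos by blast
  have 3: "eventually (\<lambda>n::nat. 3 * (2 / \<tau> * ln (real n) + 2) * (D * real n powr (- \<theta>)) \<le> real n powr (- \<kappa>)) sequentially"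
    using k by real_asymp
  have 4: "eventually (\<lambda>n::nat. 2 * (2 / \<tau> * ln (real n) + 2) * (\<kappa> * ln (real n) / real n) \<le> 1) sequentially"
    using k by real_asymp
  have 5: "eventually (\<lambda>n::nat. (2 / \<tau> * ln (real n) + 2) * (\<kappa> * ln (real n) / real n) \<le> real n powr (- \<kappa>) / 4) sequentially"
    using k by real_asymp
  have 6: "eventually (\<lambda>n::nat. \<kappa> * ln (real n) / real n + K / (real n)\<^sup>2 \<le> 1 / 2) sequentially"
    using k by real_asymp
  have 7: "eventually (\<lambda>n::nat. K / real n + 2 * real n * (\<kappa> * ln (real n) / real n + K / (real n)\<^sup>2)\<^sup>2 \<le> 1 / 2) sequentially"
    using k by real_asymp
  have 8: "eventually (\<lambda>n::nat. 1 \<le> \<kappa> * ln (real n)) sequentially" using k by real_asymp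
  show ?thesis
    using 1 2 3 4 5 6 7 8 short_returns eventually_ge_at_top[of 3]
  proof eventually_elim
    case (elim n)
    then have n: "n \<ge> 1" by simp
    have l: "0 \<le> ln (real n)" using n by simp
    have g: "real (gap n) \<le> 2 / \<tau> * ln (real n) + 2" using gap_bounds(2)[OF n] .
    have en: "e n \<le> K / (real n)\<^sup>2" using e_le[OF n] .
    have "real n * e n \<le> real n * (K / (real n)\<^sup>2)" using en by (intro mult_left_mono) auto
    also have "\<dots> = K / real n" using n by (simp add: power2_eq_square)
    also have "\<dots> \<le> 1" using elim(1) .
    finally have a: "real n * e n \<le> 1" .
    have "2 * e n \<le> (2 * K / real n) / real n" using en by (simp add: power2_eq_square)
    also have "\<dots> \<le> b 1 / real n" using elim by (intro divide_right_mono) auto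
    also have "\<dots> \<le> b n" using b_eq[OF n] c_ge[OF n] by (simp add: divide_right_mono)
    finally have bb: "2 * e n \<le> b n" .
    have cc: "3 * real (gap n) * (D * real n powr (- \<theta>)) \<le> 3 * (2 / \<tau> * ln (real n) + 2) * (D * real n powr (- \<theta>))"
      using g D_nonneg by (intro mult_right_mono) auto
    have t: "0 \<le> \<kappa> * ln (real n) / real n" using \<kappa> l by simp
    have dd: "real (gap n) * (\<kappa> * ln (real n) / real n) \<le> (2 / \<tau> * ln (real n) + 2) * (\<kappa> * ln (real n) / real n)"
      using g t by (intro mult_right_mono) auto
    show ?case
      using order.trans[OF cc elim(3)] elim(4-10) a bb dd
      unfolding large_def by (intro conjI) (simp only: | linarith)+
  qed
qed

end

text \<open>A weighted Borel-Cantelli lemma: the random series has finite expectation. Since the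
  weights may tend to 0, it yields convergence of the series and not yet finiteness of the number of
  events.\<close>

lemma (in prob_space) AE_summable_weighted_indicator:
  assumes A [measurable]: "\<And>n. A n \<in> events" and w: "\<And>n. w n \<ge> 0"
    and sum: "summable (\<lambda>n. w n * prob (A n))"
  shows "AE x in M. summable (\<lambda>n. w n * indicator (A n) x :: real)"
proof -
  have "(\<integral>\<^sup>+x. (\<Sum>n. ennreal (w n * indicator (A n) x)) \<partial>M) = (\<Sum>n. \<integral>\<^sup>+x. ennreal (w n * indicator (A n) x) \<partial>M)"
    by (rule nn_integral_suminf) measurable
  also have "\<dots> = (\<Sum>n. ennreal (w n * prob (A n)))"
  proof (rule suminf_cong)
    fix n
    have "(\<integral>\<^sup>+x. ennreal (w n * indicator (A n) x) \<partial>M) = (\<integral>\<^sup>+x. ennreal (w n) * indicator (A n) x \<partial>M)"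
      by (intro nn_integral_cong) (auto split: split_indicator)
    also have "\<dots> = ennreal (w n * prob (A n))"
      by (subst nn_integral_cmult_indicator) (auto simp: emeasure_eq_measure ennreal_mult w)
    finally show "(\<integral>\<^sup>+x. ennreal (w n * indicator (A n) x) \<partial>M) = ennreal (w n * prob (A n))" .
  qed
  also have "\<dots> = ennreal (\<Sum>n. w n * prob (A n))"
    using w sum by (intro suminf_ennreal2) auto
  finally have "(\<integral>\<^sup>+x. (\<Sum>n. ennreal (w n * indicator (A n) x)) \<partial>M) \<noteq> \<infinity>" by simp
  then have "AE x in M. (\<Sum>n. ennreal (w n * indicator (A n) x)) \<noteq> \<infinity>"
    by (intro nn_integral_noteq_infinite) auto
  then show ?thesis
    by eventually_elim (use w in \<open>auto intro!: summable_suminf_not_top\<close>)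
qed

text \<open>The second moment method, with \<open>z \<le> z\<^sup>2/(2t) + t/2\<close> in place of the Cauchy-Schwarz inequality.\<close>
lemma (in prob_space) second_moment_union:
  assumes S: "finite S" and A [measurable]: "\<And>n. n \<in> S \<Longrightarrow> A n \<in> events"
    and t: "t > 0"
  shows "(\<Sum>n\<in>S. w n * prob (A n))
           \<le> (\<Sum>m\<in>S. \<Sum>n\<in>S. w m * w n * prob (A m \<inter> A n)) / (2 * t) + t / 2 * prob (\<Union>n\<in>S. A n)"
proof -
  define Z where "Z x = (\<Sum>n\<in>S. w n * indicator (A n) x :: real)" for x
  have Z2: "(Z x)\<^sup>2 = (\<Sum>m\<in>S. \<Sum>n\<in>S. w m * w n * indicator (A m \<inter> A n) x)" for x
    unfolding Z_def power2_eq_square sum_product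
    by (intro sum.cong refl) (auto split: split_indicator)
  have U: "(\<Union>n\<in>S. A n) \<in> events" using S by auto
  have I: "integrable M (indicat_real (A n))" "integrable M (indicat_real (A m \<inter> A n))"
    if "m \<in> S" "n \<in> S" for m n using that by (auto simp: emeasure_eq_measure)
  have J: "integrable M (\<lambda>x. \<Sum>m\<in>S. \<Sum>n\<in>S. w m * w n * indicat_real (A m \<inter> A n) x)"
    "integrable M (indicat_real (\<Union>n\<in>S. A n))"
    using U by (auto intro!: Bochner_Integration.integrable_sum integrable_mult_right I simp: emeasure_eq_measure)
  have "Z x \<le> (\<Sum>m\<in>S. \<Sum>n\<in>S. w m * w n * indicator (A m \<inter> A n) x) / (2 * t) + t / 2 * indicator (\<Union>n\<in>S. A n) x" for x
  proof (cases "x \<in> (\<Union>n\<in>S. A n)")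
    case True
    have "0 \<le> (Z x - t)\<^sup>2" by simp
    then have "Z x \<le> (Z x)\<^sup>2 / (2 * t) + t / 2"
      using t by (simp add: field_simps power2_eq_square)
    then show ?thesis using True by (simp add: Z2)
  next
    case False
    then have "Z x = 0" by (auto simp: Z_def intro!: sum.neutral)
    then show ?thesis using False t Z2[of x] by simp
  qed
  then have "(\<integral>x. Z x \<partial>M) \<le> (\<integral>x. (\<Sum>m\<in>S. \<Sum>n\<in>S. w m * w n * indicator (A m \<inter> A n) x) / (2 * t) + t / 2 * indicator (\<Union>n\<in>S. A n) x \<partial>M)"
    unfolding Z_def
    by (intro integral_mono Bochner_Integration.integrable_add Bochner_Integration.integrable_sum
        integrable_divide integrable_mult_right I J)
  also have "\<dots> = (\<Sum>m\<in>S. \<Sum>n\<in>S. w m * w n * prob (A m \<inter> A n)) / (2 * t) + t / 2 * prob (\<Union>n\<in>S. A n)"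
  proof -
    have "(\<integral>x. (\<Sum>m\<in>S. \<Sum>n\<in>S. w m * w n * indicat_real (A m \<inter> A n) x) \<partial>M)
        = (\<Sum>m\<in>S. \<Sum>n\<in>S. w m * w n * prob (A m \<inter> A n))"
      by (subst Bochner_Integration.integral_sum, (intro Bochner_Integration.integrable_sum integrable_mult_right I; assumption),
          intro sum.cong refl, subst Bochner_Integration.integral_sum, (intro integrable_mult_right I; assumption))
         (auto intro!: sum.cong)
    then show ?thesis
      using U J by (subst Bochner_Integration.integral_add) auto
  qed
  also have "(\<integral>x. Z x \<partial>M) = (\<Sum>n\<in>S. w n * prob (A n))"
    unfolding Z_def
    by (subst Bochner_Integration.integral_sum, (intro integrable_mult_right I; assumption)) auto
  finally show ?thesis .
qed

section \<open>Avoidance probabilities and the convergent case\<close>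

context shrinking_targets
begin

text \<open>The 3 bounds \<open>exp 1\<close>, which is the cost of replacing
  \<open>b n - e n\<close> by \<open>b n\<close> in the exponent over at most \<open>n\<close>
  steps, as \<open>n * e n \<le> 1\<close>.\<close>

lemma avoids_upper:
  assumes n: "large n" and m: "m \<le> n" and F: "F \<in> sets M"
  shows "prob (avoids (B n) m \<inter> pre (m + 2 * gap n) F)
           \<le> (3 * exp (- (real m * b n)) + real n powr (- \<kappa>)) * prob F"
proof -
  have n1: "n \<ge> 1" using largeD(1)[OF n] by simp
  have "prob (avoids (B n) m \<inter> pre (m + 2 * gap n) F)
      \<le> ((1 - (prob (B n) - e n)) ^ m + 3 * real (gap n) * (D * real n powr (- \<theta>))) * prob F"
    using n D_nonneg K_pos \<tau>_pos
    by (intro avoids_upper_bound[OF mixing[OF n1], where e = "e n"] largeD(10)[OF n] F)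
       (use largeD(3)[OF n] in \<open>auto simp: e_def b_def gap_def\<close>)
  also have "\<dots> \<le> (3 * exp (- (real m * b n)) + real n powr (- \<kappa>)) * prob F"
  proof (intro mult_right_mono add_mono)
    have "0 \<le> 1 - (b n - e n)" using e_nonneg[of n] prob_le_1[of "B n"] unfolding b_def by linarith
    moreover have "1 - (b n - e n) \<le> exp (- (b n - e n))"
      using exp_ge_add_one_self[of "- (b n - e n)"] by linarith
    ultimately have "(1 - (b n - e n)) ^ m \<le> exp (- (b n - e n)) ^ m" by (rule power_mono[rotated])
    also have "\<dots> = exp (real m * e n) * exp (- (real m * b n))"
      by (simp add: exp_of_nat_mult[symmetric] exp_add[symmetric] algebra_simps)
    also have "exp (real m * e n) \<le> exp 1"
    proof -
      have "real m * e n \<le> real n * e n" using m e_nonneg by (intro mult_right_mono) auto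
      then show ?thesis using largeD(2)[OF n] by simp
    qed
    also have "exp 1 \<le> (3::real)" by (rule exp_le)
    finally show "(1 - (prob (B n) - e n)) ^ m \<le> 3 * exp (- (real m * b n))"
      by (simp add: b_def)
  qed (use largeD(4)[OF n] in auto)
  finally show ?thesis .
qed

lemma avoids_upper':
  assumes n: "large n" and m: "m \<le> n"
  shows "prob (avoids (B n) m) \<le> 3 * exp (- (real m * b n)) + real n powr (- \<kappa>)"
proof -
  have "avoids (B n) m \<inter> pre (m + 2 * gap n) (space M) = avoids (B n) m"
    using funpow_space by (auto simp: avoids_def)
  then show ?thesis using avoids_upper[OF n m, of "space M"] by (simp add: prob_space)
qed

text \<open>Only below the logarithmic threshold is \<open>exp (- c n)\<close> at least
  \<open>n powr (- \<kappa>)\<close> and thus larger than the loss \<open>gap n * b n\<close>.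
  Passing from the power to the exponential keeps one half, and the loss takes away another
  quarter.\<close>

lemma avoids_lower:
  assumes n: "large n" and c: "c n \<le> \<kappa> * ln (real n)"
  shows "exp (- c n) / 4 \<le> prob (avoids (B n) n)"
proof -
  have n1: "n \<ge> 1" using largeD(1)[OF n] by simp
  have bn: "b n \<le> \<kappa> * ln (real n) / real n" unfolding b_eq[OF n1] using c n1 by (intro divide_right_mono) auto
  define q where "q = b n + e n"
  have q0: "0 \<le> q" using b_nonneg e_nonneg by (simp add: q_def)
  have q1: "q \<le> \<kappa> * ln (real n) / real n + K / (real n)\<^sup>2" using bn e_le[OF n1] by (simp add: q_def)
  have q2: "q \<le> 1 / 2" using q1 largeD(7)[OF n] by linarith
  have "q\<^sup>2 \<le> (\<kappa> * ln (real n) / real n + K / (real n)\<^sup>2)\<^sup>2" using q0 q1 by (intro power_mono) auto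
  then have "2 * real n * q\<^sup>2 \<le> 2 * real n * (\<kappa> * ln (real n) / real n + K / (real n)\<^sup>2)\<^sup>2"
    by (intro mult_left_mono) auto
  moreover have "real n * e n \<le> K / real n"
    using mult_left_mono[OF e_le[OF n1], of "real n"] n1 by (simp add: power2_eq_square)
  ultimately have "real n * e n + 2 * real n * q\<^sup>2 \<le> 1 / 2" using largeD(8)[OF n] by linarith
  then have "- c n - 1 / 2 \<le> - (real n * (q + 2 * q\<^sup>2))"
    by (simp add: q_def c_def algebra_simps)
  then have "exp (- c n - 1 / 2) \<le> (1 - q) ^ n"
    using one_minus_power_ge_exp[OF q0 q2, of n] by (meson exp_le_cancel_iff order.trans)
  moreover have "exp (- c n) / 2 \<le> exp (- c n - 1 / 2)"
  proof -
    have "1 / 2 \<le> exp (- 1 / 2 :: real)" using exp_ge_add_one_self[of "- 1 / 2 :: real"] by simp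
    then have "exp (- c n) * (1 / 2) \<le> exp (- c n) * exp (- 1 / 2)" by (intro mult_left_mono) auto
    then show ?thesis by (simp add: exp_add[symmetric])
  qed
  moreover have "real (gap n) * b n \<le> exp (- c n) / 4"
  proof -
    have "real (gap n) * b n \<le> real (gap n) * (\<kappa> * ln (real n) / real n)"
      using bn by (intro mult_left_mono) auto
    also have "\<dots> \<le> real n powr (- \<kappa>) / 4" by (rule largeD(6)[OF n])
    also have "real n powr (- \<kappa>) \<le> exp (- c n)" using c n1 by (simp add: powr_def)
    finally show ?thesis by simp
  qed
  moreover have "(1 - q) ^ n - real (gap n) * b n \<le> prob (avoids (B n) n)"
    unfolding q_def b_def
    using K_pos \<tau>_pos q2
    by (intro avoids_lower_bound[OF mixing[OF n1]]) (auto simp: e_def gap_def q_def b_def)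
  ultimately show ?thesis by linarith
qed

text \<open>Majorises both the weighted error terms and the part of the series where
  \<open>c n > \<kappa> * ln n\<close>, so that a cut at this threshold affects neither convergence
  nor divergence.\<close>

lemma summable_log_powr: "summable (\<lambda>n. \<kappa> * ln (real n) / real n * real n powr (- \<kappa>))"
proof (rule summable_comparison_test_ev)
  show "summable (\<lambda>n. real n powr (- 1 - \<kappa> / 2))"
    using \<kappa> by (simp add: summable_real_powr_iff)
  have "eventually (\<lambda>n. \<bar>\<kappa> * ln (real n) / real n * real n powr (- \<kappa>)\<bar> \<le> real n powr (- 1 - \<kappa> / 2)) sequentially"
    using \<kappa> by real_asymp
  then show "eventually (\<lambda>n. norm (\<kappa> * ln (real n) / real n * real n powr (- \<kappa>)) \<le> real n powr (- 1 - \<kappa> / 2)) sequentially"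
    by simp
qed

text \<open>If \<open>x\<close> avoids \<open>B n\<close> for \<open>n\<close> steps, then it avoids \<open>B n'\<close> for nearly \<open>n'\<close> steps, for all \<open>n'\<close> in a
  window of length about \<open>1 / w n\<close>; the weights \<open>w\<close> sum over such a window to at least a constant.\<close>
theorem eventually_hits:
  assumes sum: "summable (\<lambda>n. b n * exp (- c n))"
  shows "AE x in M. eventually (\<lambda>n. x \<notin> avoids (B n) n) sequentially"
proof -
  obtain N where N: "\<And>n. n \<ge> N \<Longrightarrow> large n"
    using eventually_large by (auto simp: eventually_sequentially)
  \<comment> \<open>With \<open>b n\<close> itself as the weight, the error term
    \<open>b n * n powr (- \<kappa>)\<close> could fail to be summable. The cap turns
    \<open>n * w n\<close> into \<open>min (c n) (\<kappa> * ln n)\<close>, which is still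
    non-decreasing.\<close>
  define w where "w n = min (b n) (\<kappa> * ln (real n) / real n)" for n
  define h where "h = min (b 1) 1"
  have h: "h > 0" using b1_pos by (simp add: h_def)
  have n1: "n \<ge> 3" "n \<ge> 1" "real n > 0" if "n \<ge> N" for n using largeD(1)[OF N[OF that]] by auto
  have nw: "real n * w n = min (c n) (\<kappa> * ln (real n))" if "n \<ge> N" for n
    using n1[OF that] by (simp add: w_def c_def min_mult_distrib_left)
  have nw_ge: "h \<le> real n * w n" if "n \<ge> N" for n
    using nw[OF that] c_ge[OF n1(2)[OF that]] largeD(9)[OF N[OF that]] by (auto simp: h_def)
  have w_pos: "w n > 0" if "n \<ge> N" for n
    using nw_ge[OF that] h n1[OF that] by (smt (verit) mult_nonneg_nonpos)
  have w_anti: "w n' \<le> w n" if "n \<ge> N" "n \<le> n'" for n n'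
  proof -
    have "exp 1 \<le> real n" using n1(1)[OF that(1)] exp_le by linarith
    then have "ln (real n') / real n' \<le> ln (real n) / real n"
      using that by (intro ln_x_over_x_mono) auto
    then have "\<kappa> * (ln (real n') / real n') \<le> \<kappa> * (ln (real n) / real n)"
      using \<kappa> by (intro mult_left_mono) auto
    moreover have "b n' \<le> b n" using n1[OF that(1)] that by (intro b_decreasing) auto
    ultimately show ?thesis by (auto simp: w_def min_def)
  qed
  have nw_mono: "real n * w n \<le> real n' * w n'" if "n \<ge> N" "n \<le> n'" for n n'
  proof -
    have "c n \<le> c n'" using n1[OF that(1)] that by (intro c_mono) auto
    moreover have "\<kappa> * ln (real n) \<le> \<kappa> * ln (real n')"
      using \<kappa> n1[OF that(1)] that by (intro mult_left_mono) auto
    ultimately show ?thesis using nw that by (auto simp: min_def)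
  qed
  \<comment> \<open>Giving up the last \<open>1 / w n\<close> steps costs at most a factor
    \<open>exp 1\<close> against \<open>exp (- (n * w n))\<close>, and it lets a single avoidance at
    time \<open>n\<close> put the point into \<open>A k\<close> for a whole window of
    \<open>k\<close> after \<open>n\<close>.\<close>
  define p where "p n = n - nat \<lfloor>1 / w n\<rfloor>" for n
  define A where "A n = (if n \<ge> N then avoids (B n) (p n) else {})" for n
  have A_sets: "A n \<in> sets M" for n using n1 B_sets by (auto simp: A_def)
  define g where "g n = (if n \<ge> N then w n else 0)" for n
  \<comment> \<open>The 9 is the 3 of \<open>avoids_upper'\<close> times the 3 that bounds
    \<open>exp 1\<close>. The 10 counts the error term nine times for indices where the weight is
    capped and once as the error of \<open>avoids_upper'\<close>.\<close>
  have prob_A: "w n * prob (A n) \<le> 9 * (b n * exp (- c n)) + 10 * (\<kappa> * ln (real n) / real n * real n powr (- \<kappa>))"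
    if "n \<ge> N" for n
  proof -
    have "prob (A n) \<le> 3 * exp (- (real (p n) * b n)) + real n powr (- \<kappa>)"
      using avoids_upper'[OF N[OF that], of "p n"] that by (simp add: A_def p_def)
    moreover have "exp (- (real (p n) * b n)) \<le> 3 * exp (- (real n * w n))"
    proof -
      have "real (nat \<lfloor>1 / w n\<rfloor>) \<le> 1 / w n" using w_pos[OF that] by simp
      then have "real n - 1 / w n \<le> real (p n)" unfolding p_def by linarith
      then have "(real n - 1 / w n) * w n \<le> real (p n) * w n"
        using w_pos[OF that] by (intro mult_right_mono) auto
      also have "\<dots> \<le> real (p n) * b n" by (intro mult_left_mono) (auto simp: w_def)
      finally have "real n * w n - 1 \<le> real (p n) * b n"
        using w_pos[OF that] by (simp add: left_diff_distrib)
      then have "exp (- (real (p n) * b n)) \<le> exp (1 + - (real n * w n))" by simp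
      also have "\<dots> \<le> 3 * exp (- (real n * w n))"
        unfolding exp_add using exp_le by (intro mult_right_mono) auto
      finally show ?thesis .
    qed
    ultimately have "prob (A n) \<le> 9 * exp (- (real n * w n)) + real n powr (- \<kappa>)" by linarith
    then have "w n * prob (A n) \<le> w n * (9 * exp (- (real n * w n)) + real n powr (- \<kappa>))"
      using w_pos[OF that] by (intro mult_left_mono) auto
    also have "\<dots> = 9 * (w n * exp (- (real n * w n))) + w n * real n powr (- \<kappa>)"
      by (simp add: algebra_simps)
    also have "w n * real n powr (- \<kappa>) \<le> \<kappa> * ln (real n) / real n * real n powr (- \<kappa>)"
      by (intro mult_right_mono) (auto simp: w_def)
    also have "w n * exp (- (real n * w n)) \<le> b n * exp (- c n) + \<kappa> * ln (real n) / real n * real n powr (- \<kappa>)"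
    proof (cases "c n \<le> \<kappa> * ln (real n)")
      case True
      then have "w n = b n" using n1[OF that] by (simp add: w_def c_def field_simps)
      then show ?thesis using \<kappa> n1[OF that] by (auto simp: c_def)
    next
      case False
      then have "w n = \<kappa> * ln (real n) / real n" using n1[OF that] by (simp add: w_def c_def field_simps)
      moreover have "exp (- (\<kappa> * ln (real n))) = real n powr (- \<kappa>)" using n1[OF that] by (simp add: powr_def)
      ultimately show ?thesis using n1[OF that] b_nonneg by simp
    qed
    finally show ?thesis by simp
  qed
  have "AE x in M. summable (\<lambda>n. g n * indicator (A n) x :: real)"
  proof (rule AE_summable_weighted_indicator)
    show "g n \<ge> 0" for n using w_pos[of n] by (auto simp: g_def less_imp_le)
    show "summable (\<lambda>n. g n * prob (A n))"
    proof (rule summable_comparison_test_ev)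
      show "summable (\<lambda>n. 9 * (b n * exp (- c n)) + 10 * (\<kappa> * ln (real n) / real n * real n powr (- \<kappa>)))"
        by (intro summable_add summable_mult sum summable_log_powr)
      show "eventually (\<lambda>n. norm (g n * prob (A n)) \<le> 9 * (b n * exp (- c n)) + 10 * (\<kappa> * ln (real n) / real n * real n powr (- \<kappa>))) sequentially"
        using eventually_ge_at_top[of N]
      proof eventually_elim
        case (elim n)
        then show ?case using prob_A[OF elim] w_pos[OF elim] by (simp add: g_def abs_mult)
      qed
    qed
  qed (rule A_sets)
  then show ?thesis
  proof eventually_elim
    case (elim x)
    \<comment> \<open>A lower bound, independent of \<open>n\<close>, for the sum over the window of
      \<open>n\<close>; the Cauchy criterion then excludes windows that start far out.\<close>
    have "h / (1 + h) > 0" using h by simp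
    then obtain N1 where N1: "\<And>m n. m \<ge> N1 \<Longrightarrow> norm (\<Sum>k\<in>{m..<n}. g k * indicator (A k) x :: real) < h / (1 + h)"
      using elim unfolding summable_Cauchy by blast
    have "x \<notin> avoids (B n) n" if n: "n \<ge> N" "n \<ge> N1" for n
    proof
      assume x: "x \<in> avoids (B n) n"
      define q where "q = nat \<lfloor>1 / w n\<rfloor>"
      define y where "y = real n * w n"
      have y: "h \<le> y" "y > 0" using nw_ge[OF n(1)] h by (auto simp: y_def)
      have wy: "1 / w n = real n / y" using n1[OF n(1)] by (simp add: y_def)
      have winv: "0 \<le> 1 / w n" using w_pos[OF n(1)] by simp
      have q: "real q + 1 \<ge> real n / y" "real q \<le> real n / y"
        using winv unfolding q_def wy[symmetric] by linarith+
      \<comment> \<open>The window has \<open>q + 1 \<ge> n / y\<close> indices, all at most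
        \<open>n + n / y\<close>, and \<open>k * w k \<ge> n * w n = y\<close> bounds each weight
        from below; the product of count and bound is \<open>y / (1 + y)\<close>.\<close>
      have window: "g k * indicator (A k) x \<ge> y / (real n + real n / y)" if k: "k \<in> {n..<n + q + 1}" for k
      proof -
        have kn: "k \<ge> n" "k \<ge> N" using k n by auto
        have "k - n \<le> q" using k by auto
        also have "q \<le> nat \<lfloor>1 / w k\<rfloor>"
          unfolding q_def using w_anti[OF n(1) kn(1)] w_pos[OF kn(2)]
          by (intro nat_mono floor_mono divide_left_mono mult_pos_pos w_pos n kn) auto
        finally have "p k \<le> n" by (simp add: p_def)
        then have "x \<in> avoids (B k) (p k)"
          using x avoids_mono[OF decreasing[OF n1(2)[OF n(1)] kn(1)]] by blast
        then have "g k * indicator (A k) x = w k" using kn by (simp add: g_def A_def)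
        moreover have "y / (real n + real n / y) \<le> w k"
        proof -
          have "y \<le> real k * w k" unfolding y_def using nw_mono[OF n(1) kn(1)] .
          also have "\<dots> \<le> (real n + real n / y) * w k"
            using k q w_pos[OF kn(2)] by (intro mult_right_mono) auto
          finally show ?thesis using n1[OF n(1)] y by (simp add: pos_divide_le_eq mult.commute add_pos_pos)
        qed
        ultimately show ?thesis by simp
      qed
      have "h / (1 + h) \<le> y / (1 + y)" using h y by (simp add: field_simps)
      also have "\<dots> = (real n / y) * (y / (real n + real n / y))"
      proof -
        have "real n + real n / y = real n * ((1 + y) / y)" using y by (simp add: field_simps)
        then show ?thesis using y n1[OF n(1)] by simp
      qed
      also have "\<dots> \<le> real (card {n..<n + q + 1}) * (y / (real n + real n / y))"
        using q y by (intro mult_right_mono) auto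
      also have "\<dots> \<le> (\<Sum>k\<in>{n..<n + q + 1}. g k * indicator (A k) x)"
        using window by (intro sum_bounded_below) auto
      also have "\<dots> < h / (1 + h)" using N1[OF n(2), of "n + q + 1"] by simp
      finally show False by simp
    qed
    then show ?case unfolding eventually_sequentially by (intro exI[of _ "max N N1"]) auto
  qed
qed

section \<open>Quasi-independence and the divergent case\<close>

lemma pair_bound:
  assumes n: "large n" "c n \<le> \<kappa> * ln (real n)" and m: "large m" "c m \<le> \<kappa> * ln (real m)"
    and mn: "m \<le> n"
  shows "prob (avoids (B m) m \<inter> avoids (B n) n)
           \<le> 4 * exp (- c m) * (9 * exp (- (real (n - m) * b n)) + exp (- c n))"
proof -
  have n1: "n \<ge> 1" "m \<ge> 1" using largeD(1)[OF n(1)] largeD(1)[OF m(1)] by auto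
  have [measurable]: "B n \<in> sets M" "B m \<in> sets M" using n1 B_sets by auto
  have kn: "real n powr (- \<kappa>) \<le> exp (- c n)" "real m powr (- \<kappa>) \<le> exp (- c m)"
    using n m n1 by (simp_all add: powr_def)
  have "b m \<le> \<kappa> * ln (real m) / real m" unfolding b_eq[OF n1(2)] using m n1 by (intro divide_right_mono) auto
  then have "2 * real (gap m) * b m \<le> 2 * real (gap m) * (\<kappa> * ln (real m) / real m)"
    by (intro mult_left_mono) auto
  also have "\<dots> \<le> 1" by (rule largeD(5)[OF m(1)])
  finally have g: "2 * real (gap m) * b m \<le> 1" .
  have g': "2 * real (gap m) * b n \<le> 1"
    using g mult_left_mono[OF b_decreasing[OF n1(2) mn], of "2 * real (gap m)"] by simp
  have cm: "3 * exp (- (real m * b m)) + real m powr (- \<kappa>) \<le> 4 * exp (- c m)"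
    using kn by (simp add: c_def)
  show ?thesis
  \<comment> \<open>If the gap fits, only the avoidance of \<open>B n\<close> after it is kept, and
    the forgotten \<open>2 * gap m\<close> steps cost a factor 3 because
    \<open>2 * gap m * b n \<le> 1\<close>. Otherwise \<open>(n - m) * b n \<le> 1\<close>, the last
    factor of the claim is at least 1, and the first event alone gives the bound.\<close>
  proof (cases "m + 2 * gap m \<le> n")
    case True
    define l where "l = n - (m + 2 * gap m)"
    have "avoids (B m) m \<inter> avoids (B n) n \<subseteq> avoids (B m) m \<inter> pre (m + 2 * gap m) (avoids (B n) l)"
      using funpow_space by (auto simp: avoids_def funpow_funpow l_def)
    then have "prob (avoids (B m) m \<inter> avoids (B n) n)
        \<le> prob (avoids (B m) m \<inter> pre (m + 2 * gap m) (avoids (B n) l))"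
      by (intro finite_measure_mono) auto
    also have "\<dots> \<le> (3 * exp (- (real m * b m)) + real m powr (- \<kappa>)) * prob (avoids (B n) l)"
      by (intro avoids_upper m) auto
    also have "\<dots> \<le> (4 * exp (- c m)) * (9 * exp (- (real (n - m) * b n)) + exp (- c n))"
    proof (rule mult_mono[OF cm])
      have "prob (avoids (B n) l) \<le> 3 * exp (- (real l * b n)) + real n powr (- \<kappa>)"
        by (intro avoids_upper' n) (simp add: l_def)
      moreover have "exp (- (real l * b n)) \<le> 3 * exp (- (real (n - m) * b n))"
      proof -
        have "real (n - m) = real l + 2 * real (gap m)" using True by (simp add: l_def of_nat_diff)
        then have "real (n - m) * b n = real l * b n + 2 * real (gap m) * b n"
          by (simp only: distrib_right)
        then have "- (real l * b n) \<le> 1 + - (real (n - m) * b n)"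
          using g' by linarith
        then have "exp (- (real l * b n)) \<le> exp (1 + - (real (n - m) * b n))" by simp
        also have "\<dots> \<le> 3 * exp (- (real (n - m) * b n))"
          unfolding exp_add using exp_le by (intro mult_right_mono) auto
        finally show ?thesis .
      qed
      ultimately show "prob (avoids (B n) l) \<le> 9 * exp (- (real (n - m) * b n)) + exp (- c n)"
        using kn(1) by linarith
    qed auto
    finally show ?thesis .
  next
    case False
    have "prob (avoids (B m) m \<inter> avoids (B n) n) \<le> prob (avoids (B m) m)"
      by (intro finite_measure_mono) auto
    also have "\<dots> \<le> 4 * exp (- c m)" using avoids_upper'[OF m(1) order.refl] cm by linarith
    also have "\<dots> \<le> 4 * exp (- c m) * (9 * exp (- (real (n - m) * b n)) + exp (- c n))"
    proof -
      have "real (n - m) * b n \<le> 2 * real (gap m) * b n"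
        using False b_nonneg by (intro mult_right_mono) auto
      also have "\<dots> \<le> 1" by (rule g')
      finally have "exp (- 1) \<le> exp (- (real (n - m) * b n))" by simp
      moreover have "1 / 3 \<le> exp (- 1 :: real)" using exp_le by (simp add: exp_minus field_simps)
      ultimately have "1 \<le> 9 * exp (- (real (n - m) * b n)) + exp (- c n)"
        using exp_gt_zero[of "- c n"] by linarith
      then show ?thesis by simp
    qed
    finally show ?thesis .
  qed
qed

text \<open>Up to \<open>2 * m\<close>, monotonicity of \<open>b\<close> and \<open>c\<close> keeps
  \<open>b n\<close> between \<open>b m / 2\<close> and \<open>b m\<close>, and the sum is dominated
  by a geometric one. Beyond, either \<open>m * b n \<le> 1\<close> and replacing
  \<open>n - m\<close> by \<open>n\<close> costs a factor 3, or \<open>c n\<close> is so large that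
  a geometric sequence depending on \<open>m\<close> only dominates the term. Each range contributes
  a constant 3.\<close>

lemma row_sum_bound:
  assumes S: "finite S" "\<And>n. n \<in> S \<Longrightarrow> m \<le> n" and m: "m \<ge> 1"
  shows "(\<Sum>n\<in>S. b n * exp (- (real (n - m) * b n))) \<le> 6 + 3 * (\<Sum>n\<in>S. b n * exp (- c n))"
proof -
  define near where "near = {n \<in> S. n \<le> 2 * m}"
  define far where "far = {n \<in> S. 2 * m < n}"
  define h where "h = b m / 2"
  have h: "h > 0" "h \<le> 1 / 2" using b_pos[OF m] prob_le_1[of "B m"] unfolding h_def b_def by auto
  have fin: "finite near" "finite far" using S by (auto simp: near_def far_def)
  have split: "(\<Sum>n\<in>S. F n) = sum F near + sum F far" for F :: "nat \<Rightarrow> real"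
  proof -
    have "S = near \<union> far" "near \<inter> far = {}" by (auto simp: near_def far_def)
    then show ?thesis using fin by (metis sum.union_disjoint)
  qed
  have "(\<Sum>n\<in>near. b n * exp (- (real (n - m) * b n))) \<le> (\<Sum>n\<in>near. 2 * h * exp (- (real (n - m) * h)))"
  proof (intro sum_mono mult_mono)
    fix n assume n: "n \<in> near"
    then have mn: "m \<le> n" "n \<le> 2 * m" "n \<ge> 1" using S(2)[of n] m n by (auto simp: near_def)
    show "b n \<le> 2 * h" using b_decreasing[OF m mn(1)] by (simp add: h_def)
    have "h = c m / real (2 * m)" using m by (simp add: h_def c_def)
    also have "\<dots> \<le> c m / real n"
      using mn b_nonneg by (intro divide_left_mono) (auto simp: c_def)
    also have "\<dots> \<le> b n" unfolding b_eq[OF mn(3)] using c_mono[OF m mn(1)] by (intro divide_right_mono) auto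
    finally show "exp (- (real (n - m) * b n)) \<le> exp (- (real (n - m) * h))"
      by (simp add: mult_left_mono)
  qed (use h in auto)
  also have "\<dots> = 2 * (h * (\<Sum>n\<in>near. exp (- (real (n - m) * h))))"
    by (simp add: sum_distrib_left mult.assoc)
  also have "(\<Sum>n\<in>near. exp (- (real (n - m) * h))) = (\<Sum>i\<in>(\<lambda>n. n - m) ` near. exp (- (real i * h)))"
  proof -
    have "inj_on (\<lambda>n. n - m) near"
    proof (rule inj_onI)
      fix x y assume "x \<in> near" "y \<in> near" "x - m = y - m"
      then show "x = y" using S(2)[of x] S(2)[of y] by (auto simp: near_def)
    qed
    then show ?thesis by (simp add: sum.reindex)
  qed
  also have "2 * (h * \<dots>) \<le> 2 * (1 + h)"
    using h fin by (intro mult_left_mono sum_exp_neg_le) auto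
  finally have 1: "(\<Sum>n\<in>near. b n * exp (- (real (n - m) * b n))) \<le> 3" using h by simp
  \<comment> \<open>For \<open>n > 2 * m\<close> this gives \<open>n * z \<ge> 1\<close>, and if
    \<open>c n * m > n\<close> also \<open>n * z \<le> c n / 2\<close>; both numbers then lie where
    \<open>x * exp (- x)\<close> decreases.\<close>
  define z where "z = 1 / (2 * real m)"
  have z: "z > 0" "z \<le> 1 / 2" using m by (auto simp: z_def field_simps)
  have "(\<Sum>n\<in>far. b n * exp (- (real (n - m) * b n)))
      \<le> (\<Sum>n\<in>far. 3 * (b n * exp (- c n)) + 2 * z * exp (- (real n * z)))"
  proof (rule sum_mono)
    fix n assume n: "n \<in> far"
    then have mn: "m \<le> n" "2 * m < n" "n \<ge> 1" using S(2)[of n] m n by (auto simp: far_def)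
    show "b n * exp (- (real (n - m) * b n)) \<le> 3 * (b n * exp (- c n)) + 2 * z * exp (- (real n * z))"
    proof (cases "c n * real m \<le> real n")
      case True
      have "real m * b n \<le> 1" unfolding b_eq[OF mn(3)] using True mn by (simp add: mult.commute)
      then have "- (real (n - m) * b n) \<le> 1 + - c n"
        using mn by (simp add: c_def of_nat_diff algebra_simps)
      then have "exp (- (real (n - m) * b n)) \<le> exp (1 + - c n)" by simp
      also have "\<dots> \<le> 3 * exp (- c n)"
        unfolding exp_add using exp_le by (intro mult_right_mono) auto
      finally have "b n * exp (- (real (n - m) * b n)) \<le> b n * (3 * exp (- c n))"
        using b_nonneg by (intro mult_left_mono)
      moreover have "0 \<le> 2 * z * exp (- (real n * z))" using z by simp
      ultimately show ?thesis by simp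
    next
      case False
      then have large_c: "real n * z \<le> c n / 2" using m by (simp add: z_def field_simps)
      have "real n * z \<ge> 1" using mn m by (simp add: z_def field_simps)
      then have "c n / 2 * exp (- (c n / 2)) \<le> real n * z * exp (- (real n * z))"
        using large_c by (rule mult_exp_neg_antimono)
      then have "2 / real n * (c n / 2 * exp (- (c n / 2))) \<le> 2 / real n * (real n * z * exp (- (real n * z)))"
        by (intro mult_left_mono) auto
      moreover have "2 / real n * (c n / 2 * exp (- (c n / 2))) = b n * exp (- (c n / 2))"
        using mn by (simp add: b_eq)
      moreover have "2 / real n * (real n * z * exp (- (real n * z))) = 2 * z * exp (- (real n * z))"
        using mn by simp
      moreover have "b n * exp (- (real (n - m) * b n)) \<le> b n * exp (- (c n / 2))"
      proof -
        have "real n / 2 * b n \<le> real (n - m) * b n"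
          using mn b_nonneg by (intro mult_right_mono) auto
        then show ?thesis using b_nonneg by (intro mult_left_mono) (auto simp: c_def)
      qed
      moreover have "0 \<le> b n * exp (- c n)" using b_nonneg by simp
      ultimately show ?thesis by linarith
    qed
  qed
  also have "\<dots> = 3 * (\<Sum>n\<in>far. b n * exp (- c n)) + 2 * (z * (\<Sum>n\<in>far. exp (- (real n * z))))"
    by (simp add: sum.distrib sum_distrib_left mult.assoc)
  also have "\<dots> \<le> 3 * (\<Sum>n\<in>far. b n * exp (- c n)) + 2 * (1 + z)"
    using z fin by (intro add_left_mono mult_left_mono sum_exp_neg_le) auto
  also have "\<dots> \<le> 3 * (\<Sum>n\<in>far. b n * exp (- c n)) + 3" using z by simp
  finally have 2: "(\<Sum>n\<in>far. b n * exp (- (real (n - m) * b n))) \<le> 3 * (\<Sum>n\<in>far. b n * exp (- c n)) + 3" .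
  have 3: "(\<Sum>n\<in>near. b n * exp (- c n)) \<ge> 0" using b_nonneg by (intro sum_nonneg) auto
  show ?thesis using 1 2 3 split[of "\<lambda>n. b n * exp (- (real (n - m) * b n))"] split[of "\<lambda>n. b n * exp (- c n)"]
    by linarith
qed

text \<open>A row gives \<open>9 * (6 + 3 * \<Sigma>) + \<Sigma> \<le> 82 * \<Sigma>\<close> because
  \<open>\<Sigma> \<ge> 1\<close>; hence \<open>328 = 4 * 82\<close> and, by symmetry in
  \<open>m\<close> and \<open>n\<close>, \<open>656\<close>. With
  \<open>t = 4 * 656 * \<Sigma>\<close> the first term of the second moment bound is
  \<open>\<Sigma> / 8\<close>, half of the available \<open>\<Sigma> / 4\<close>; this leaves
  \<open>10496 = 8 * 1312\<close>.\<close>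

lemma union_lower_bound:
  assumes S: "finite S" "\<And>n. n \<in> S \<Longrightarrow> large n" "\<And>n. n \<in> S \<Longrightarrow> c n \<le> \<kappa> * ln (real n)"
    and sum: "(\<Sum>n\<in>S. b n * exp (- c n)) \<ge> 1"
  shows "prob (\<Union>n\<in>S. avoids (B n) n) \<ge> 1 / 10496"
proof -
  define \<Sigma> where "\<Sigma> = (\<Sum>n\<in>S. b n * exp (- c n))"
  have n1: "n \<ge> 1" if "n \<in> S" for n using largeD(1)[OF S(2)[OF that]] by simp
  define P where "P m n = b m * b n * prob (avoids (B m) m \<inter> avoids (B n) n)" for m n
  have P_nonneg: "P m n \<ge> 0" for m n by (simp add: P_def b_nonneg)
  have P_sym: "P m n = P n m" for m n by (simp add: P_def Int_commute mult.commute)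
  have row: "(\<Sum>n\<in>{n\<in>S. m \<le> n}. P m n) \<le> 328 * \<Sigma> * (b m * exp (- c m))" if m: "m \<in> S" for m
  proof -
    let ?S = "{n\<in>S. m \<le> n}"
    have "(\<Sum>n\<in>?S. P m n) \<le> (\<Sum>n\<in>?S. b m * b n * (4 * exp (- c m) * (9 * exp (- (real (n - m) * b n)) + exp (- c n))))"
      unfolding P_def using S m b_nonneg by (intro sum_mono mult_left_mono pair_bound) auto
    also have "\<dots> = 4 * (b m * exp (- c m)) * (9 * (\<Sum>n\<in>?S. b n * exp (- (real (n - m) * b n))) + (\<Sum>n\<in>?S. b n * exp (- c n)))"
      by (simp add: sum_distrib_left sum.distrib algebra_simps)
    also have "\<dots> \<le> 4 * (b m * exp (- c m)) * (82 * \<Sigma>)"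
    proof (intro mult_left_mono)
      have "(\<Sum>n\<in>?S. b n * exp (- (real (n - m) * b n))) \<le> 6 + 3 * (\<Sum>n\<in>?S. b n * exp (- c n))"
        using S n1[OF m] by (intro row_sum_bound) auto
      moreover have "(\<Sum>n\<in>?S. b n * exp (- c n)) \<le> \<Sigma>"
        unfolding \<Sigma>_def using S b_nonneg by (intro sum_mono2) auto
      ultimately show "9 * (\<Sum>n\<in>?S. b n * exp (- (real (n - m) * b n))) + (\<Sum>n\<in>?S. b n * exp (- c n)) \<le> 82 * \<Sigma>"
        using sum unfolding \<Sigma>_def[symmetric] by linarith
    qed (use b_nonneg in auto)
    finally show ?thesis by (simp add: algebra_simps)
  qed
  have "(\<Sum>m\<in>S. \<Sum>n\<in>S. P m n) \<le> (\<Sum>m\<in>S. \<Sum>n\<in>S. (if m \<le> n then P m n else 0) + (if n \<le> m then P n m else 0))"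
    using P_nonneg P_sym by (intro sum_mono) (auto simp: not_le)
  also have "\<dots> = (\<Sum>m\<in>S. \<Sum>n\<in>S. if m \<le> n then P m n else 0) + (\<Sum>m\<in>S. \<Sum>n\<in>S. if n \<le> m then P n m else 0)"
    by (simp add: sum.distrib)
  also have "(\<Sum>m\<in>S. \<Sum>n\<in>S. if n \<le> m then P n m else 0) = (\<Sum>m\<in>S. \<Sum>n\<in>S. if m \<le> n then P m n else 0)"
    by (rule sum.swap)
  also have "(\<Sum>m\<in>S. \<Sum>n\<in>S. if m \<le> n then P m n else 0) = (\<Sum>m\<in>S. \<Sum>n\<in>{n\<in>S. m \<le> n}. P m n)"
    using S by (simp add: sum.If_cases Int_def)
  also have "\<dots> \<le> (\<Sum>m\<in>S. 328 * \<Sigma> * (b m * exp (- c m)))" by (intro sum_mono row)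
  also have "\<dots> = 328 * \<Sigma>\<^sup>2" by (simp add: \<Sigma>_def sum_distrib_left[symmetric] power2_eq_square mult.assoc)
  finally have 2: "(\<Sum>m\<in>S. \<Sum>n\<in>S. P m n) \<le> 656 * \<Sigma>\<^sup>2" by simp
  have \<Sigma>: "\<Sigma> \<ge> 1" using sum by (simp add: \<Sigma>_def)
  have "\<Sigma> / 4 = (\<Sum>n\<in>S. b n * (exp (- c n) / 4))" by (simp add: \<Sigma>_def sum_divide_distrib)
  also have "\<dots> \<le> (\<Sum>n\<in>S. b n * prob (avoids (B n) n))"
    using b_nonneg S by (intro sum_mono mult_left_mono avoids_lower) auto
  also have "\<dots> \<le> (\<Sum>m\<in>S. \<Sum>n\<in>S. P m n) / (2 * (2624 * \<Sigma>)) + 2624 * \<Sigma> / 2 * prob (\<Union>n\<in>S. avoids (B n) n)"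
    unfolding P_def using S \<Sigma> n1 B_sets by (intro second_moment_union) auto
  also have "(\<Sum>m\<in>S. \<Sum>n\<in>S. P m n) / (2 * (2624 * \<Sigma>)) \<le> 656 * \<Sigma>\<^sup>2 / (2 * (2624 * \<Sigma>))"
    using 2 \<Sigma> by (intro divide_right_mono) auto
  also have "\<dots> = \<Sigma> / 8" using \<Sigma> by (simp add: power2_eq_square)
  finally have "\<Sigma> * 1 \<le> \<Sigma> * (10496 * prob (\<Union>n\<in>S. avoids (B n) n))" by simp
  then have "1 \<le> 10496 * prob (\<Union>n\<in>S. avoids (B n) n)" using \<Sigma> by (subst (asm) mult_le_cancel_left_pos) auto
  then show ?thesis by simp
qed

text \<open>All tail unions have probability at least one fixed constant, so the limit superior has
  positive probability. Its complement is almost surely mapped into itself: if \<open>f x\<close>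
  avoids \<open>B n\<close> for \<open>n\<close> steps, so does \<open>x\<close> once it lies
  outside \<open>B n\<close>, which \<open>shrink\<close> ensures for large \<open>n\<close>. The
  zero-one law then applies.\<close>

theorem infinitely_often_avoids:
  assumes not_sum: "\<not> summable (\<lambda>n. b n * exp (- c n))"
    and ergodic: "\<And>A. A \<in> sets M \<Longrightarrow> f -` A \<inter> space M = A \<Longrightarrow> prob A = 0 \<or> prob A = 1"
    and shrink: "AE x in M. \<exists>n\<ge>1. x \<notin> B n"
  shows "AE x in M. frequently (\<lambda>n. x \<in> avoids (B n) n) sequentially"
proof -
  obtain N where N: "\<And>n. n \<ge> N \<Longrightarrow> large n"
    using eventually_large by (auto simp: eventually_sequentially)
  have n1: "n \<ge> 1" "real n > 0" if "n \<ge> N" for n using largeD(1)[OF N[OF that]] by auto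
  have N1: "N \<ge> 1" using n1[of N] by simp
  \<comment> \<open>Terms beyond the logarithmic threshold are replaced by 0. They are at most
    \<open>\<kappa> * ln n / n * n powr (- \<kappa>)\<close>, since \<open>x * exp (- x)\<close>
    decreases, so the divergence survives.\<close>
  define s where "s n = (if n \<ge> N \<and> c n \<le> \<kappa> * ln (real n) then b n * exp (- c n) else 0)" for n
  have s_nonneg: "s n \<ge> 0" for n by (simp add: s_def b_nonneg)
  have not_sum_s: "\<not> summable s"
  proof
    assume "summable s"
    then have "summable (\<lambda>n. s n + \<kappa> * ln (real n) / real n * real n powr (- \<kappa>))"
      by (intro summable_add summable_log_powr)
    then have "summable (\<lambda>n. b n * exp (- c n))"
    proof (rule summable_comparison_test_ev[rotated])
      show "eventually (\<lambda>n. norm (b n * exp (- c n)) \<le> s n + \<kappa> * ln (real n) / real n * real n powr (- \<kappa>)) sequentially"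
        using eventually_ge_at_top[of N]
      proof eventually_elim
        case (elim n)
        note n = n1[OF elim]
        have k: "1 \<le> \<kappa> * ln (real n)" by (rule largeD(9)[OF N[OF elim]])
        show ?case
        proof (cases "c n \<le> \<kappa> * ln (real n)")
          case True
          have "0 \<le> \<kappa> * ln (real n) / real n * real n powr (- \<kappa>)" using k by simp
          then show ?thesis using True elim b_nonneg by (simp add: s_def)
        next
          case False
          have "c n * exp (- c n) \<le> \<kappa> * ln (real n) * exp (- (\<kappa> * ln (real n)))"
            using False k by (intro mult_exp_neg_antimono) auto
          then have "c n * exp (- c n) / real n \<le> \<kappa> * ln (real n) * exp (- (\<kappa> * ln (real n))) / real n"
            by (intro divide_right_mono) auto
          moreover have "norm (b n * exp (- c n)) = c n * exp (- c n) / real n"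
            using n b_nonneg[of n] by (simp add: abs_mult c_def)
          ultimately show ?thesis using n s_nonneg[of n] by (simp add: powr_def)
        qed
      qed
    qed
    then show False using not_sum by simp
  qed
  define L where "L k = (\<Union>n\<in>{k + N..}. avoids (B n) n)" for k
  have A_sets: "avoids (B n) n \<in> sets M" if "n \<ge> N" for n using n1[OF that] B_sets by auto
  have L_sets: "L k \<in> sets M" for k unfolding L_def using A_sets by (intro sets.countable_UN') auto
  have L_prob: "prob (L k) \<ge> 1 / 10496" for k
  proof -
    obtain M' where M': "(\<Sum>n<M'. s n) \<ge> (\<Sum>n<k + N. s n) + 1"
    proof (rule ccontr)
      assume "\<not> thesis"
      then have *: "(\<Sum>n<M'. s n) \<le> (\<Sum>n<k + N. s n) + 1" for M' using that by (meson linear)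
      have "(\<Sum>n\<le>m. s n) \<le> (\<Sum>n<k + N. s n) + 1" for m
        using *[of "Suc m"] by (simp only: lessThan_Suc_atMost)
      then have "summable s" using s_nonneg by (rule bounded_imp_summable[rotated])
      then show False using not_sum_s by simp
    qed
    define S where "S = {n. k + N \<le> n \<and> n < M' \<and> c n \<le> \<kappa> * ln (real n)}"
    have fin: "finite S" by (rule finite_subset[of _ "{..<M'}"]) (auto simp: S_def)
    have "k + N \<le> M'"
    proof (rule ccontr)
      assume "\<not> k + N \<le> M'"
      then have "(\<Sum>n<M'. s n) \<le> (\<Sum>n<k + N. s n)" using s_nonneg by (intro sum_mono2) auto
      then show False using M' by simp
    qed
    then have "(\<Sum>n<M'. s n) = (\<Sum>n<k + N. s n) + (\<Sum>n\<in>{k + N..<M'}. s n)"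
      by (simp add: lessThan_atLeast0 sum.atLeastLessThan_concat)
    then have "1 \<le> (\<Sum>n\<in>{k + N..<M'}. s n)" using M' by simp
    also have "\<dots> = (\<Sum>n\<in>S. b n * exp (- c n))"
      by (rule sum.mono_neutral_cong_right) (auto simp: S_def s_def)
    finally have "prob (\<Union>n\<in>S. avoids (B n) n) \<ge> 1 / 10496"
      using fin N by (intro union_lower_bound) (auto simp: S_def)
    also have "prob (\<Union>n\<in>S. avoids (B n) n) \<le> prob (L k)"
      using L_sets by (intro finite_measure_mono) (auto simp: S_def L_def)
    finally show ?thesis .
  qed
  define Lim where "Lim = (\<Inter>k. L k)"
  have Lim_sets: "Lim \<in> sets M" unfolding Lim_def using L_sets by auto
  have "(\<lambda>k. prob (L k)) \<longlonglongrightarrow> prob Lim"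
    unfolding Lim_def using L_sets
    by (intro finite_Lim_measure_decseq) (force simp: L_def decseq_def)+
  then have Lim_prob: "prob Lim \<ge> 1 / 10496" using L_prob by (meson LIMSEQ_le_const)
  have Lim_iff: "x \<in> Lim \<longleftrightarrow> frequently (\<lambda>n. x \<in> avoids (B n) n) sequentially" for x
  proof
    assume "x \<in> Lim"
    then show "frequently (\<lambda>n. x \<in> avoids (B n) n) sequentially"
      unfolding frequently_sequentially
    proof (intro allI)
      fix k
      assume "x \<in> Lim"
      then have "x \<in> L k" by (simp add: Lim_def)
      then obtain n where "n \<ge> k + N" "x \<in> avoids (B n) n" by (auto simp: L_def)
      then show "\<exists>n\<ge>k. x \<in> avoids (B n) n" by (intro exI[of _ n]) auto
    qed
  next
    assume *: "frequently (\<lambda>n. x \<in> avoids (B n) n) sequentially"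
    have "\<exists>n\<ge>k + N. x \<in> avoids (B n) n" for k using * unfolding frequently_sequentially by blast
    then show "x \<in> Lim" by (auto simp: Lim_def L_def)
  qed
  have "prob (space M - Lim) = 0 \<or> prob (space M - Lim) = 1"
  proof (rule zero_one_law[OF ergodic])
    show "AE x in M. x \<in> space M - Lim \<longrightarrow> f x \<in> space M - Lim"
      using shrink AE_space
    proof eventually_elim
      case (elim x)
      obtain n0 where n0: "n0 \<ge> 1" "x \<notin> B n0" using elim by auto
      have "x \<in> Lim" if "f x \<in> Lim"
        unfolding Lim_iff frequently_sequentially
      proof
        fix k
        have "\<forall>k. \<exists>n\<ge>k. f x \<in> avoids (B n) n"
          using that unfolding Lim_iff frequently_sequentially .
        then obtain n where n: "n \<ge> max k n0" "f x \<in> avoids (B n) n" by metis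
        have xB: "x \<notin> B n" using n0 decreasing[of n0 n] n by auto
        have "(f ^^ i) x \<notin> B n" if "i < n" for i
          using that n xB by (cases i) (auto simp: avoids_def funpow_f simp del: funpow.simps(2))
        then show "\<exists>n\<ge>k. x \<in> avoids (B n) n" using n elim by (intro exI[of _ n]) (auto simp: avoids_def)
      qed
      then show ?case using elim measurable_space[OF f_measurable] by auto
    qed
  qed (use Lim_sets in auto)
  then have "prob Lim = 1" using Lim_prob Lim_sets prob_compl[of Lim] by auto
  then have "AE x in M. x \<in> Lim" using Lim_sets by (simp add: prob_eq_1)
  then show ?thesis by (simp add: Lim_iff)
qed

end

section \<open>Interval maps with exponential decay of correlations\<close>

lemma emeasure_UN_le_cmult:
  assumes I: "countable I" and A: "\<And>i. i \<in> I \<Longrightarrow> A i \<in> sets M" and B: "\<And>i. i \<in> I \<Longrightarrow> B i \<in> sets N"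
    and disj: "disjoint_family_on B I"
    and le: "\<And>i. i \<in> I \<Longrightarrow> emeasure M (A i) \<le> k * emeasure N (B i)"
  shows "emeasure M (\<Union>i\<in>I. A i) \<le> k * emeasure N (\<Union>i\<in>I. B i)"
proof -
  let ?J = "to_nat_on I ` I"
  define A' where "A' n = (if n \<in> ?J then A (from_nat_into I n) else {})" for n
  define B' where "B' n = (if n \<in> ?J then B (from_nat_into I n) else {})" for n
  have J: "from_nat_into I n \<in> I" if "n \<in> ?J" for n using that I by auto
  have "(\<Union>i\<in>I. A i) = (\<Union>n. A' n)" "(\<Union>i\<in>I. B i) = (\<Union>n. B' n)"
    using I J by (auto simp: A'_def B'_def split: if_splits intro!: exI[of _ "to_nat_on I _"])
  have A'_sets: "range A' \<subseteq> sets M" "range B' \<subseteq> sets N"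
    using A B J by (auto simp: A'_def B'_def)
  have B'_disj: "disjoint_family B'"
    using disj I by (force simp: disjoint_family_on_def B'_def)
  have "emeasure M (\<Union>i\<in>I. A i) \<le> (\<Sum>n. emeasure M (A' n))"
    unfolding \<open>(\<Union>i\<in>I. A i) = (\<Union>n. A' n)\<close> by (rule emeasure_subadditive_countably[OF A'_sets(1)])
  also have "\<dots> \<le> (\<Sum>n. k * emeasure N (B' n))"
    using le J by (intro suminf_le) (auto simp: A'_def B'_def)
  also have "\<dots> = k * emeasure N (\<Union>i\<in>I. B i)"
    unfolding \<open>(\<Union>i\<in>I. B i) = (\<Union>n. B' n)\<close>
    by (simp add: suminf_emeasure[OF A'_sets(2) B'_disj])
  finally show ?thesis .
qed

text \<open>A Borel cover is produced because \<open>S\<close> need not be measurable: it will be a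
  preimage under a function about which no measurability is known.\<close>

lemma emeasure_lborel_le_diam:
  fixes S :: "real set"
  assumes "\<And>x y. x \<in> S \<Longrightarrow> y \<in> S \<Longrightarrow> \<bar>x - y\<bar> \<le> d" "d \<ge> 0"
  obtains I where "I \<in> sets borel" "S \<subseteq> I" "emeasure lborel I \<le> ennreal d"
proof (cases "S = {}")
  case True
  then show ?thesis using that[of "{}"] by simp
next
  case False
  then obtain z where z: "z \<in> S" by auto
  have bdd: "bdd_below S" using assms(1)[OF _ z] by (intro bdd_belowI[of _ "z - d"]) (fastforce simp: abs_le_iff)
  define a where "a = Inf S"
  have "S \<subseteq> {a..a + d}"
  proof
    fix x assume x: "x \<in> S"
    have "x - d \<le> y" if "y \<in> S" for y using assms(1)[OF x that] by linarith
    then have "x - d \<le> a" unfolding a_def using False by (intro cInf_greatest) auto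
    then show "x \<in> {a..a + d}" using x bdd by (auto simp: a_def cInf_lower)
  qed
  then show ?thesis using that[of "{a..a + d}"] assms by simp
qed

text \<open>Covers both the expanding and the Lipschitz direction: \<open>h\<close> may be a map or a choice of
  preimages.\<close>
lemma emeasure_le_expanding:
  fixes S T :: "real set"
  assumes S: "S \<in> sets borel" and T: "T \<in> sets borel" and h: "\<And>x. x \<in> S \<Longrightarrow> h x \<in> T"
    and L: "L > 0" "\<And>x y. x \<in> S \<Longrightarrow> y \<in> S \<Longrightarrow> \<bar>x - y\<bar> \<le> L * \<bar>h x - h y\<bar>"
  shows "emeasure lborel S \<le> ennreal L * emeasure lborel T"
proof (rule ennreal_le_epsilon)
  fix e :: real assume e: "e > 0"
  \<comment> \<open>\<open>T\<close> is approximated from outside by an open set. Its components are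
    intervals, whose diameter equals their length, so the points of \<open>S\<close> sent into a
    component have diameter at most \<open>L\<close> times that length.\<close>
  obtain U where U: "open U" "T \<subseteq> U" "emeasure lborel (U - T) \<le> ennreal (e / L)"
    using outer_regular_lborel_le[OF T, of "e / L"] e L by auto
  have C: "open C" "connected C" "C \<subseteq> U" "C \<noteq> {}" if "C \<in> components U" for C
    by (rule open_components[OF U(1) that], rule in_components_connected[OF that],
        rule in_components_subset[OF that], rule in_components_nonempty[OF that])
  have disj: "disjoint_family_on (\<lambda>C. C) (components U)"
    using pairwise_disjoint_components[of U] by (auto simp: disjoint_family_on_def pairwise_def disjnt_def)
  have count: "countable (components U)"
    using countable_disjoint_open_subsets[of "components U"] C(1) pairwise_disjoint_components[of U]
    by (auto simp: pairwise_def disjoint_def disjnt_def)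
  have "\<exists>I. I \<in> sets borel \<and> {x \<in> S. h x \<in> C} \<subseteq> I \<and> emeasure lborel I \<le> ennreal L * emeasure lborel C"
    if CU: "C \<in> components U" for C
  proof (cases "emeasure lborel C = \<infinity>")
    case True
    then show ?thesis using L by (intro exI[of _ UNIV]) (auto simp: ennreal_mult_top)
  next
    case False
    have int: "is_interval C" using C(2)[OF CU] by (simp add: is_interval_connected_1)
    define l where "l = measure lborel C"
    have l: "emeasure lborel C = ennreal l" using False by (simp add: l_def emeasure_eq_ennreal_measure)
    have "\<bar>x - y\<bar> \<le> l" if xy: "x \<in> C" "y \<in> C" for x y
    proof -
      have mm: "min x y \<in> C" "max x y \<in> C" using xy by (auto simp: min_def max_def)
      have "{min x y..max x y} \<subseteq> C" using mem_is_interval_1_I[OF int mm] by auto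
      then have "emeasure lborel {min x y..max x y} \<le> emeasure lborel C"
        using C(1)[OF CU] by (intro emeasure_mono) auto
      then have "ennreal (max x y - min x y) \<le> ennreal l" using l by (simp add: min_le_iff_disj)
      then show ?thesis by (subst (asm) ennreal_le_iff) (auto simp: l_def min_def max_def split: if_splits)
    qed
    then have "\<bar>x - y\<bar> \<le> L * l" if "x \<in> {x \<in> S. h x \<in> C}" "y \<in> {x \<in> S. h x \<in> C}" for x y
      using that L(2)[of x y] mult_left_mono[of "\<bar>h x - h y\<bar>" l L] L(1) by (auto intro: order.trans)
    then obtain I where "I \<in> sets borel" "{x \<in> S. h x \<in> C} \<subseteq> I" "emeasure lborel I \<le> ennreal (L * l)"
      using L by (elim emeasure_lborel_le_diam) (auto simp: l_def)
    then show ?thesis using L(1) l by (auto simp: ennreal_mult l_def)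
  qed
  then obtain I where I: "I C \<in> sets borel" "{x \<in> S. h x \<in> C} \<subseteq> I C" "emeasure lborel (I C) \<le> ennreal L * emeasure lborel C"
    if "C \<in> components U" for C by metis
  have "S \<subseteq> (\<Union>C\<in>components U. I C)"
  proof
    fix x assume x: "x \<in> S"
    then have "h x \<in> \<Union>(components U)" using h U by auto
    then obtain C where "C \<in> components U" "h x \<in> C" by blast
    then show "x \<in> (\<Union>C\<in>components U. I C)" using x I(2) by blast
  qed
  then have "emeasure lborel S \<le> emeasure lborel (\<Union>C\<in>components U. I C)"
    using I(1) count by (intro emeasure_mono) auto
  also have "\<dots> \<le> ennreal L * emeasure lborel (\<Union>C\<in>components U. C)"
    by (rule emeasure_UN_le_cmult[OF count _ _ disj]) (use I C in auto)
  also have "(\<Union>C\<in>components U. C) = U" by auto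
  also have "emeasure lborel U \<le> emeasure lborel T + emeasure lborel (U - T)"
    using emeasure_subadditive[of T lborel "U - T"] U T by (simp add: Un_absorb1)
  also have "\<dots> \<le> emeasure lborel T + ennreal (e / L)" using U by (intro add_left_mono) auto
  finally have "emeasure lborel S \<le> ennreal L * (emeasure lborel T + ennreal (e / L))"
    by (simp add: mult_left_mono)
  also have "\<dots> = ennreal L * emeasure lborel T + ennreal e"
    using L e by (simp add: distrib_left ennreal_mult[symmetric])
  finally show "emeasure lborel S \<le> ennreal L * emeasure lborel T + ennreal e" .
qed

section \<open>From decay of correlations on intervals to mixing\<close>

lemma variation_sum_antimono:
  fixes g :: "real \<Rightarrow> real"
  assumes "\<forall>i<n. x i < x (Suc i)" and "antimono g"
  shows "(\<Sum>i<n. \<bar>g (x (Suc i)) - g (x i)\<bar>) = g (x 0) - g (x n)"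
proof -
  have "(\<Sum>i<n. \<bar>g (x (Suc i)) - g (x i)\<bar>) = (\<Sum>i<n. g (x i) - g (x (Suc i)))"
    using assms by (intro sum.cong) (auto simp: antimono_def less_imp_le)
  then show ?thesis using sum_lessThan_telescope'[of "\<lambda>i. g (x i)" n] by simp
qed

text \<open>The indicator of an interval is the difference of two decreasing indicators.\<close>
lemma BV_indicator_interval:
  assumes A: "is_interval A" and X: "X \<noteq> {}"
  shows "bounded_variation X (indicator A)" "BV_norm X (indicator A) \<le> 3" "0 \<le> BV_norm X (indicator A)"
proof -
  define D where "D = {x::real. \<exists>y\<in>A. x \<le> y}"
  \<comment> \<open>Without the intersection with \<open>D\<close>, the set would be all of the line
    for empty \<open>A\<close>.\<close>
  define E where "E = {x::real. \<forall>y\<in>A. x < y} \<inter> D"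
  have ind: "indicat_real A x = indicator D x - indicator E x" for x
  proof (cases "x \<in> D - E")
    case True
    then obtain y y' where "y \<in> A" "y' \<in> A" "y' \<le> x" "x \<le> y" by (auto simp: D_def E_def not_less)
    then have "x \<in> A" using mem_is_interval_1_I[OF A] by blast
    then show ?thesis using True by simp
  next
    case False
    have "x \<in> D" "x \<notin> E" if "x \<in> A" using that by (auto simp: D_def E_def)
    moreover have "E \<subseteq> D" by (auto simp: E_def)
    ultimately show ?thesis using False by (auto split: split_indicator)
  qed
  have down: "x \<in> D" if "y \<in> D" "x \<le> y" for x y using that by (auto simp: D_def intro: order.trans)
  have down': "x \<in> E" if "y \<in> E" "x \<le> y" for x y
    using that down[of y x] by (auto simp: E_def intro: order.strict_trans1)
  have anti: "antimono (indicat_real D)" "antimono (indicat_real E)"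
    using down down' by (auto simp: antimono_def split: split_indicator)
  have le: "s \<le> 2" if s_in: "s \<in> variation_sums X (indicator A)" for s
  proof -
    obtain n x where s: "s = (\<Sum>i<n. \<bar>indicat_real A (x (Suc i)) - indicator A (x i)\<bar>)"
      and x: "\<forall>i<n. x i < x (Suc i)"
      using s_in by (auto simp: variation_sums_def)
    have "s \<le> (\<Sum>i<n. \<bar>indicat_real D (x (Suc i)) - indicator D (x i)\<bar> + \<bar>indicat_real E (x (Suc i)) - indicator E (x i)\<bar>)"
      unfolding s ind by (intro sum_mono) linarith
    also have "\<dots> = (indicat_real D (x 0) - indicator D (x n)) + (indicat_real E (x 0) - indicator E (x n))"
      by (simp only: sum.distrib variation_sum_antimono[OF x anti(1)] variation_sum_antimono[OF x anti(2)])
    also have "\<dots> \<le> 2" by (auto split: split_indicator)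
    finally show ?thesis .
  qed
  have 0: "0 \<in> variation_sums X (indicator A)"
    using X unfolding variation_sums_def by (auto intro!: exI[of _ "0::nat"])
  show bv: "bounded_variation X (indicator A)"
    unfolding bounded_variation_def using le by (intro bdd_aboveI)
  have "Sup (variation_sums X (indicator A)) \<le> 2" using 0 le by (intro cSup_least) auto
  moreover have "0 \<le> Sup (variation_sums X (indicator A))"
    using 0 bv by (auto simp: bounded_variation_def intro: cSup_upper)
  moreover have "(SUP x\<in>X. \<bar>indicat_real A x\<bar>) \<le> 1"
    using X by (intro cSUP_least) (auto split: split_indicator)
  moreover have "0 \<le> (SUP x\<in>X. \<bar>indicat_real A x\<bar>)"
  proof -
    obtain x where "x \<in> X" using X by auto
    then have "\<bar>indicat_real A x\<bar> \<le> (SUP x\<in>X. \<bar>indicat_real A x\<bar>)"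
      by (intro cSUP_upper bdd_aboveI2[of _ _ 1]) (auto split: split_indicator)
    then show ?thesis by linarith
  qed
  ultimately show "BV_norm X (indicator A) \<le> 3" "0 \<le> BV_norm X (indicator A)"
    by (auto simp: BV_norm_def)
qed

locale mixing_interval_map = measure_preserving_system \<mu> f for \<mu> :: "real measure" and f +
  fixes X :: "real set" and K \<tau> :: real
  assumes X_interval: "is_interval X" and X_bounded: "bounded X"
    and space_\<mu>: "space \<mu> = X" and sets_\<mu>: "sets \<mu> = sets (restrict_space borel X)"
    and ac: "absolutely_continuous (restrict_space lborel X) \<mu>"
    and ergodic: "\<And>A. A \<in> sets \<mu> \<Longrightarrow> f -` A \<inter> space \<mu> = A \<Longrightarrow> prob A = 0 \<or> prob A = 1"
    and K_pos: "K > 0" and \<tau>_pos: "\<tau> > 0"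
    and interval_mixing: "\<And>A. is_interval A \<Longrightarrow> A \<subseteq> X \<Longrightarrow> exp_mixing_set K \<tau> A"
begin

lemma X_borel [measurable]: "X \<in> sets borel"
  using X_interval by (rule real_interval_borel_measurable)

lemma sets_\<mu>_iff: "A \<in> sets \<mu> \<longleftrightarrow> A \<in> sets borel \<and> A \<subseteq> X"
  unfolding sets_\<mu> by (subst sets_restrict_space_iff) auto

lemma emeasure_lborel_finite: "A \<subseteq> X \<Longrightarrow> emeasure lborel A < \<infinity>"
  using X_bounded bounded_subset emeasure_bounded_finite by blast

lemma null_set_transfer: "A \<in> null_sets lborel \<Longrightarrow> A \<inter> X \<in> null_sets \<mu>"
proof -
  assume A: "A \<in> null_sets lborel"
  then have "A \<inter> X \<in> null_sets (restrict_space lborel X)"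
    by (subst null_sets_restrict_space) (auto intro: null_set_Int2)
  then show ?thesis using ac by (auto simp: absolutely_continuous_def)
qed

lemma AE_transfer: "AE x in lborel. P x \<Longrightarrow> AE x in \<mu>. P x"
proof -
  assume "AE x in lborel. P x"
  then obtain N where "{x. \<not> P x} \<subseteq> N" "N \<in> null_sets lborel"
    by (auto simp: eventually_ae_filter)
  then show ?thesis using null_set_transfer[of N] space_\<mu> by (intro AE_I'[of "N \<inter> X"]) auto
qed

lemma sigma_sets_rays: "sets \<mu> = sigma_sets X ((\<inter>) X ` range atMost)"
proof -
  have "sets (borel :: real measure) = sigma_sets UNIV (range atMost)"
    by (subst borel_eq_atMost) (simp add: sets_measure_of)
  then show ?thesis
    unfolding sets_\<mu> sets_restrict_space using sigma_sets_Int[of X UNIV "range atMost"] X_borel by simp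
qed

text \<open>The sets \<open>E\<close> with this limit form a Dynkin system that contains the
  intersection-stable generator of rays, which are intervals in \<open>X\<close>. Disjoint unions
  pass to the limit by dominated convergence of series, with \<open>prob (A k)\<close> as the
  dominating terms. The rate is lost, but \<open>E\<close> may now be any measurable set.\<close>

theorem mixing:
  assumes E: "E \<in> sets \<mu>" and F: "F \<in> sets \<mu>"
  shows "(\<lambda>n. prob (E \<inter> pre n F)) \<longlonglongrightarrow> prob E * prob F"
proof -
  have E': "E \<in> sigma_sets X ((\<inter>) X ` range atMost)" using E sigma_sets_rays by simp
  have [measurable]: "pre n F \<in> sets \<mu>" for n using F by auto
  have "Int_stable ((\<inter>) X ` range atMost)"
  proof (rule Int_stableI)
    fix a b assume "a \<in> (\<inter>) X ` range atMost" "b \<in> (\<inter>) X ` range atMost"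
    then obtain u v where "a = X \<inter> {..u}" "b = X \<inter> {..v}" by auto
    then have "a \<inter> b = X \<inter> {..min u v}" by auto
    then show "a \<inter> b \<in> (\<inter>) X ` range atMost" by blast
  qed
  moreover have "(\<inter>) X ` range atMost \<subseteq> Pow X" by auto
  ultimately show ?thesis
    using E'
  proof (induction rule: sigma_sets_induct_disjoint)
    case (basic A)
    then obtain u where "A = X \<inter> {..u}" by auto
    then have mix: "exp_mixing_set K \<tau> A"
      using X_interval by (intro interval_mixing is_interval_Int) (auto simp: is_interval_1)
    have "(\<lambda>n. K * exp (- \<tau> * real n) * prob F) \<longlonglongrightarrow> 0" using \<tau>_pos by real_asymp
    then have "(\<lambda>n. prob (A \<inter> pre n F) - prob A * prob F) \<longlonglongrightarrow> 0"
      by (rule Lim_null_comparison[rotated]) (use mix F in \<open>auto simp: exp_mixing_set_def\<close>)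
    then show ?case by (simp add: LIM_zero_iff)
  next
    case empty
    then show ?case by simp
  next
    case (compl A)
    then have A: "A \<in> sets \<mu>" using sigma_sets_rays by simp
    have "prob ((X - A) \<inter> pre n F) = prob F - prob (A \<inter> pre n F)" for n
    proof -
      have "(X - A) \<inter> pre n F = pre n F - (A \<inter> pre n F)" using space_\<mu> by auto
      moreover have "prob (pre n F - (A \<inter> pre n F)) = prob (pre n F) - prob (A \<inter> pre n F)"
        using A F by (intro finite_measure_Diff) auto
      ultimately show ?thesis using prob_pre[OF F, of n] by simp
    qed
    moreover have "prob (X - A) = 1 - prob A" using A prob_compl space_\<mu> by metis
    moreover have "(\<lambda>n. prob F - prob (A \<inter> pre n F)) \<longlonglongrightarrow> prob F - prob A * prob F"
      by (intro tendsto_diff tendsto_const compl)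
    ultimately show ?case by (simp add: left_diff_distrib)
  next
    case (union A)
    then have A: "range A \<subseteq> sets \<mu>" using sigma_sets_rays by simp
    have sums: "(\<lambda>i. prob (A i)) sums prob (\<Union>i. A i)"
      using A union(1) by (rule finite_measure_UNION)
    have sumsn: "(\<lambda>i. prob (A i \<inter> pre n F)) sums prob ((\<Union>i. A i) \<inter> pre n F)" for n
    proof -
      have "(\<lambda>i. prob (A i \<inter> pre n F)) sums prob (\<Union>i. A i \<inter> pre n F)"
        using A union(1) by (intro finite_measure_UNION) (auto simp: disjoint_family_on_def)
      moreover have "(\<Union>i. A i \<inter> pre n F) = (\<Union>i. A i) \<inter> pre n F" by auto
      ultimately show ?thesis by simp
    qed
    have "(\<lambda>n. \<Sum>i. prob (A i \<inter> pre n F)) \<longlonglongrightarrow> (\<Sum>i. prob (A i) * prob F)"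
    proof (intro tannerys_theorem[THEN conjunct2, THEN conjunct2])
      show "(\<lambda>n. prob (A k \<inter> pre n F)) \<longlonglongrightarrow> prob (A k) * prob F" for k by (rule union)
      show "\<forall>\<^sub>F (k, n) in at_top \<times>\<^sub>F sequentially. norm (prob (A k \<inter> pre n F)) \<le> prob (A k)"
        using A by (intro always_eventually) (auto intro!: finite_measure_mono)
      show "summable (\<lambda>k. prob (A k))" using sums by (rule sums_summable)
    qed auto
    moreover have "(\<Sum>i. prob (A i \<inter> pre n F)) = prob ((\<Union>i. A i) \<inter> pre n F)" for n
      using sumsn by (rule sums_unique[symmetric])
    moreover have "(\<Sum>i. prob (A i) * prob F) = prob (\<Union>i. A i) * prob F"
      using sums_mult2[OF sums] by (rule sums_unique[symmetric])
    ultimately show ?case by simp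
  qed
qed

end

section \<open>Branches and short returns\<close>

text \<open>\<open>half_sqrt ^ k\<close> is the square root of the dyadic radius
  \<open>(1 / 2) ^ k\<close>.\<close>

definition half_sqrt :: real where "half_sqrt = sqrt (1 / 2)"

lemma half_sqrt_mult_self: "half_sqrt * half_sqrt = 1 / 2"
  unfolding half_sqrt_def by (rule real_sqrt_mult_self[THEN trans]) simp

lemma half_sqrt_power2: "half_sqrt ^ k * half_sqrt ^ k = (1 / 2) ^ k"
  by (simp only: power_mult_distrib[symmetric] half_sqrt_mult_self)

lemma half_sqrt_bounds: "0 < half_sqrt" "half_sqrt < 1"
  unfolding half_sqrt_def using real_sqrt_less_iff[of "1/2" 1] by (simp_all del: real_sqrt_less_iff)

text \<open>The union over the \<open>k\<close> times at scale \<open>k\<close> costs a factor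
  \<open>k\<close>, and \<open>k * half_sqrt ^ k\<close> is still summable.\<close>

lemma AE_eventually_not_in_open:
  fixes W :: "nat \<Rightarrow> nat \<Rightarrow> real set"
  assumes W: "\<And>k j. W k j \<in> sets borel"
    and le: "\<And>k j. 1 \<le> j \<Longrightarrow> j \<le> k \<Longrightarrow> emeasure lborel (W k j) \<le> ennreal (c * half_sqrt ^ k)" and c: "c \<ge> 0"
  shows "AE x in lborel. eventually (\<lambda>k. \<forall>j\<in>{1..k}. x \<notin> W k j) sequentially"
proof -
  have U_le: "emeasure lborel (\<Union>j\<in>{1..k}. W k j) \<le> ennreal (real k * (c * half_sqrt ^ k))" for k
  proof -
    have "emeasure lborel (\<Union>j\<in>{1..k}. W k j) \<le> (\<Sum>j\<in>{1..k}. emeasure lborel (W k j))"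
      using W by (intro emeasure_subadditive_finite) auto
    also have "\<dots> \<le> (\<Sum>j\<in>{1..k}. ennreal (c * half_sqrt ^ k))" by (intro sum_mono le) auto
    also have "\<dots> = ennreal (real k * (c * half_sqrt ^ k))" 
      using c half_sqrt_bounds by (simp add: ennreal_mult' ennreal_of_nat_eq_real_of_nat)
    finally show ?thesis .
  qed
  have "AE x in lborel. eventually (\<lambda>k. x \<in> space lborel - (\<Union>j\<in>{1..k}. W k j)) sequentially"
  proof (rule borel_cantelli_AE1)
    show "(\<Union>j\<in>{1..k}. W k j) \<in> sets lborel" for k using W by auto
    show "emeasure lborel (\<Union>j\<in>{1..k}. W k j) < \<infinity>" for k
      using U_le[of k] by (simp add: order.strict_trans1)
    show "summable (\<lambda>k. measure lborel (\<Union>j\<in>{1..k}. W k j))"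
    proof (rule summable_comparison_test')
      show "norm (measure lborel (\<Union>j\<in>{1..k}. W k j)) \<le> c * (real k * half_sqrt ^ k)" for k
        using U_le[of k] c half_sqrt_bounds
        by (simp add: measure_def enn2real_leI mult_ac)
      have "summable (\<lambda>k. real (Suc k) * half_sqrt ^ k)"
        using geometric_deriv_sums[of half_sqrt] half_sqrt_bounds by (auto intro: sums_summable)
      then have "summable (\<lambda>k. real k * half_sqrt ^ k)"
        by (rule summable_comparison_test'[where N = 0]) (use half_sqrt_bounds in \<open>auto simp: mult_right_mono\<close>)
      then show "summable (\<lambda>k. c * (real k * half_sqrt ^ k))" by (rule summable_mult)
    qed
  qed
  then show ?thesis by eventually_elim (auto elim: eventually_mono)
qed

locale expanding_interval_map = mixing_interval_map \<mu> f X K \<tau> for \<mu> f X K \<tau> +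
  fixes P :: "real set set" and \<Lambda> :: real
  assumes P_partition: "partition_on X P" and P_countable: "countable P"
    and P_interval: "\<And>I. I \<in> P \<Longrightarrow> is_interval I"
    and P_monotone: "\<And>I. I \<in> P \<Longrightarrow> mono_on I f \<or> antimono_on I f"
    and \<Lambda>: "\<Lambda> > 1" and expanding: "\<And>I. I \<in> P \<Longrightarrow> expanding_on f \<Lambda> I"
begin

section \<open>Branches of the iterates\<close>

abbreviation branches :: "nat \<Rightarrow> real set set" where
  "branches \<equiv> iterated_partition X f P"

definition cylinder :: "(nat \<Rightarrow> real set) \<Rightarrow> nat \<Rightarrow> real set" where
  "cylinder J n = {x \<in> X. \<forall>i<n. (f ^^ i) x \<in> J i}"

lemma branches_eq: "branches n = (\<lambda>J. cylinder J n) ` ({..<n} \<rightarrow>\<^sub>E P) - {{}}"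
proof -
  have "cylinder J n = cylinder (restrict J {..<n}) n" for J by (auto simp: cylinder_def)
  moreover have "restrict J {..<n} \<in> {..<n} \<rightarrow>\<^sub>E P" if "\<forall>i<n. J i \<in> P" for J using that by auto
  moreover have "\<forall>i<n. J i \<in> P" if "J \<in> {..<n} \<rightarrow>\<^sub>E P" for J using that by auto
  ultimately have "{cylinder J n | J. \<forall>i<n. J i \<in> P} = (\<lambda>J. cylinder J n) ` ({..<n} \<rightarrow>\<^sub>E P)"
    by blast
  then show ?thesis by (simp add: iterated_partition_def cylinder_def)
qed

lemma branchE:
  assumes "I \<in> branches n"
  obtains J where "\<And>i. i < n \<Longrightarrow> J i \<in> P" "I = cylinder J n"
  using assms unfolding branches_eq by auto

lemma countable_branches: "countable (branches n)"
  unfolding branches_eq using P_countable by (intro countable_Diff countable_image countable_PiE) auto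

lemma finite_branches: "finite P \<Longrightarrow> finite (branches n)"
  unfolding branches_eq by (intro finite_Diff finite_imageI finite_PiE) auto

lemma card_branches_le: "finite P \<Longrightarrow> card (branches n) \<le> card P ^ n"
proof -
  assume P: "finite P"
  have fin: "finite ({..<n} \<rightarrow>\<^sub>E P)" using P by (intro finite_PiE) auto
  have "card (branches n) \<le> card ((\<lambda>J. cylinder J n) ` ({..<n} \<rightarrow>\<^sub>E P))"
    unfolding branches_eq using fin by (intro card_mono) auto
  also have "\<dots> \<le> card ({..<n} \<rightarrow>\<^sub>E P)" using fin by (rule card_image_le)
  finally show ?thesis by (simp add: card_PiE)
qed

lemma branch_subset: "I \<in> branches n \<Longrightarrow> I \<subseteq> X"
  by (auto simp: iterated_partition_def)

lemma branch_nonempty: "I \<in> branches n \<Longrightarrow> I \<noteq> {}"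
  by (auto simp: iterated_partition_def)

lemma in_P_unique: "I \<in> P \<Longrightarrow> I' \<in> P \<Longrightarrow> x \<in> I \<Longrightarrow> x \<in> I' \<Longrightarrow> I = I'"
  using partition_onD2[OF P_partition] by (auto simp: disjoint_def)

lemma disjoint_branches: "disjoint_family_on (\<lambda>I. I) (branches n)"
proof (unfold disjoint_family_on_def, intro ballI impI)
  fix I I' assume I: "I \<in> branches n" "I' \<in> branches n" "I \<noteq> I'"
  obtain J where J: "\<And>i. i < n \<Longrightarrow> J i \<in> P" "I = cylinder J n" using branchE I by metis
  obtain J' where J': "\<And>i. i < n \<Longrightarrow> J' i \<in> P" "I' = cylinder J' n" using branchE I by metis
  show "I \<inter> I' = {}"
  proof (rule ccontr)
    assume "I \<inter> I' \<noteq> {}"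
    then obtain x where "x \<in> I" "x \<in> I'" by auto
    then have "J i = J' i" if "i < n" for i
      using that in_P_unique[OF J(1) J'(1), of i i "(f ^^ i) x"] J J' by (auto simp: cylinder_def)
    then show False using I J J' by (auto simp: cylinder_def)
  qed
qed

lemma Union_branches: "\<Union>(branches n) = X"
proof
  show "\<Union>(branches n) \<subseteq> X" using branch_subset by auto
  show "X \<subseteq> \<Union>(branches n)"
  proof
    fix x assume x: "x \<in> X"
    have "\<exists>I. I \<in> P \<and> (f ^^ i) x \<in> I" for i
      using funpow_space[of x i] x partition_onD1[OF P_partition] by (auto simp: space_\<mu>)
    then obtain J where J: "\<And>i. J i \<in> P" "\<And>i. (f ^^ i) x \<in> J i" by metis
    then have "x \<in> cylinder J n" using x by (auto simp: cylinder_def)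
    moreover have "cylinder J n \<in> branches n"
      using J \<open>x \<in> cylinder J n\<close> unfolding iterated_partition_def cylinder_def[symmetric] by auto
    ultimately show "x \<in> \<Union>(branches n)" by auto
  qed
qed

text \<open>Both claims are needed in one induction: monotonicity of \<open>f ^^ n\<close> is what
  makes the part of the cylinder that is sent into the interval \<open>J n\<close> an interval
  again.\<close>

lemma cylinder_interval:
  assumes "\<And>i. i < n \<Longrightarrow> J i \<in> P"
  shows "is_interval (cylinder J n) \<and>
    (mono_on (cylinder J n) (f ^^ n) \<or> antimono_on (cylinder J n) (f ^^ n))"
  using assms
proof (induction n)
  case 0
  then show ?case using X_interval by (auto simp: cylinder_def monotone_on_def)
next
  case (Suc n)
  let ?C = "cylinder J n" and ?C' = "cylinder J (Suc n)"
  have IH: "is_interval ?C" "mono_on ?C (f ^^ n) \<or> antimono_on ?C (f ^^ n)" using Suc by auto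
  have Jn: "is_interval (J n)" "mono_on (J n) f \<or> antimono_on (J n) f"
    using P_interval P_monotone Suc.prems by auto
  have C': "x \<in> ?C' \<longleftrightarrow> x \<in> ?C \<and> (f ^^ n) x \<in> J n" for x
    by (auto simp: cylinder_def less_Suc_eq)
  have "is_interval ?C'"
    unfolding is_interval_1
  proof (intro ballI allI impI)
    fix x z y assume x: "x \<in> ?C'" and z: "z \<in> ?C'" and y: "x \<le> y \<and> y \<le> z"
    have yC: "y \<in> ?C" using x z y C' mem_is_interval_1_I[OF IH(1)] by blast
    have "(f ^^ n) x \<le> (f ^^ n) y \<and> (f ^^ n) y \<le> (f ^^ n) z \<or> (f ^^ n) z \<le> (f ^^ n) y \<and> (f ^^ n) y \<le> (f ^^ n) x"
      using IH(2) x z y yC C' unfolding monotone_on_def by blast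
    then have "(f ^^ n) y \<in> J n" using x z C' mem_is_interval_1_I[OF Jn(1)] by blast
    then show "y \<in> ?C'" using yC C' by simp
  qed
  moreover have "mono_on ?C' (f ^^ Suc n) \<or> antimono_on ?C' (f ^^ Suc n)"
    using IH(2) Jn(2) C' unfolding monotone_on_def funpow.simps comp_apply by blast
  ultimately show ?case by blast
qed

lemma branch_interval: "I \<in> branches n \<Longrightarrow> is_interval I"
  using cylinder_interval branchE by metis

lemma branch_borel: "I \<in> branches n \<Longrightarrow> I \<in> sets borel"
  using branch_interval real_interval_borel_measurable by blast

lemma expanding_P:
  assumes I: "I \<in> P" "x \<in> I" "y \<in> I"
  shows "\<Lambda> * \<bar>x - y\<bar> \<le> \<bar>f x - f y\<bar>"
proof -
  obtain D where D: "\<And>x. x \<in> I \<Longrightarrow> (f has_real_derivative D x) (at x within I)" "\<And>x. x \<in> I \<Longrightarrow> \<bar>D x\<bar> \<ge> \<Lambda>"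
    using expanding[OF I(1)] by (auto simp: expanding_on_def)
  have *: "\<Lambda> * \<bar>x - y\<bar> \<le> \<bar>f x - f y\<bar>" if "x \<in> I" "y \<in> I" "x \<le> y" for x y
  proof -
    have sub: "{x..y} \<subseteq> I" using mem_is_interval_1_I[OF P_interval[OF I(1)] that(1,2)] by auto
    have "\<exists>z\<in>{x..y}. f y - f x = D z * (y - x)"
    proof (rule mvt_very_simple[OF that(3)])
      fix z assume "x \<le> z" "z \<le> y"
      then have "z \<in> I" using sub by auto
      then show "(f has_derivative (\<lambda>h. D z * h)) (at z within {x..y})"
        using D(1) sub has_derivative_subset unfolding has_field_derivative_def by blast
    qed
    then obtain z where z: "z \<in> I" "f y - f x = D z * (y - x)" using sub by auto
    have "f x - f y = D z * (x - y)" using z(2) by (simp add: algebra_simps)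
    then have "\<bar>f x - f y\<bar> = \<bar>D z\<bar> * \<bar>x - y\<bar>" by (simp only: abs_mult)
    then show ?thesis using D(2)[OF z(1)] by (simp add: mult_right_mono)
  qed
  show ?thesis using *[of x y] *[of y x] I by (cases "x \<le> y") (auto simp: abs_minus_commute)
qed

lemma expanding_branch:
  assumes I: "I \<in> branches n" "x \<in> I" "y \<in> I"
  shows "\<Lambda> ^ n * \<bar>x - y\<bar> \<le> \<bar>(f ^^ n) x - (f ^^ n) y\<bar>"
proof -
  obtain J where J: "\<And>i. i < n \<Longrightarrow> J i \<in> P" "I = cylinder J n" using branchE I by metis
  have "\<Lambda> ^ m * \<bar>x - y\<bar> \<le> \<bar>(f ^^ m) x - (f ^^ m) y\<bar>" if "m \<le> n" for m
    using that
  proof (induction m)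
    case (Suc m)
    then have "\<Lambda> * (\<Lambda> ^ m * \<bar>x - y\<bar>) \<le> \<Lambda> * \<bar>(f ^^ m) x - (f ^^ m) y\<bar>"
      using \<Lambda> by (intro mult_left_mono) auto
    also have "\<dots> \<le> \<bar>f ((f ^^ m) x) - f ((f ^^ m) y)\<bar>"
      using Suc.prems J I by (intro expanding_P[OF J(1)[of m]]) (auto simp: cylinder_def)
    finally show ?case by (simp add: mult.assoc)
  qed auto
  then show ?thesis by simp
qed

text \<open>A set of centres \<open>z\<close>, not of returning points: some \<open>x\<close> in
  \<open>I\<close> and its image under \<open>f ^^ j\<close> both lie in the ball around
  \<open>z\<close>. This makes it open for every \<open>I\<close>, and Borel-Cantelli then speaks
  directly about almost every centre.\<close>

definition near_returns :: "nat \<Rightarrow> real \<Rightarrow> real set \<Rightarrow> real set" where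
  "near_returns j r I = {z. \<exists>x\<in>I. \<bar>x - z\<bar> < r \<and> \<bar>(f ^^ j) x - z\<bar> < r}"

lemma near_returns_open: "open (near_returns j r I)"
proof -
  have "near_returns j r I = (\<Union>x\<in>I. ball x r \<inter> ball ((f ^^ j) x) r)"
    by (auto simp: near_returns_def dist_real_def)
  then show ?thesis by auto
qed

text \<open>If \<open>x\<close> and \<open>y\<close> witness that \<open>z\<close> and
  \<open>w\<close> are such centres, then
  \<open>(\<Lambda> - 1) * \<bar>x - y\<bar> \<le> 4 * r\<close>, and \<open>z\<close>,
  \<open>w\<close> are within \<open>r\<close> of \<open>x\<close>, \<open>y\<close>.\<close>

definition \<kappa>r where "\<kappa>r = 2 + 4 / (\<Lambda> - 1)"

lemma \<kappa>r_pos: "\<kappa>r > 0" using \<Lambda> by (simp add: \<kappa>r_def add_pos_pos)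

text \<open>On a branch \<open>x - f\<^sup>j x\<close> varies at rate at least \<open>\<Lambda> - 1\<close>, so that near returns happen in a
  set of diameter \<open>O(r)\<close>.\<close>
lemma near_returns_measure:
  assumes I: "I \<in> branches j" and j: "j \<ge> 1" and r: "r > 0"
  shows "emeasure lborel (near_returns j r I) \<le> ennreal (\<kappa>r * r)"
proof -
  have "\<bar>z - w\<bar> \<le> \<kappa>r * r" if z: "z \<in> near_returns j r I" and w: "w \<in> near_returns j r I" for z w
  proof -
    obtain x where x: "x \<in> I" "\<bar>x - z\<bar> < r" "\<bar>(f ^^ j) x - z\<bar> < r" using z by (auto simp: near_returns_def)
    obtain y where y: "y \<in> I" "\<bar>y - w\<bar> < r" "\<bar>(f ^^ j) y - w\<bar> < r" using w by (auto simp: near_returns_def)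
    have "\<Lambda> * \<bar>x - y\<bar> \<le> \<Lambda> ^ j * \<bar>x - y\<bar>" using \<Lambda> j by (intro mult_right_mono self_le_power) auto
    also have "\<dots> \<le> \<bar>(f ^^ j) x - (f ^^ j) y\<bar>" by (rule expanding_branch[OF I x(1) y(1)])
    also have "\<dots> \<le> \<bar>x - y\<bar> + 4 * r" using x y by linarith
    finally have "(\<Lambda> - 1) * \<bar>x - y\<bar> \<le> 4 * r" by (simp add: left_diff_distrib)
    then have "\<bar>x - y\<bar> \<le> 4 * r / (\<Lambda> - 1)" using \<Lambda> by (simp add: pos_le_divide_eq mult.commute)
    then have "\<bar>z - w\<bar> \<le> 2 * r + 4 * r / (\<Lambda> - 1)" using x y by linarith
    then show ?thesis by (simp add: \<kappa>r_def distrib_right)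
  qed
  then obtain S where "S \<in> sets borel" "near_returns j r I \<subseteq> S" "emeasure lborel S \<le> ennreal (\<kappa>r * r)"
    using emeasure_lborel_le_diam[of "near_returns j r I" "\<kappa>r * r"] \<kappa>r_pos r by (auto simp: less_imp_le)
  then show ?thesis using emeasure_mono[of "near_returns j r I" S lborel] by (auto intro: order.trans)
qed

text \<open>By Fubini the Lebesgue integral over \<open>z\<close> of the measure of the ball of
  radius \<open>r\<close> is \<open>2 * r\<close>. Markov's inequality at level
  \<open>sqrt r\<close> bounds the exceptional centres by \<open>2 * sqrt r\<close>, which is
  summable over dyadic radii; no bound on the density enters.\<close>

lemma AE_small_balls: "AE z in \<mu>. eventually (\<lambda>k. prob (ball z ((1 / 2) ^ k) \<inter> X) \<le> half_sqrt ^ k) sequentially"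
proof (rule AE_transfer)
  have idm: "(\<lambda>x. x) \<in> measurable \<mu> borel"
    by (rule measurableI) (auto simp: sets_\<mu>_iff space_\<mu> X_borel)
  have sf: "sigma_finite_measure \<mu>" by (rule sigma_finite_measure_axioms)
  interpret pair_sigma_finite lborel \<mu> ..
  define V where "V k = {z. prob (ball z ((1 / 2) ^ k) \<inter> X) > half_sqrt ^ k}" for k :: nat
  define g where "g k = (\<lambda>p. indicator {p :: real \<times> real. \<bar>fst p - snd p\<bar> < (1 / 2) ^ k} p :: ennreal)" for k :: nat
  have gm: "g k \<in> borel_measurable (lborel \<Otimes>\<^sub>M \<mu>)" for k
  proof -
    have "(\<lambda>p. (fst p, snd p)) \<in> measurable (lborel \<Otimes>\<^sub>M \<mu>) (borel \<Otimes>\<^sub>M borel)"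
      using measurable_compose[OF measurable_snd idm] by (intro measurable_Pair) auto
    moreover have "g k \<in> borel_measurable (borel \<Otimes>\<^sub>M borel)" unfolding g_def by measurable
    ultimately have "(\<lambda>p. g k (fst p, snd p)) \<in> borel_measurable (lborel \<Otimes>\<^sub>M \<mu>)"
      by (rule measurable_compose)
    then show ?thesis by simp
  qed
  have inner: "(\<integral>\<^sup>+x. g k (z, x) \<partial>\<mu>) = emeasure \<mu> (ball z ((1 / 2) ^ k) \<inter> X)" for k z
  proof -
    have "(\<integral>\<^sup>+x. g k (z, x) \<partial>\<mu>) = (\<integral>\<^sup>+x. indicator (ball z ((1 / 2) ^ k) \<inter> X) x \<partial>\<mu>)"
      by (intro nn_integral_cong) (auto simp: g_def space_\<mu> dist_real_def split: split_indicator)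
    then show ?thesis by (simp add: sets_\<mu>_iff)
  qed
  have meas: "(\<lambda>z. emeasure \<mu> (ball z ((1 / 2) ^ k) \<inter> X)) \<in> borel_measurable lborel" for k
    using sigma_finite_measure.borel_measurable_nn_integral_fst[OF sf gm[of k]] by (simp add: inner)
  have V_eq: "V k = {z \<in> space lborel. ennreal (half_sqrt ^ k) < emeasure \<mu> (ball z ((1 / 2) ^ k) \<inter> X)}" for k
    using half_sqrt_bounds by (auto simp: V_def emeasure_eq_measure ennreal_less_iff)
  have V_sets: "V k \<in> sets borel" for k
    using borel_measurable_less[OF measurable_const meas, of "ennreal (half_sqrt ^ k)" k] unfolding V_eq by simp
  have V_le: "emeasure lborel (V k) \<le> ennreal (2 * half_sqrt ^ k)" for k
  proof -
    let ?u = "half_sqrt ^ k"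
    have u: "?u > 0" using half_sqrt_bounds by simp
    have "ennreal ?u * emeasure lborel (V k) = (\<integral>\<^sup>+z. ennreal ?u * indicator (V k) z \<partial>lborel)"
      using V_sets by (simp add: nn_integral_cmult_indicator)
    also have "\<dots> \<le> (\<integral>\<^sup>+z. emeasure \<mu> (ball z ((1 / 2) ^ k) \<inter> X) \<partial>lborel)"
      by (intro nn_integral_mono) (auto simp: V_eq split: split_indicator)
    also have "\<dots> = (\<integral>\<^sup>+z. \<integral>\<^sup>+x. g k (z, x) \<partial>\<mu> \<partial>lborel)" by (simp add: inner)
    also have "\<dots> = (\<integral>\<^sup>+x. \<integral>\<^sup>+z. g k (z, x) \<partial>lborel \<partial>\<mu>)"
      using Fubini'[of "\<lambda>z x. g k (z, x)"] gm by simp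
    also have "\<dots> = (\<integral>\<^sup>+x. ennreal (2 * (1 / 2) ^ k) \<partial>\<mu>)"
    proof (intro nn_integral_cong)
      fix x
      have "(\<integral>\<^sup>+z. g k (z, x) \<partial>lborel) = (\<integral>\<^sup>+z. indicator {x - (1 / 2) ^ k<..<x + (1 / 2) ^ k} z \<partial>lborel)"
        by (intro nn_integral_cong) (auto simp: g_def abs_less_iff split: split_indicator)
      then show "(\<integral>\<^sup>+z. g k (z, x) \<partial>lborel) = ennreal (2 * (1 / 2) ^ k)" by simp
    qed
    also have "\<dots> = ennreal (2 * (1 / 2) ^ k)" by (simp add: emeasure_space_1)
    also have "\<dots> = ennreal ?u * ennreal (2 * ?u)"
      using u half_sqrt_power2[of k] by (simp add: ennreal_mult[symmetric] algebra_simps)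
    finally show ?thesis using half_sqrt_bounds by (subst (asm) ennreal_mult_le_mult_iff) auto
  qed
  have "AE x in lborel. eventually (\<lambda>k. \<forall>j\<in>{1..k}. x \<notin> V k) sequentially"
    by (rule AE_eventually_not_in_open[where c = 2]) (use V_sets V_le in auto)
  then show "AE z in lborel. eventually (\<lambda>k. prob (ball z ((1 / 2) ^ k) \<inter> X) \<le> half_sqrt ^ k) sequentially"
  proof eventually_elim
    case (elim z)
    show ?case using elim eventually_ge_at_top[of 1]
      by eventually_elim (auto simp: V_def not_less)
  qed
qed

lemma AE_no_near_returns:
  assumes \<I>: "\<And>k j. \<I> k j \<subseteq> branches j" and c: "c \<ge> 0"
    and le: "\<And>k j. 1 \<le> j \<Longrightarrow> j \<le> k div q \<Longrightarrow>
      emeasure lborel (\<Union>I\<in>\<I> k j. near_returns j ((1 / 2) ^ k) I) \<le> ennreal (c * half_sqrt ^ k)"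
  shows "AE z in \<mu>. eventually (\<lambda>k. \<forall>j\<in>{1..k div q}. \<forall>I\<in>\<I> k j. z \<notin> near_returns j ((1 / 2) ^ k) I) sequentially"
proof (rule AE_transfer)
  define W where "W k j = (if 1 \<le> j \<and> j \<le> k div q then \<Union>I\<in>\<I> k j. near_returns j ((1 / 2) ^ k) I else {})" for k j
  have "AE z in lborel. eventually (\<lambda>k. \<forall>j\<in>{1..k}. z \<notin> W k j) sequentially"
  proof (rule AE_eventually_not_in_open[OF _ _ c])
    show "W k j \<in> sets borel" for k j by (auto simp: W_def near_returns_open intro!: borel_open)
    show "emeasure lborel (W k j) \<le> ennreal (c * half_sqrt ^ k)" for k j using le by (auto simp: W_def)
  qed
  then show "AE z in lborel. eventually (\<lambda>k. \<forall>j\<in>{1..k div q}. \<forall>I\<in>\<I> k j. z \<notin> near_returns j ((1 / 2) ^ k) I) sequentially"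
  proof eventually_elim
    case (elim z)
    then show ?case
    proof eventually_elim
      case (elim k)
      show ?case
      proof
        fix j assume j: "j \<in> {1..k div q}"
        then have "j \<in> {1..k}" by (auto intro: order.trans[OF _ div_le_dividend])
        then show "\<forall>I\<in>\<I> k j. z \<notin> near_returns j ((1 / 2) ^ k) I" using bspec[OF elim \<open>j \<in> {1..k}\<close>] j by (auto simp: W_def)
      qed
    qed
  qed
qed

text \<open>\<open>\<rho> ^ k\<close> is a positive power of the radius \<open>(1 / 2) ^ k\<close>.
  Dyadic radii make Borel-Cantelli applicable and do not involve the sequence
  \<open>r\<close>.\<close>

definition rare_returns :: "real \<Rightarrow> bool" where
  "rare_returns z \<longleftrightarrow> (\<exists>A \<rho>. 0 \<le> A \<and> 0 < \<rho> \<and> \<rho> < 1 \<and>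
     eventually (\<lambda>k. \<forall>j\<ge>1. \<forall>G\<in>sets \<mu>. G \<subseteq> ball z ((1 / 2) ^ k) \<inter> X \<longrightarrow>
       prob (ball z ((1 / 2) ^ k) \<inter> X \<inter> pre j G) \<le> A * \<rho> ^ k * prob G) sequentially)"

text \<open>Only times up to \<open>k div q\<close> need geometry. Later the mixing error
  \<open>exp (- \<tau> * k / q)\<close> is itself exponentially small in \<open>k\<close>, and
  rounding \<open>k / q\<close> down costs the factor \<open>exp \<tau>\<close>.\<close>

lemma rare_returnsI:
  assumes small: "eventually (\<lambda>k. prob (ball z ((1 / 2) ^ k) \<inter> X) \<le> half_sqrt ^ k) sequentially"
    and q: "q \<ge> 1" and A: "A \<ge> 0"
    and early: "eventually (\<lambda>k. \<forall>j\<in>{1..k div q}. \<forall>G\<in>sets \<mu>. G \<subseteq> ball z ((1 / 2) ^ k) \<inter> X \<longrightarrow>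
       prob (ball z ((1 / 2) ^ k) \<inter> X \<inter> pre j G) \<le> A * half_sqrt ^ k * prob G) sequentially"
  shows "rare_returns z"
proof -
  define \<rho> where "\<rho> = max half_sqrt (exp (- \<tau> / real q))"
  have \<rho>: "0 < \<rho>" "\<rho> < 1" "half_sqrt \<le> \<rho>" "exp (- \<tau> / real q) \<le> \<rho>"
    using half_sqrt_bounds \<tau>_pos q by (auto simp: \<rho>_def)
  define A' where "A' = A + 1 + K * exp \<tau>"
  have "eventually (\<lambda>k. \<forall>j\<ge>1. \<forall>G\<in>sets \<mu>. G \<subseteq> ball z ((1 / 2) ^ k) \<inter> X \<longrightarrow>
       prob (ball z ((1 / 2) ^ k) \<inter> X \<inter> pre j G) \<le> A' * \<rho> ^ k * prob G) sequentially"
    using small early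
  proof eventually_elim
    case (elim k)
    let ?B = "ball z ((1 / 2) ^ k) \<inter> X"
    have u: "half_sqrt ^ k \<le> \<rho> ^ k" using \<rho> half_sqrt_bounds by (intro power_mono) auto
    show ?case
    proof (intro allI impI ballI)
      fix j :: nat and G assume j: "1 \<le> j" and G: "G \<in> sets \<mu>" "G \<subseteq> ?B"
      show "prob (?B \<inter> pre j G) \<le> A' * \<rho> ^ k * prob G"
      proof (cases "j \<le> k div q")
        case True
        then have "prob (?B \<inter> pre j G) \<le> A * half_sqrt ^ k * prob G" using elim j G by auto
        also have "\<dots> \<le> A' * \<rho> ^ k * prob G"
          using A u half_sqrt_bounds K_pos \<rho>
          by (intro mult_right_mono mult_mono) (auto simp: A'_def)
        finally show ?thesis .
      next
        case False
        have "is_interval ?B" using X_interval by (intro is_interval_Int) (auto simp: is_interval_ball_real)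
        then have mix: "exp_mixing_set K \<tau> ?B" by (intro interval_mixing) auto
        have "prob (?B \<inter> pre j G) \<le> (prob ?B + K * exp (- \<tau> * real (k div q))) * prob G"
          using False K_pos \<tau>_pos by (intro exp_mixing_setD(1)[OF mix G(1)]) auto
        also have "\<dots> \<le> (\<rho> ^ k + K * (exp \<tau> * \<rho> ^ k)) * prob G"
        proof (intro mult_right_mono add_mono mult_left_mono)
          show "prob ?B \<le> \<rho> ^ k" using elim(1) u by linarith
          have "real k / real q \<le> real (k div q) + 1"
          proof -
            have "k = q * (k div q) + k mod q" by simp
            also have "\<dots> \<le> q * (k div q) + q" using q by (intro add_left_mono less_imp_le mod_less_divisor) auto
            finally have "real k \<le> real q * (real (k div q) + 1)"
              unfolding of_nat_le_iff[where 'a = real, symmetric] by (simp add: distrib_left)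
            then show ?thesis using q by (simp add: pos_divide_le_eq mult.commute)
          qed
          then have "\<tau> * (real k / real q) \<le> \<tau> * (real (k div q) + 1)"
            using \<tau>_pos by (intro mult_left_mono) auto
          then have "exp (- \<tau> * real (k div q)) \<le> exp (\<tau> + real k * (- \<tau> / real q))"
            by (simp add: algebra_simps)
          also have "\<dots> = exp \<tau> * exp (- \<tau> / real q) ^ k" by (simp only: exp_add exp_of_nat_mult)
          also have "\<dots> \<le> exp \<tau> * \<rho> ^ k" using \<rho> by (intro mult_left_mono power_mono) auto
          finally show "exp (- \<tau> * real (k div q)) \<le> exp \<tau> * \<rho> ^ k" .
        qed (use K_pos in auto)
        also have "\<dots> = (1 + K * exp \<tau>) * \<rho> ^ k * prob G" by (simp add: algebra_simps)
        also have "\<dots> \<le> A' * \<rho> ^ k * prob G"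
          using A \<rho> by (intro mult_right_mono) (auto simp: A'_def)
        finally show ?thesis .
      qed
    qed
  qed
  then show ?thesis unfolding rare_returns_def using \<rho> A K_pos
    by (intro exI[of _ A'] exI[of _ \<rho>]) (auto simp: A'_def)
qed

theorem AE_rare_returns_finite:
  assumes fin: "finite P"
  shows "AE z in \<mu>. rare_returns z"
proof -
  \<comment> \<open>For \<open>j \<le> k div q\<close> there are at most
    \<open>2 ^ ((card P + 1) * j)\<close> branches, hence at most the square root of
    \<open>2 ^ k\<close>. With \<open>O((1 / 2) ^ k)\<close> for each branch, the total is
    \<open>O(half_sqrt ^ k)\<close>.\<close>
  define q where "q = 2 * (card P + 1)"
  have "AE z in \<mu>. eventually (\<lambda>k. \<forall>j\<in>{1..k div q}. \<forall>I\<in>branches j. z \<notin> near_returns j ((1 / 2) ^ k) I) sequentially"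
  proof (rule AE_no_near_returns[where c = \<kappa>r])
    fix k j assume j: "1 \<le> j" "j \<le> k div q"
    have "emeasure lborel (\<Union>I\<in>branches j. near_returns j ((1 / 2) ^ k) I)
        \<le> (\<Sum>I\<in>branches j. emeasure lborel (near_returns j ((1 / 2) ^ k) I))"
      by (intro emeasure_subadditive_finite finite_branches[OF fin]) (auto intro!: borel_open near_returns_open)
    also have "\<dots> \<le> (\<Sum>I\<in>branches j. ennreal (\<kappa>r * (1 / 2) ^ k))"
      using j by (intro sum_mono near_returns_measure) auto
    also have "\<dots> = ennreal (real (card (branches j)) * (\<kappa>r * (1 / 2) ^ k))"
      using \<kappa>r_pos by (simp add: ennreal_mult ennreal_of_nat_eq_real_of_nat)
    also have "\<dots> \<le> ennreal (\<kappa>r * half_sqrt ^ k)"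
    proof (rule ennreal_leI)
      have "real (card (branches j)) \<le> real (card P ^ j)" using card_branches_le[OF fin, of j] by simp
      also have "\<dots> \<le> real ((2 ^ (card P + 1)) ^ j)"
      proof -
        have "card P \<le> 2 ^ (card P + 1)" by (rule order.trans[OF less_imp_le[OF less_exp] power_increasing]) auto
        then have "card P ^ j \<le> (2 ^ (card P + 1)) ^ j" by (rule power_mono) simp
        then show ?thesis by (simp only: of_nat_le_iff)
      qed
      finally have N: "real (card (branches j)) \<le> 2 ^ ((card P + 1) * j)"
        by (simp only: power_mult of_nat_power of_nat_numeral)
      have "2 * ((card P + 1) * j) \<le> k" using j(2) div_times_less_eq_dividend[of k q] mult_le_mono1[OF j(2), of q]
        by (simp add: q_def algebra_simps)
      then have "half_sqrt ^ k \<le> half_sqrt ^ (2 * ((card P + 1) * j))"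
        using half_sqrt_bounds by (intro power_decreasing) auto
      also have "\<dots> = (1 / 2) ^ ((card P + 1) * j)" by (simp only: power_mult power2_eq_square half_sqrt_mult_self)
      finally have "real (card (branches j)) * half_sqrt ^ k \<le> 2 ^ ((card P + 1) * j) * (1 / 2) ^ ((card P + 1) * j)"
        using N half_sqrt_bounds by (intro mult_mono) auto
      also have "\<dots> = 1" by (simp only: power_mult_distrib[symmetric]) simp
      finally have "real (card (branches j)) * half_sqrt ^ k * (\<kappa>r * half_sqrt ^ k) \<le> 1 * (\<kappa>r * half_sqrt ^ k)"
        using \<kappa>r_pos half_sqrt_bounds by (intro mult_right_mono) auto
      then show "real (card (branches j)) * (\<kappa>r * (1 / 2) ^ k) \<le> \<kappa>r * half_sqrt ^ k"
        unfolding half_sqrt_power2[symmetric] by (simp only: mult.assoc mult.left_commute mult_1_left)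
    qed
    finally show "emeasure lborel (\<Union>I\<in>branches j. near_returns j ((1 / 2) ^ k) I) \<le> ennreal (\<kappa>r * half_sqrt ^ k)" .
  qed (use \<kappa>r_pos in auto)
  then show ?thesis using AE_small_balls
  proof eventually_elim
    case (elim z)
    show ?case
    \<comment> \<open>The constant for early returns is 0: for such a centre no point of the ball
      returns to it by time \<open>k div q\<close>.\<close>
    proof (rule rare_returnsI[OF elim(2), of q 0])
      show "eventually (\<lambda>k. \<forall>j\<in>{1..k div q}. \<forall>G\<in>sets \<mu>. G \<subseteq> ball z ((1 / 2) ^ k) \<inter> X \<longrightarrow>
       prob (ball z ((1 / 2) ^ k) \<inter> X \<inter> pre j G) \<le> 0 * half_sqrt ^ k * prob G) sequentially"
        using elim(1)
      proof eventually_elim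
        case (elim k)
        show ?case
        proof (intro ballI impI)
          fix j G assume j: "j \<in> {1..k div q}" and G: "G \<in> sets \<mu>" "G \<subseteq> ball z ((1 / 2) ^ k) \<inter> X"
          have "ball z ((1 / 2) ^ k) \<inter> X \<inter> pre j G = {}"
          proof (rule ccontr)
            assume "ball z ((1 / 2) ^ k) \<inter> X \<inter> pre j G \<noteq> {}"
            then obtain x where x': "x \<in> ball z ((1 / 2) ^ k) \<inter> X" "(f ^^ j) x \<in> G" by blast
            moreover from x' G(2) have "(f ^^ j) x \<in> ball z ((1 / 2) ^ k)" by blast
            ultimately have x: "x \<in> X" "\<bar>x - z\<bar> < (1 / 2) ^ k" "\<bar>(f ^^ j) x - z\<bar> < (1 / 2) ^ k"
              by (simp_all add: dist_real_def abs_minus_commute)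
            obtain I where "I \<in> branches j" "x \<in> I" using x(1) Union_branches by auto
            then have "z \<in> near_returns j ((1 / 2) ^ k) I" using x by (auto simp: near_returns_def)
            then show False using elim j \<open>I \<in> branches j\<close> by blast
          qed
          then show "prob (ball z ((1 / 2) ^ k) \<inter> X \<inter> pre j G) \<le> 0 * half_sqrt ^ k * prob G" by simp
        qed
      qed
    qed (auto simp: q_def)
  qed
qed

end

section \<open>Countable partitions with large images\<close>

lemma interval_minus_endpoints:
  fixes I :: "real set"
  assumes I: "is_interval I" "bounded I" and x: "x \<in> I" "x \<noteq> Inf I" "x \<noteq> Sup I"
  shows "x \<in> interior I"
proof -
  have bdd: "bdd_below I" "bdd_above I" using I bounded_imp_bdd_below bounded_imp_bdd_above by auto
  have "Inf I < x" "x < Sup I"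
    using x cInf_lower[OF x(1) bdd(1)] cSup_upper[OF x(1) bdd(2)] by auto
  then obtain s t where st: "s \<in> I" "s < x" "t \<in> I" "x < t"
    using cInf_lessD[of I x] less_cSupD[of I x] x(1) by auto
  then have "{s<..<t} \<subseteq> I" using mem_is_interval_1_I[OF I(1) st(1,3)] by auto
  then show ?thesis using st by (intro interiorI[of "{s<..<t}"]) auto
qed

text \<open>Replaces the infinitely many possible images of branches by finitely many cells, to
  which the pigeonhole principle applies.\<close>

lemma grid_cell_in_interval:
  fixes S :: "real set"
  assumes S: "is_interval S" "S \<subseteq> {\<alpha>..\<beta>}" and h: "h > 0" "3 * h \<le> measure lborel S"
    and p: "\<beta> - \<alpha> \<le> real p * h"
  shows "\<exists>i<p. {\<alpha> + real i * h<..<\<alpha> + real (Suc i) * h} \<subseteq> S"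
proof -
  have "S \<noteq> {}" using h by auto
  have bdd: "bdd_below S" "bdd_above S" using S(2) by (auto intro: bdd_below_mono bdd_above_mono)
  have Sab: "S \<subseteq> {Inf S..Sup S}" using bdd by (auto intro: cInf_lower cSup_upper)
  have "\<alpha> \<le> Inf S" by (rule cInf_greatest[OF \<open>S \<noteq> {}\<close>]) (use S(2) in auto)
  moreover have "Sup S \<le> \<beta>" by (rule cSup_least[OF \<open>S \<noteq> {}\<close>]) (use S(2) in auto)
  moreover have "Inf S \<le> Sup S" using \<open>S \<noteq> {}\<close> Sab by force
  ultimately have ab: "Inf S \<le> Sup S" "\<alpha> \<le> Inf S" "Sup S \<le> \<beta>" by auto
  have "measure lborel S \<le> measure lborel {Inf S..Sup S}"
    using Sab S(1) by (intro measure_mono_fmeasurable) (auto simp: real_interval_borel_measurable fmeasurable_def emeasure_lborel_Icc_eq)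
  then have len: "3 * h \<le> Sup S - Inf S" using h ab by simp
  define i where "i = nat \<lceil>(Inf S - \<alpha>) / h\<rceil>"
  have "0 \<le> (Inf S - \<alpha>) / h" using ab h by simp
  then have "(Inf S - \<alpha>) / h \<le> real i" "real i < (Inf S - \<alpha>) / h + 1"
    unfolding i_def by linarith+
  then have i: "Inf S \<le> \<alpha> + real i * h" "\<alpha> + real i * h < Inf S + h"
    using h by (simp_all add: field_simps)
  have Si: "\<alpha> + real (Suc i) * h < Sup S" using i len h by (simp add: algebra_simps)
  have "real (Suc i) * h < real p * h" using Si ab p by linarith
  then have "i < p" using h by simp
  moreover have "{\<alpha> + real i * h<..<\<alpha> + real (Suc i) * h} \<subseteq> S"
  proof
    fix x assume x: "x \<in> {\<alpha> + real i * h<..<\<alpha> + real (Suc i) * h}"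
    then have "Inf S < x" "x < Sup S" using i Si by auto
    then obtain s t where st: "s \<in> S" "s < x" "t \<in> S" "x < t"
      using cInf_lessD[OF \<open>S \<noteq> {}\<close>, of x] less_cSupD[OF \<open>S \<noteq> {}\<close>, of x] by auto
    then show "x \<in> S" using mem_is_interval_1_I[OF S(1) st(1,3)] by auto
  qed
  ultimately show ?thesis by blast
qed

locale large_image_map = expanding_interval_map \<mu> f X K \<tau> P \<Lambda> for \<mu> f X K \<tau> P \<Lambda> +
  fixes \<delta> C :: real
  assumes \<delta>: "\<delta> > 0" and C: "C > 0"
    and large_image: "\<And>n I. n \<ge> 1 \<Longrightarrow> I \<in> branches n \<Longrightarrow> measure lborel ((f ^^ n) ` I) \<ge> \<delta>"
    and distortion: "\<And>n I. n \<ge> 1 \<Longrightarrow> I \<in> branches n \<Longrightarrow> distortion_bounded_on (f ^^ n) C I"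
begin

section \<open>Distortion estimates on branches\<close>

abbreviation leb :: "real set \<Rightarrow> real" where "leb \<equiv> measure lborel"

definition len_X where "len_X = leb X"

lemma emeasure_leb: "A \<subseteq> X \<Longrightarrow> emeasure lborel A = ennreal (leb A)"
  using emeasure_lborel_finite[of A] by (intro emeasure_eq_ennreal_measure) auto

lemma leb_mono: "A \<in> sets borel \<Longrightarrow> B \<in> sets borel \<Longrightarrow> A \<subseteq> B \<Longrightarrow> B \<subseteq> X \<Longrightarrow> leb A \<le> leb B"
  using emeasure_lborel_finite[of B] by (intro measure_mono_fmeasurable) (auto simp: fmeasurable_def)

lemma leb_le_iff: "A \<subseteq> X \<Longrightarrow> B \<subseteq> X \<Longrightarrow> L \<ge> 0 \<Longrightarrow>
  emeasure lborel A \<le> ennreal L * emeasure lborel B \<longleftrightarrow> leb A \<le> L * leb B"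
  by (simp add: emeasure_leb ennreal_mult[symmetric])

lemma leb_expanding:
  assumes "S \<in> sets borel" "T \<in> sets borel" "S \<subseteq> X" "T \<subseteq> X" "\<And>x. x \<in> S \<Longrightarrow> h x \<in> T"
    and "L > 0" "\<And>x y. x \<in> S \<Longrightarrow> y \<in> S \<Longrightarrow> \<bar>x - y\<bar> \<le> L * \<bar>h x - h y\<bar>"
  shows "leb S \<le> L * leb T"
  using emeasure_le_expanding[of S T h L] assms by (simp add: leb_le_iff)

lemma funpow_X: "x \<in> X \<Longrightarrow> (f ^^ n) x \<in> X"
  using funpow_space[of x n] by (simp add: space_\<mu>)

lemma pre_borel: "G \<in> sets \<mu> \<Longrightarrow> I \<in> sets borel \<Longrightarrow> I \<subseteq> X \<Longrightarrow> I \<inter> pre n G \<in> sets borel"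
  using pre_sets[of G n] by (auto simp: sets_\<mu>_iff)

text \<open>By the mean value theorem \<open>f ^^ n\<close> is bi-Lipschitz on a branch, with
  constants whose ratio \<open>C\<^sup>2\<close> depends neither on \<open>n\<close> nor on the
  branch. The later estimates use bounded distortion only in this form.\<close>

lemma branch_slope:
  assumes n: "n \<ge> 1" and I: "I \<in> branches n"
  obtains m where "m > 0" "\<And>x y. x \<in> I \<Longrightarrow> y \<in> I \<Longrightarrow> m * \<bar>x - y\<bar> \<le> \<bar>(f ^^ n) x - (f ^^ n) y\<bar>"
    "\<And>x y. x \<in> I \<Longrightarrow> y \<in> I \<Longrightarrow> \<bar>(f ^^ n) x - (f ^^ n) y\<bar> \<le> C\<^sup>2 * m * \<bar>x - y\<bar>"
    "continuous_on I (f ^^ n)"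
proof -
  obtain D where D: "\<And>x. x \<in> I \<Longrightarrow> ((f ^^ n) has_real_derivative D x) (at x within I)"
    and ratio: "\<And>x y. x \<in> I \<Longrightarrow> y \<in> I \<Longrightarrow> inverse C \<le> D x / D y \<and> D x / D y \<le> C"
    using distortion[OF n I] by (auto simp: distortion_bounded_on_def)
  obtain x0 where x0: "x0 \<in> I" using branch_nonempty[OF I] by auto
  have D0: "D x \<noteq> 0" if "x \<in> I" for x using ratio[OF that that] C by auto
  \<comment> \<open>Derivatives do not vanish: a quotient by 0 is 0, which the positive lower bound
    \<open>inverse C\<close> excludes.\<close>
  have le: "\<bar>D x\<bar> \<le> C * \<bar>D y\<bar>" if "x \<in> I" "y \<in> I" for x y
  proof -
    have "0 \<le> D x / D y" using ratio[OF that] C by (meson inverse_nonnegative_iff_nonnegative less_imp_le order.trans)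
    then have "\<bar>D x / D y\<bar> \<le> C" using ratio[OF that] by (simp only: abs_of_nonneg)
    then have "\<bar>D x\<bar> / \<bar>D y\<bar> \<le> C" by (simp only: abs_divide)
    then show ?thesis using D0[OF that(2)] by (simp add: pos_divide_le_eq)
  qed
  define m where "m = \<bar>D x0\<bar> / C"
  have m: "m > 0" using D0[OF x0] C by (simp add: m_def)
  have slope: "\<exists>z\<in>I. \<bar>(f ^^ n) x - (f ^^ n) y\<bar> = \<bar>D z\<bar> * \<bar>x - y\<bar>" if "x \<in> I" "y \<in> I" "x \<le> y" for x y
  proof -
    have sub: "{x..y} \<subseteq> I" using mem_is_interval_1_I[OF branch_interval[OF I] that(1,2)] by auto
    have "\<exists>z\<in>{x..y}. (f ^^ n) y - (f ^^ n) x = D z * (y - x)"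
    proof (rule mvt_very_simple[OF that(3)])
      fix z assume "x \<le> z" "z \<le> y"
      then have "z \<in> I" using sub by auto
      then show "((f ^^ n) has_derivative (\<lambda>h. D z * h)) (at z within {x..y})"
        using D sub has_derivative_subset unfolding has_field_derivative_def by blast
    qed
    then obtain z where z: "z \<in> I" "(f ^^ n) y - (f ^^ n) x = D z * (y - x)" using sub by auto
    then have "(f ^^ n) x - (f ^^ n) y = D z * (x - y)" by (simp add: algebra_simps)
    then show ?thesis using z(1) by (auto simp: abs_mult)
  qed
  have slope': "\<exists>z\<in>I. \<bar>(f ^^ n) x - (f ^^ n) y\<bar> = \<bar>D z\<bar> * \<bar>x - y\<bar>" if "x \<in> I" "y \<in> I" for x y
    using slope[of x y] slope[of y x] that by (cases "x \<le> y") (auto simp: abs_minus_commute)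
  show ?thesis
  proof (rule that[OF m])
    fix x y assume xy: "x \<in> I" "y \<in> I"
    obtain z where z: "z \<in> I" "\<bar>(f ^^ n) x - (f ^^ n) y\<bar> = \<bar>D z\<bar> * \<bar>x - y\<bar>" using slope'[OF xy] by auto
    have "m \<le> \<bar>D z\<bar>" using le[OF x0 z(1)] C by (simp add: m_def pos_divide_le_eq mult.commute)
    then show "m * \<bar>x - y\<bar> \<le> \<bar>(f ^^ n) x - (f ^^ n) y\<bar>" unfolding z(2) by (rule mult_right_mono) simp
    have "\<bar>D z\<bar> \<le> C\<^sup>2 * m" using le[OF z(1) x0] C by (simp add: m_def power2_eq_square)
    then show "\<bar>(f ^^ n) x - (f ^^ n) y\<bar> \<le> C\<^sup>2 * m * \<bar>x - y\<bar>" unfolding z(2) by (rule mult_right_mono) simp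
  next
    show "continuous_on I (f ^^ n)" using D by (rule DERIV_continuous_on)
  qed
qed

lemma branch_image:
  assumes "n \<ge> 1" "I \<in> branches n"
  shows "is_interval ((f ^^ n) ` I)" "(f ^^ n) ` I \<in> sets borel" "(f ^^ n) ` I \<subseteq> X"
proof -
  have "continuous_on I (f ^^ n)" using branch_slope[OF assms] by metis
  then have "connected ((f ^^ n) ` I)"
    using branch_interval[OF assms(2)] by (intro connected_continuous_image) (auto simp: is_interval_connected_1)
  then show "is_interval ((f ^^ n) ` I)" by (simp add: is_interval_connected_1)
  then show "(f ^^ n) ` I \<in> sets borel" by (rule real_interval_borel_measurable)
  show "(f ^^ n) ` I \<subseteq> X" using branch_subset[OF assms(2)] funpow_X by auto
qed

lemma lipschitz_image_leb:
  assumes S: "S \<in> sets borel" "S \<subseteq> X" and T: "T \<in> sets borel" "T \<subseteq> X" "T \<subseteq> g ` S" and L: "L > 0"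
    and lip: "\<And>x y. x \<in> S \<Longrightarrow> y \<in> S \<Longrightarrow> \<bar>g x - g y\<bar> \<le> L * \<bar>x - y\<bar>"
  shows "leb T \<le> L * leb S"
proof -
  have "\<forall>y\<in>T. \<exists>x. x \<in> S \<and> g x = y" using T by auto
  then obtain h where h: "\<And>y. y \<in> T \<Longrightarrow> h y \<in> S" "\<And>y. y \<in> T \<Longrightarrow> g (h y) = y" by metis
  show ?thesis using lip h by (intro leb_expanding[of T S h] S T L) metis+
qed

text \<open>An image of length at least \<open>\<delta>\<close> forces a slope of order at least
  \<open>\<delta> / leb I\<close>, and preimages within the branch shrink by the slope.\<close>

lemma branch_pre_upper:
  assumes n: "n \<ge> 1" and I: "I \<in> branches n" and G: "G \<in> sets \<mu>"
  shows "leb (I \<inter> pre n G) \<le> C\<^sup>2 / \<delta> * leb I * leb G"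
proof -
  obtain m where m: "m > 0" "\<And>x y. x \<in> I \<Longrightarrow> y \<in> I \<Longrightarrow> m * \<bar>x - y\<bar> \<le> \<bar>(f ^^ n) x - (f ^^ n) y\<bar>"
    "\<And>x y. x \<in> I \<Longrightarrow> y \<in> I \<Longrightarrow> \<bar>(f ^^ n) x - (f ^^ n) y\<bar> \<le> C\<^sup>2 * m * \<bar>x - y\<bar>"
    using branch_slope[OF n I] by metis
  have Ib: "I \<in> sets borel" "I \<subseteq> X" using branch_borel branch_subset I by auto
  have Gb: "G \<in> sets borel" "G \<subseteq> X" using G by (auto simp: sets_\<mu>_iff)
  have "\<delta> \<le> leb ((f ^^ n) ` I)" by (rule large_image[OF n I])
  also have "\<dots> \<le> C\<^sup>2 * m * leb I"
    using C m by (intro lipschitz_image_leb[of I _ "f ^^ n"] Ib branch_image[OF n I]) auto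
  finally have d: "1 / m \<le> C\<^sup>2 / \<delta> * leb I" using m \<delta> by (simp add: field_simps)
  have "leb (I \<inter> pre n G) \<le> 1 / m * leb G"
    using m by (intro leb_expanding[of _ _ "f ^^ n"] pre_borel G Ib Gb) (auto simp: Ib field_simps dest: subsetD[OF Ib(2)])
  also have "\<dots> \<le> C\<^sup>2 / \<delta> * leb I * leb G" using d by (intro mult_right_mono) auto
  finally show ?thesis .
qed

text \<open>Conversely, an image inside \<open>X\<close> caps the slope at order
  \<open>len_X / leb I\<close>, so preimages of sets in the image cannot be too small.\<close>

lemma branch_pre_lower:
  assumes n: "n \<ge> 1" and I: "I \<in> branches n" and F: "F \<in> sets \<mu>" "F \<subseteq> (f ^^ n) ` I"
  shows "leb I * leb F \<le> C\<^sup>2 * len_X * leb (I \<inter> pre n F)"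
proof -
  obtain m where m: "m > 0" "\<And>x y. x \<in> I \<Longrightarrow> y \<in> I \<Longrightarrow> m * \<bar>x - y\<bar> \<le> \<bar>(f ^^ n) x - (f ^^ n) y\<bar>"
    "\<And>x y. x \<in> I \<Longrightarrow> y \<in> I \<Longrightarrow> \<bar>(f ^^ n) x - (f ^^ n) y\<bar> \<le> C\<^sup>2 * m * \<bar>x - y\<bar>"
    using branch_slope[OF n I] by metis
  have Ib: "I \<in> sets borel" "I \<subseteq> X" using branch_borel branch_subset I by auto
  have Fb: "F \<in> sets borel" "F \<subseteq> X" using F by (auto simp: sets_\<mu>_iff)
  have "leb I \<le> 1 / m * leb ((f ^^ n) ` I)"
    using m by (intro leb_expanding[of _ _ "f ^^ n"] Ib branch_image[OF n I]) (auto simp: field_simps)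
  also have "\<dots> \<le> 1 / m * len_X"
    unfolding len_X_def using m by (intro mult_left_mono leb_mono branch_image[OF n I]) auto
  finally have 1: "leb I \<le> 1 / m * len_X" .
  have "F \<subseteq> (f ^^ n) ` (I \<inter> pre n F)" using F(2) Ib(2) unfolding space_\<mu> by blast
  then have "leb F \<le> C\<^sup>2 * m * leb (I \<inter> pre n F)"
    using C m Ib by (intro lipschitz_image_leb[of "I \<inter> pre n F" _ "f ^^ n"] pre_borel F Ib Fb) (auto simp: space_\<mu>)
  then have "leb I * leb F \<le> 1 / m * len_X * (C\<^sup>2 * m * leb (I \<inter> pre n F))"
    using 1 m by (intro mult_mono) (auto simp: len_X_def)
  then show ?thesis using m by (simp add: mult_ac)
qed

lemma leb_UN_branches_le:
  assumes \<I>: "\<I> \<subseteq> branches n" and L: "L \<ge> 0"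
    and A: "\<And>I. I \<in> \<I> \<Longrightarrow> A I \<in> sets borel" "\<And>I. I \<in> \<I> \<Longrightarrow> A I \<subseteq> X"
    and B: "\<And>I. I \<in> \<I> \<Longrightarrow> B I \<in> sets borel" "\<And>I. I \<in> \<I> \<Longrightarrow> B I \<subseteq> I"
    and le: "\<And>I. I \<in> \<I> \<Longrightarrow> leb (A I) \<le> L * leb (B I)"
  shows "leb (\<Union>I\<in>\<I>. A I) \<le> L * leb (\<Union>I\<in>\<I>. B I)"
proof -
  have BX: "B I \<subseteq> X" if "I \<in> \<I>" for I using B(2)[OF that] branch_subset \<I> that by blast
  have "emeasure lborel (\<Union>I\<in>\<I>. A I) \<le> ennreal L * emeasure lborel (\<Union>I\<in>\<I>. B I)"
  proof (rule emeasure_UN_le_cmult)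
    show "countable \<I>" using \<I> countable_branches countable_subset by blast
    show "disjoint_family_on B \<I>"
      using disjoint_branches[of n] \<I> B(2) unfolding disjoint_family_on_def by blast
    show "emeasure lborel (A I) \<le> ennreal L * emeasure lborel (B I)" if "I \<in> \<I>" for I
      using le[OF that] A(2)[OF that] BX[OF that] L by (simp add: leb_le_iff)
  qed (use A B in auto)
  moreover have "(\<Union>I\<in>\<I>. A I) \<subseteq> X" "(\<Union>I\<in>\<I>. B I) \<subseteq> X" using A(2) BX by blast+
  ultimately show ?thesis using L by (simp add: leb_le_iff)
qed

lemma pre_upper:
  assumes n: "n \<ge> 1" and G: "G \<in> sets \<mu>" and \<I>: "\<I> \<subseteq> branches n"
  shows "leb (\<Union>I\<in>\<I>. I \<inter> pre n G) \<le> C\<^sup>2 / \<delta> * leb G * leb (\<Union>\<I>)"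
proof -
  have "leb (\<Union>I\<in>\<I>. I \<inter> pre n G) \<le> C\<^sup>2 / \<delta> * leb G * leb (\<Union>I\<in>\<I>. I)"
  proof (rule leb_UN_branches_le[OF \<I>])
    fix I assume "I \<in> \<I>"
    then have I: "I \<in> branches n" using \<I> by auto
    show "leb (I \<inter> pre n G) \<le> C\<^sup>2 / \<delta> * leb G * leb I" using branch_pre_upper[OF n I G] by (simp add: mult_ac)
    show "I \<inter> pre n G \<in> sets borel" "I \<inter> pre n G \<subseteq> X" "I \<in> sets borel" "I \<subseteq> I"
      using pre_borel[OF G] branch_borel[OF I] branch_subset[OF I] by auto
  qed (use \<delta> in auto)
  then show ?thesis by simp
qed

section \<open>Bounds for the invariant density\<close>

lemma restrict_lborel:
  "sets (restrict_space lborel X) = sets \<mu>" "A \<subseteq> X \<Longrightarrow> emeasure (restrict_space lborel X) A = emeasure lborel A"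
  unfolding sets_\<mu> by (rule sets_restrict_space_cong) (auto intro: emeasure_restrict_space)

text \<open>The sets where the density lies between \<open>1 / (k + 1)\<close> and
  \<open>k + 1\<close> exhaust almost every point, so one of them has positive measure. Both density
  bounds are spread out from such a set.\<close>

lemma obtain_comparable_set:
  obtains E v M where "E \<in> sets \<mu>" "prob E > 0" "v > 0" "M > 0"
    "\<And>A. A \<in> sets \<mu> \<Longrightarrow> A \<subseteq> E \<Longrightarrow> v * leb A \<le> prob A \<and> prob A \<le> M * leb A"
proof -
  define R where "R = restrict_space lborel X"
  have R_sets: "sets R = sets \<mu>" unfolding R_def by (rule restrict_lborel)
  have R_space: "space R = X" by (simp add: R_def space_restrict_space)
  have R_em: "emeasure R A = ennreal (leb A)" if "A \<subseteq> X" for A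
    unfolding R_def using restrict_lborel(2)[OF that] emeasure_leb[OF that] by simp
  interpret R: finite_measure R by (rule finite_measureI) (simp add: R_space R_em)
  obtain \<rho> where \<rho>: "\<rho> \<in> borel_measurable R" "density R \<rho> = \<mu>"
    using R.Radon_Nikodym[of \<mu>] ac R_sets unfolding R_def by auto
  have em: "emeasure \<mu> A = (\<integral>\<^sup>+x. \<rho> x * indicator A x \<partial>R)" if "A \<in> sets \<mu>" for A
    using emeasure_density[OF \<rho>(1), of A] that \<rho>(2) R_sets by simp
  define E where "E k = {x \<in> space R. ennreal (1 / (real k + 1)) \<le> \<rho> x \<and> \<rho> x \<le> ennreal (real k + 1)}" for k :: nat
  have E_sets: "E k \<in> sets \<mu>" for k unfolding R_sets[symmetric] E_def using \<rho>(1) by measurable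
  have "(\<integral>\<^sup>+x. \<rho> x \<partial>R) \<noteq> \<infinity>"
  proof -
    have "(\<integral>\<^sup>+x. \<rho> x \<partial>R) = emeasure \<mu> X"
      using em[of X] space_\<mu> sets.top[of \<mu>]
      by (auto simp: R_space intro!: nn_integral_cong)
    then show ?thesis by simp
  qed
  then have "AE x in R. \<rho> x \<noteq> \<infinity>" using \<rho>(1) by (intro nn_integral_noteq_infinite) auto
  then have "AE x in density R \<rho>. \<exists>k. x \<in> E k"
    unfolding AE_density[OF \<rho>(1)] using AE_space
  proof eventually_elim
    case (elim x)
    show ?case
    proof
      assume pos: "0 < \<rho> x"
      obtain t where t: "\<rho> x = ennreal t" "t > 0" using elim pos by (cases "\<rho> x") auto
      obtain k :: nat where k: "max t (1 / t) < real k" using reals_Archimedean2 by blast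
      have "1 / (real k + 1) \<le> t" using k t by (simp add: field_simps) 
      then have "ennreal (1 / (real k + 1)) \<le> \<rho> x" unfolding t(1) by (rule ennreal_leI)
      moreover have "\<rho> x \<le> ennreal (real k + 1)" unfolding t(1) using k by (intro ennreal_leI) auto
      ultimately show "\<exists>k. x \<in> E k" using elim unfolding E_def by blast
    qed
  qed
  then have AE_E: "AE x in \<mu>. \<exists>k. x \<in> E k" unfolding \<rho>(2) .
  have "\<exists>k. prob (E k) > 0"
  proof (rule ccontr)
    assume "\<not> ?thesis"
    then have "prob (E k) = 0" for k by (simp add: less_le)
    then have "AE x in \<mu>. x \<notin> E k" for k using E_sets by (simp add: prob_eq_0)
    then have "AE x in \<mu>. \<forall>k. x \<notin> E k" by (simp add: AE_all_countable)
    then have "AE x in \<mu>. False" using AE_E by eventually_elim auto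
    then show False by simp
  qed
  then obtain k where k: "prob (E k) > 0" by auto
  show ?thesis
  proof (rule that[OF E_sets k, of "1 / (real k + 1)" "real k + 1"])
    fix A assume A: "A \<in> sets \<mu>" "A \<subseteq> E k"
    then have AX: "A \<subseteq> X" by (simp add: sets_\<mu>_iff)
    have const: "(\<integral>\<^sup>+x. ennreal c * indicator A x \<partial>R) = ennreal (c * leb A)" if "c \<ge> 0" for c
      using A R_sets that by (subst nn_integral_cmult_indicator) (auto simp: R_em AX ennreal_mult)
    have "ennreal (1 / (real k + 1) * leb A) \<le> ennreal (prob A)"
    proof -
      have "(\<integral>\<^sup>+x. ennreal (1 / (real k + 1)) * indicator A x \<partial>R) \<le> emeasure \<mu> A"
        unfolding em[OF A(1)] using A(2) by (intro nn_integral_mono) (auto simp: E_def split: split_indicator)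
      then show ?thesis by (subst (asm) const) (auto simp: emeasure_eq_measure)
    qed
    moreover have "ennreal (prob A) \<le> ennreal ((real k + 1) * leb A)"
    proof -
      have "emeasure \<mu> A \<le> (\<integral>\<^sup>+x. ennreal (real k + 1) * indicator A x \<partial>R)"
        unfolding em[OF A(1)] using A(2) by (intro nn_integral_mono) (auto simp: E_def split: split_indicator)
      then show ?thesis by (subst (asm) const) (auto simp: emeasure_eq_measure)
    qed
    ultimately show "1 / (real k + 1) * leb A \<le> prob A \<and> prob A \<le> (real k + 1) * leb A"
      by (simp add: ennreal_le_iff)
  qed auto
qed

text \<open>By mixing, \<open>prob E * prob F\<close> is the limit of
  \<open>prob (E \<inter> pre n F)\<close>. On \<open>E\<close> the measure is at most
  \<open>M * leb\<close>, and \<open>leb (pre n F)\<close> is at most a multiple of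
  \<open>leb F\<close> that does not depend on \<open>n\<close>. The summand 1 in \<open>H\<close>
  ensures positivity.\<close>

lemma density_bounded_above:
  obtains H where "H > 0" "\<And>F. F \<in> sets \<mu> \<Longrightarrow> prob F \<le> H * leb F"
proof -
  obtain E v M where E: "E \<in> sets \<mu>" "prob E > 0" "M > 0" and
    M: "\<And>A. A \<in> sets \<mu> \<Longrightarrow> A \<subseteq> E \<Longrightarrow> v * leb A \<le> prob A \<and> prob A \<le> M * leb A"
    using obtain_comparable_set by metis
  define H where "H = M * (C\<^sup>2 / \<delta> * len_X) / prob E + 1"
  have H0: "0 \<le> M * (C\<^sup>2 / \<delta> * len_X) / prob E" using E \<delta> by (simp add: len_X_def)
  show ?thesis
  proof (rule that[of H])
    show "H > 0" using H0 by (simp add: H_def)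
    fix F assume F: "F \<in> sets \<mu>"
    have "prob (E \<inter> pre n F) \<le> M * (C\<^sup>2 / \<delta> * len_X * leb F)" if n: "n \<ge> 1" for n
    proof -
      have "prob (E \<inter> pre n F) \<le> M * leb (E \<inter> pre n F)" using M[of "E \<inter> pre n F"] E F by auto
      also have "leb (E \<inter> pre n F) \<le> leb (\<Union>I\<in>branches n. I \<inter> pre n F)"
      proof (rule leb_mono)
        have "(\<Union>I\<in>branches n. I \<inter> pre n F) = pre n F" using Union_branches[of n] by (auto simp: space_\<mu>)
        moreover have "pre n F \<in> sets \<mu>" "E \<inter> pre n F \<in> sets \<mu>" using E F by auto
        ultimately show "(\<Union>I\<in>branches n. I \<inter> pre n F) \<in> sets borel" "E \<inter> pre n F \<in> sets borel"
          "E \<inter> pre n F \<subseteq> (\<Union>I\<in>branches n. I \<inter> pre n F)" "(\<Union>I\<in>branches n. I \<inter> pre n F) \<subseteq> X"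
          by (auto simp: sets_\<mu>_iff)
      qed
      also have "\<dots> \<le> C\<^sup>2 / \<delta> * leb F * leb (\<Union>(branches n))" by (rule pre_upper[OF n F]) simp
      finally show ?thesis using E(3) by (simp add: Union_branches len_X_def mult_ac)
    qed
    then have "prob E * prob F \<le> M * (C\<^sup>2 / \<delta> * len_X * leb F)"
      by (intro LIMSEQ_le_const2[OF mixing[OF E(1) F]]) auto
    then have "prob F \<le> M * (C\<^sup>2 / \<delta> * len_X * leb F) / prob E"
      using E(2) by (simp only: pos_le_divide_eq mult.commute)
    then have "prob F \<le> M * (C\<^sup>2 / \<delta> * len_X) / prob E * leb F" by simp
    also have "\<dots> \<le> H * leb F" unfolding H_def by (intro mult_right_mono) auto
    finally show "prob F \<le> H * leb F" .
  qed
qed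

text \<open>Invariance gives \<open>\<mu>(F) \<ge> \<mu>(W \<inter> f\<^sup>-\<^sup>n F)\<close>.  The \<open>n\<close>-branches meeting the compact set \<open>W\<close> nearly
  fill it, and by bounded distortion each of them contributes to every \<open>F\<close> in its long image.\<close>
lemma density_bounded_below_interval:
  obtains a b c where "a < b" "{a<..<b} \<subseteq> X" "c > 0"
    "\<And>F. F \<in> sets \<mu> \<Longrightarrow> F \<subseteq> {a<..<b} \<Longrightarrow> c * leb F \<le> prob F"
proof -
  obtain E v M where E: "E \<in> sets \<mu>" "prob E > 0" and v: "v > 0" and
    M: "\<And>A. A \<in> sets \<mu> \<Longrightarrow> A \<subseteq> E \<Longrightarrow> v * leb A \<le> prob A \<and> prob A \<le> M * leb A"
    using obtain_comparable_set by metis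
  have EX: "E \<in> sets borel" "E \<subseteq> X" using E by (auto simp: sets_\<mu>_iff)
  have "leb E \<noteq> 0" using M[of E] E by auto
  then have lebE: "leb E > 0" by (simp add: less_le)
  have E_leb: "E \<in> sets lebesgue" using EX by simp
  obtain W where W: "closed W" "W \<subseteq> E" "emeasure lebesgue (E - W) < ennreal (leb E)"
    using sets_lebesgue_inner_closed[OF E_leb lebE] by metis
  have Wb: "W \<in> sets borel" "W \<subseteq> X" using W EX by auto
  have W_sets: "W \<in> sets \<mu>" using Wb by (simp add: sets_\<mu>_iff)
  have "bounded W" using Wb(2) X_bounded bounded_subset by blast
  then have W_compact: "compact W" using W(1) by (simp add: compact_eq_bounded_closed)
  have lebW: "leb W > 0"
  proof -
    have "ennreal (leb (E - W)) < ennreal (leb E)"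
      using W(3) EX Wb by (subst emeasure_leb[symmetric]) auto
    then have "leb (E - W) < leb E" by (simp add: ennreal_less_iff)
    moreover have "leb (E - W) = leb E - leb W"
      using EX Wb W(2) emeasure_lborel_finite[of E] by (intro measure_Diff) auto
    ultimately show ?thesis by simp
  qed
  obtain \<alpha> \<beta> where \<alpha>\<beta>: "X \<subseteq> {\<alpha>..\<beta>}" "\<alpha> \<le> \<beta>"
  proof -
    obtain R where R: "\<And>x. x \<in> X \<Longrightarrow> \<bar>x\<bar> \<le> R" using X_bounded by (auto simp: bounded_real)
    have "X \<subseteq> {- \<bar>R\<bar>..\<bar>R\<bar>}" using R by (force simp: abs_le_iff)
    then show ?thesis using that[of "- \<bar>R\<bar>" "\<bar>R\<bar>"] by auto
  qed
  \<comment> \<open>A third of the guaranteed image length, so that each image of a branch contains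
    a whole cell of the grid.\<close>
  define h where "h = \<delta> / 3"
  have h: "h > 0" using \<delta> by (simp add: h_def)
  obtain p :: nat where "(\<beta> - \<alpha>) / h \<le> real p" using real_arch_simple by blast
  then have p: "\<beta> - \<alpha> \<le> real p * h" using h by (simp add: pos_divide_le_eq)
  define cell where "cell i = {\<alpha> + real i * h<..<\<alpha> + real (Suc i) * h}" for i
  have len_X0: "len_X > 0" using leb_mono[of W X] Wb lebW by (simp add: len_X_def)
  have p0: "p > 0"
  proof (rule ccontr)
    assume "\<not> p > 0"
    then have "X \<subseteq> {\<alpha>..\<alpha>}" using \<alpha>\<beta> p by auto
    then have "leb X \<le> leb {\<alpha>..\<alpha>}" by (intro measure_mono_fmeasurable) (auto simp: X_borel fmeasurable_def)
    then show False using len_X0 by (simp add: len_X_def)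
  qed
  \<comment> \<open>One of the \<open>p\<close> cells is covered by the images of branches of total
    length at least \<open>leb W / p\<close>; the other factor is that of
    \<open>branch_pre_lower\<close>.\<close>
  define c1 where "c1 = leb W / (real p * (C\<^sup>2 * len_X))"
  have c1: "c1 > 0" using lebW p0 C len_X0 by (simp add: c1_def)
  have step: "\<exists>i<p. cell i \<subseteq> X \<and> (\<forall>F\<in>sets \<mu>. F \<subseteq> cell i \<longrightarrow> v * (c1 * leb F - \<epsilon>) \<le> prob F)"
    if \<epsilon>: "\<epsilon> > 0" for \<epsilon>
  proof -
    \<comment> \<open>\<open>U\<close> exceeds \<open>W\<close> by at most
      \<open>\<epsilon>\<close>. Branches shorter than \<open>d\<close> that meet \<open>W\<close>
      stay inside \<open>U\<close>, and expansion makes all \<open>n\<close>-branches that short;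
      passing from \<open>V i\<close> to its part in \<open>W\<close> thus loses at most
      \<open>\<epsilon>\<close>.\<close>
    obtain U where U: "open U" "W \<subseteq> U" "emeasure lborel (U - W) \<le> ennreal \<epsilon>"
      using outer_regular_lborel_le[OF Wb(1) \<epsilon>] by auto
    obtain d where d: "d > 0" "(\<Union>x\<in>W. ball x d) \<subseteq> U"
      using compact_subset_open_imp_ball_epsilon_subset[OF W_compact U(1,2)] by auto
    obtain n0 where n0: "(\<beta> - \<alpha>) / d < \<Lambda> ^ n0" using real_arch_pow[OF \<Lambda>] by blast
    define n where "n = Suc n0"
    have "\<Lambda> ^ n0 \<le> \<Lambda> ^ n" using \<Lambda> by (intro power_increasing) (auto simp: n_def)
    then have n: "n \<ge> 1" "(\<beta> - \<alpha>) / d < \<Lambda> ^ n" using n0 by (auto simp: n_def)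
    define V where "V i = \<Union>{I \<in> branches n. I \<inter> W \<noteq> {} \<and> cell i \<subseteq> (f ^^ n) ` I}" for i
    have sub: "{I \<in> branches n. I \<inter> W \<noteq> {} \<and> cell i \<subseteq> (f ^^ n) ` I} \<subseteq> branches n" for i by auto
    have V_borel: "V i \<in> sets borel" for i
      unfolding V_def using countable_subset[OF sub countable_branches] branch_borel by (intro sets.countable_Union) auto
    have VX: "V i \<subseteq> X" for i using branch_subset by (auto simp: V_def)
    have "I \<subseteq> U" if I: "I \<in> branches n" "I \<inter> W \<noteq> {}" for I
    proof
      fix x assume x: "x \<in> I"
      obtain w where w: "w \<in> I" "w \<in> W" using I by auto
      have "(f ^^ n) w \<in> {\<alpha>..\<beta>}" "(f ^^ n) x \<in> {\<alpha>..\<beta>}"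
        using funpow_X branch_subset[OF I(1)] w(1) x \<alpha>\<beta>(1) by blast+
      then have range: "\<bar>(f ^^ n) w - (f ^^ n) x\<bar> \<le> \<beta> - \<alpha>" by (auto simp: abs_le_iff)
      have "\<Lambda> ^ n * \<bar>w - x\<bar> \<le> \<bar>(f ^^ n) w - (f ^^ n) x\<bar>" by (rule expanding_branch[OF I(1) w(1) x])
      also have "\<dots> \<le> \<beta> - \<alpha>"
        by (rule range)
      also have "\<dots> < \<Lambda> ^ n * d" using n d by (simp add: pos_divide_less_eq)
      finally have "\<bar>w - x\<bar> < d" using \<Lambda> by simp
      then have "x \<in> ball w d" by (simp add: dist_real_def)
      then show "x \<in> U" using d(2) w(2) by blast
    qed
    then have VU: "V i \<subseteq> U" for i by (auto simp: V_def)
    have "W \<subseteq> (\<Union>i<p. V i)"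
    proof
      fix w assume w: "w \<in> W"
      then obtain I where I: "I \<in> branches n" "w \<in> I" using Union_branches[of n] Wb by blast
      have "3 * h \<le> leb ((f ^^ n) ` I)" using large_image[OF n(1) I(1)] by (simp add: h_def)
      then obtain i where "i < p" "cell i \<subseteq> (f ^^ n) ` I"
        using grid_cell_in_interval[of "(f ^^ n) ` I" \<alpha> \<beta> h p] branch_image[OF n(1) I(1)] \<alpha>\<beta> h p
        unfolding cell_def by blast
      then show "w \<in> (\<Union>i<p. V i)" using I w by (auto simp: V_def)
    qed
    moreover have "(\<Union>i<p. V i) \<subseteq> X" using VX by blast
    ultimately have "leb W \<le> leb (\<Union>i<p. V i)" using Wb V_borel by (intro leb_mono) auto
    also have "\<dots> \<le> (\<Sum>i<p. leb (V i))" using V_borel by (intro measure_UNION_le) auto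
    finally have sum: "leb W \<le> (\<Sum>i<p. leb (V i))" .
    have "\<exists>i<p. leb W / real p \<le> leb (V i)"
    proof (rule ccontr)
      assume "\<not> ?thesis"
      then have "(\<Sum>i<p. leb (V i)) < (\<Sum>i<p. leb W / real p)"
        using p0 by (intro sum_strict_mono) (auto simp: not_le)
      then show False using sum p0 by simp
    qed
    then obtain i where i: "i < p" "leb W / real p \<le> leb (V i)" by auto
    have Vi0: "leb (V i) > 0" using i(2) lebW p0 by (smt (verit) divide_pos_pos of_nat_0_less_iff)
    then have "V i \<noteq> {}" by auto
    then obtain I0 where "I0 \<in> branches n" "cell i \<subseteq> (f ^^ n) ` I0" by (auto simp: V_def)
    then have cellX: "cell i \<subseteq> X" using branch_image(3)[OF n(1)] by blast
    have "v * (c1 * leb F - \<epsilon>) \<le> prob F" if F: "F \<in> sets \<mu>" "F \<subseteq> cell i" for F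
    proof -
      have VF_sets: "V i \<inter> pre n F \<in> sets borel" using pre_borel[OF F(1) V_borel VX] .
      have "leb (V i) * leb F \<le> C\<^sup>2 * len_X * leb (V i \<inter> pre n F)"
      proof (cases "leb F = 0")
        case True
        then show ?thesis using len_X0 by simp
      next
        case False
        then have F0: "leb F > 0" by (simp add: less_le)
        let ?\<I> = "{I \<in> branches n. I \<inter> W \<noteq> {} \<and> cell i \<subseteq> (f ^^ n) ` I}"
        have "leb (\<Union>I\<in>?\<I>. I) \<le> C\<^sup>2 * len_X / leb F * leb (\<Union>I\<in>?\<I>. I \<inter> pre n F)"
        proof (rule leb_UN_branches_le[OF sub])
          fix I assume I: "I \<in> ?\<I>"
          then have I': "I \<in> branches n" by auto
          have "leb I * leb F \<le> C\<^sup>2 * len_X * leb (I \<inter> pre n F)"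
            using I F by (intro branch_pre_lower[OF n(1) I']) auto
          then show "leb I \<le> C\<^sup>2 * len_X / leb F * leb (I \<inter> pre n F)" using F0 by (simp add: field_simps)
          show "I \<in> sets borel" "I \<subseteq> X" "I \<inter> pre n F \<in> sets borel" "I \<inter> pre n F \<subseteq> I"
            using branch_borel[OF I'] branch_subset[OF I'] pre_borel[OF F(1)] by auto
        qed (use F0 len_X0 in auto)
        moreover have "(\<Union>I\<in>?\<I>. I) = V i" "(\<Union>I\<in>?\<I>. I \<inter> pre n F) = V i \<inter> pre n F" by (auto simp: V_def)
        ultimately show ?thesis using F0 by (simp add: field_simps)
      qed
      then have "leb (V i) * leb F / (C\<^sup>2 * len_X) \<le> leb (V i \<inter> pre n F)"
        using C len_X0 by (simp add: pos_divide_le_eq mult.commute)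
      moreover have "c1 * leb F \<le> leb (V i) * leb F / (C\<^sup>2 * len_X)"
      proof -
        have "leb W / real p * leb F / (C\<^sup>2 * len_X) \<le> leb (V i) * leb F / (C\<^sup>2 * len_X)"
          using i(2) C len_X0 by (intro divide_right_mono mult_right_mono) auto
        then show ?thesis by (simp add: c1_def)
      qed
      ultimately have 1: "c1 * leb F \<le> leb (V i \<inter> pre n F)" by linarith
      have "leb (V i \<inter> pre n F) \<le> leb ((W \<inter> pre n F) \<union> (V i - W))"
        using VF_sets V_borel VX Wb pre_borel[OF F(1) Wb] by (intro leb_mono) auto
      also have "\<dots> \<le> leb (W \<inter> pre n F) + leb (V i - W)"
        using V_borel Wb pre_borel[OF F(1) Wb] by (intro measure_Un_le) auto
      also have "leb (V i - W) \<le> \<epsilon>"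
      proof -
        have "ennreal (leb (V i - W)) = emeasure lborel (V i - W)" using VX by (intro emeasure_leb[symmetric]) auto
        also have "\<dots> \<le> emeasure lborel (U - W)" using VU U(1) Wb by (intro emeasure_mono) auto
        also have "\<dots> \<le> ennreal \<epsilon>" by (rule U(3))
        finally show ?thesis using \<epsilon> by (simp add: ennreal_le_iff)
      qed
      finally have "c1 * leb F - \<epsilon> \<le> leb (W \<inter> pre n F)" using 1 by linarith
      then have "v * (c1 * leb F - \<epsilon>) \<le> v * leb (W \<inter> pre n F)" using v by (intro mult_left_mono) auto
      also have "\<dots> \<le> prob (W \<inter> pre n F)" using M[of "W \<inter> pre n F"] W(2) W_sets F(1) by auto
      also have "\<dots> \<le> prob (pre n F)" using F(1) by (intro finite_measure_mono) auto
      also have "\<dots> = prob F" using F(1) by (rule prob_pre)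
      finally show ?thesis .
    qed
    then show ?thesis using i cellX by blast
  qed
  \<comment> \<open>The cell found by \<open>step\<close> depends on \<open>\<epsilon>\<close>. As
    there are only \<open>p\<close> cells, one of them serves infinitely many of the errors
    \<open>1 / (k + 1)\<close>, which therefore disappear.\<close>
  have cells: "\<forall>k\<in>UNIV. \<exists>i\<in>{..<p}. cell i \<subseteq> X \<and> (\<forall>F\<in>sets \<mu>. F \<subseteq> cell i \<longrightarrow> v * (c1 * leb F - 1 / (real k + 1)) \<le> prob F)"
  proof
    fix k :: nat
    have "1 / (real k + 1) > 0" by simp
    from step[OF this] show "\<exists>i\<in>{..<p}. cell i \<subseteq> X \<and> (\<forall>F\<in>sets \<mu>. F \<subseteq> cell i \<longrightarrow> v * (c1 * leb F - 1 / (real k + 1)) \<le> prob F)"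
      by blast
  qed
  obtain i where i: "infinite {k. cell i \<subseteq> X \<and> (\<forall>F\<in>sets \<mu>. F \<subseteq> cell i \<longrightarrow> v * (c1 * leb F - 1 / (real k + 1)) \<le> prob F)}"
    using pigeonhole_infinite_rel[OF infinite_UNIV_nat finite_lessThan cells] by auto
  have "cell i \<subseteq> X"
  proof (rule ccontr)
    assume "\<not> cell i \<subseteq> X"
    then show False using i by simp
  qed
  then have cellX: "cell i \<subseteq> X" by auto
  show ?thesis
  proof (rule that[of "\<alpha> + real i * h" "\<alpha> + real (Suc i) * h" "v * c1"])
    show "\<alpha> + real i * h < \<alpha> + real (Suc i) * h" using h by simp
    show "{\<alpha> + real i * h<..<\<alpha> + real (Suc i) * h} \<subseteq> X" using cellX by (simp add: cell_def)
    show "v * c1 > 0" using v c1 by simp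
    fix F assume F: "F \<in> sets \<mu>" "F \<subseteq> {\<alpha> + real i * h<..<\<alpha> + real (Suc i) * h}"
    show "v * c1 * leb F \<le> prob F"
    proof (rule field_le_epsilon)
      fix e :: real assume e: "e > 0"
      obtain k0 :: nat where k0: "v / e < real k0" using reals_Archimedean2 by blast
      obtain k where k: "k \<ge> k0" "v * (c1 * leb F - 1 / (real k + 1)) \<le> prob F"
        using i F unfolding infinite_nat_iff_unbounded_le cell_def by blast
      have "v / (real k + 1) \<le> e"
      proof -
        have "v / e \<le> real k + 1" using k0 k(1) by linarith
        then show ?thesis using e by (simp add: field_simps)
      qed
      then show "v * c1 * leb F \<le> prob F + e" using k(2) by (simp add: algebra_simps)
    qed
  qed
qed

section \<open>Lower density bound near almost every point\<close>

definition bounded_below_near :: "real \<Rightarrow> bool" where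
  "bounded_below_near x \<longleftrightarrow>
     (\<exists>\<epsilon>>0. \<exists>\<eta>>0. \<forall>F\<in>sets \<mu>. F \<subseteq> ball x \<epsilon> \<longrightarrow> \<eta> * leb F \<le> prob F)"

lemma AE_in_branch_interior: "AE x in \<mu>. \<exists>I\<in>P. x \<in> interior I"
proof -
  have "countable (\<Union>I\<in>P. {Inf I, Sup I})" using P_countable by auto
  then have "AE x in lborel. x \<notin> (\<Union>I\<in>P. {Inf I, Sup I})"
    by (intro AE_not_in countable_imp_null_set_lborel)
  then have "AE x in \<mu>. x \<notin> (\<Union>I\<in>P. {Inf I, Sup I})" by (rule AE_transfer)
  then show ?thesis using AE_space
  proof eventually_elim
    case (elim x)
    then obtain I where I: "I \<in> P" "x \<in> I" using partition_onD1[OF P_partition] by (auto simp: space_\<mu>)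
    have "I \<subseteq> X" using I partition_onD1[OF P_partition] by auto
    then have "x \<in> interior I"
      using elim I P_interval X_bounded bounded_subset by (intro interval_minus_endpoints) auto
    then show ?case using I by auto
  qed
qed

lemma P_branch: "I \<in> P \<Longrightarrow> I \<in> branches 1"
proof -
  assume I: "I \<in> P"
  then have "I \<subseteq> X" "I \<noteq> {}" using partition_onD1[OF P_partition] partition_onD3[OF P_partition] by auto
  then have "{x \<in> X. \<forall>i<1. (f ^^ i) x \<in> (\<lambda>_. I) i} = I" by auto
  then show "I \<in> branches 1" using I \<open>I \<noteq> {}\<close> unfolding iterated_partition_def
    by (intro DiffI CollectI exI[of _ "\<lambda>_. I"]) auto
qed

text \<open>Such points form an open set of positive measure. It is almost surely mapped into
  itself: at an interior point of a branch \<open>f\<close> is locally open and Lipschitz, and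
  invariance hands the lower bound to the image, divided by the Lipschitz constant. The zero-one law
  gives full measure.\<close>

lemma AE_bounded_below_near: "AE x in \<mu>. bounded_below_near x"
proof -
  define O' where "O' = {x. bounded_below_near x}"
  have "open O'"
  proof (rule openI)
    fix x assume "x \<in> O'"
    then obtain \<epsilon> \<eta> where e: "\<epsilon> > 0" "\<eta> > 0" "\<And>F. F \<in> sets \<mu> \<Longrightarrow> F \<subseteq> ball x \<epsilon> \<Longrightarrow> \<eta> * leb F \<le> prob F"
      by (auto simp: O'_def bounded_below_near_def)
    have "bounded_below_near y" if "y \<in> ball x (\<epsilon> / 2)" for y
    proof -
      have "ball y (\<epsilon> / 2) \<subseteq> ball x \<epsilon>"
      proof
        fix z assume "z \<in> ball y (\<epsilon> / 2)"
        then show "z \<in> ball x \<epsilon>" using that unfolding mem_ball dist_real_def by linarith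
      qed
      then have "\<forall>F\<in>sets \<mu>. F \<subseteq> ball y (\<epsilon> / 2) \<longrightarrow> \<eta> * leb F \<le> prob F" using e(3) by blast
      moreover have "\<epsilon> / 2 > 0" using e(1) by simp
      ultimately show ?thesis unfolding bounded_below_near_def using e(2) by blast
    qed
    then show "\<exists>e>0. ball x e \<subseteq> O'" using e(1) by (intro exI[of _ "\<epsilon> / 2"]) (auto simp: O'_def)
  qed
  then have O'_sets: "O' \<inter> X \<in> sets \<mu>" by (simp add: sets_\<mu>_iff X_borel borel_open sets.Int)
  have "prob (O' \<inter> X) = 0 \<or> prob (O' \<inter> X) = 1"
  proof (rule zero_one_law[OF ergodic O'_sets])
    show "AE x in \<mu>. x \<in> O' \<inter> X \<longrightarrow> f x \<in> O' \<inter> X"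
      using AE_in_branch_interior
    proof eventually_elim
      case (elim x)
      then obtain I where I: "I \<in> P" "x \<in> interior I" by auto
      have Ib: "I \<in> branches 1" using P_branch[OF I(1)] .
      obtain m where m: "m > 0" "\<And>x y. x \<in> I \<Longrightarrow> y \<in> I \<Longrightarrow> m * \<bar>x - y\<bar> \<le> \<bar>(f ^^ 1) x - (f ^^ 1) y\<bar>"
        "\<And>x y. x \<in> I \<Longrightarrow> y \<in> I \<Longrightarrow> \<bar>(f ^^ 1) x - (f ^^ 1) y\<bar> \<le> C\<^sup>2 * m * \<bar>x - y\<bar>"
        "continuous_on I (f ^^ 1)"
        using branch_slope[OF order.refl Ib] by metis
      have inj: "inj_on f I"
      proof (rule inj_onI)
        fix a b assume "a \<in> I" "b \<in> I" "f a = f b"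
        then show "a = b" using m(2)[of a b] m(1) by (simp add: mult_le_0_iff)
      qed
      show ?case
      proof
        assume x: "x \<in> O' \<inter> X"
        then obtain \<epsilon> \<eta> where e: "\<epsilon> > 0" "\<eta> > 0" "\<And>F. F \<in> sets \<mu> \<Longrightarrow> F \<subseteq> ball x \<epsilon> \<Longrightarrow> \<eta> * leb F \<le> prob F"
          by (auto simp: O'_def bounded_below_near_def)
        define S where "S = interior I \<inter> ball x \<epsilon>"
        have S: "open S" "x \<in> S" "S \<subseteq> I" "S \<subseteq> ball x \<epsilon>"
          using I e(1) interior_subset[of I] by (auto simp: S_def)
        have SX: "S \<subseteq> X" using S(3) branch_subset[OF Ib] by blast
        have "continuous_on I f" using m(4) by simp
        then have "open (f ` S)"
          using injective_eq_1d_open_map_UNIV[of I f] P_interval[OF I(1)] inj S by blast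
        then obtain \<epsilon>' where e': "\<epsilon>' > 0" "ball (f x) \<epsilon>' \<subseteq> f ` S"
          using S(2) by (auto simp: open_contains_ball)
        define L where "L = C\<^sup>2 * m"
        have L: "L > 0" using C m by (simp add: L_def)
        have "\<eta> / L * leb F \<le> prob F" if F: "F \<in> sets \<mu>" "F \<subseteq> ball (f x) \<epsilon>'" for F
        proof -
          have Fb: "F \<in> sets borel" "F \<subseteq> X" using F(1) by (auto simp: sets_\<mu>_iff)
          have A: "S \<inter> pre 1 F \<in> sets borel" using pre_borel[OF F(1) borel_open[OF S(1)] SX] .
          then have A_sets: "S \<inter> pre 1 F \<in> sets \<mu>" using SX by (auto simp: sets_\<mu>_iff)
          have "F \<subseteq> f ` (S \<inter> pre 1 F)" using F(2) e'(2) SX unfolding space_\<mu> by fastforce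
          then have "leb F \<le> L * leb (S \<inter> pre 1 F)"
            using m(3) S(3) SX L A Fb by (intro lipschitz_image_leb[of "S \<inter> pre 1 F" F f L]) (auto simp: L_def)
          then have "\<eta> / L * leb F \<le> \<eta> / L * (L * leb (S \<inter> pre 1 F))" using e L by (intro mult_left_mono) auto
          also have "\<dots> = \<eta> * leb (S \<inter> pre 1 F)" using L by simp
          also have "\<dots> \<le> prob (S \<inter> pre 1 F)" using A_sets S(4) by (intro e(3)) auto
          also have "\<dots> \<le> prob (pre 1 F)" using F(1) by (intro finite_measure_mono pre_sets) auto
          also have "\<dots> = prob F" using F(1) by (rule prob_pre)
          finally show ?thesis .
        qed
        then have "f x \<in> O'" using e(2) e'(1) L unfolding O'_def bounded_below_near_def
          by (intro CollectI exI[of _ \<epsilon>'] conjI exI[of _ "\<eta> / L"]) auto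
        moreover have "f x \<in> X" using x funpow_X[of x 1] by simp
        ultimately show "f x \<in> O' \<inter> X" by simp
      qed
    qed
  qed
  moreover have "prob (O' \<inter> X) > 0"
  proof -
    obtain a b c where abc: "a < b" "{a<..<b} \<subseteq> X" "c > 0"
      "\<And>F. F \<in> sets \<mu> \<Longrightarrow> F \<subseteq> {a<..<b} \<Longrightarrow> c * leb F \<le> prob F"
      using density_bounded_below_interval by metis
    have ab_sets: "{a<..<b} \<in> sets \<mu>" using abc(2) by (simp add: sets_\<mu>_iff)
    have "{a<..<b} \<subseteq> O' \<inter> X"
    proof
      fix x assume x: "x \<in> {a<..<b}"
      define \<epsilon> where "\<epsilon> = min (x - a) (b - x)"
      have "\<epsilon> > 0" "ball x \<epsilon> \<subseteq> {a<..<b}" using x by (auto simp: \<epsilon>_def dist_real_def)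
      then have "\<forall>F\<in>sets \<mu>. F \<subseteq> ball x \<epsilon> \<longrightarrow> c * leb F \<le> prob F" using abc(4) by (meson order.trans)
      then have "bounded_below_near x" using abc(3) \<open>\<epsilon> > 0\<close> unfolding bounded_below_near_def by meson
      then show "x \<in> O' \<inter> X" using x abc(2) by (auto simp: O'_def)
    qed
    then have "prob {a<..<b} \<le> prob (O' \<inter> X)" using O'_sets by (intro finite_measure_mono)
    moreover have "0 < c * leb {a<..<b}" using abc by simp
    ultimately show ?thesis using abc(4)[OF ab_sets order.refl] by linarith
  qed
  ultimately have "prob (O' \<inter> X) = 1" by simp
  then have "AE x in \<mu>. x \<in> O' \<inter> X" using O'_sets by (simp add: prob_eq_1)
  then show ?thesis by eventually_elim (simp add: O'_def)
qed

text \<open>With infinitely many branches the bound per branch has to be charged to the length of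
  the branch. Above length \<open>half_sqrt ^ k\<close> it is at most
  \<open>\<kappa>r * half_sqrt ^ k\<close> times that length, and the lengths sum to at most
  \<open>len_X\<close>. Shorter branches may return, but those meeting the ball lie in a ball of
  radius \<open>2 * half_sqrt ^ k\<close>, and the preimage of \<open>G\<close> occupies at most a
  fraction of order \<open>leb G\<close> of each.\<close>

theorem AE_rare_returns_countable: "AE z in \<mu>. rare_returns z"
proof -
  define \<I> where "\<I> k j = {I \<in> branches j. half_sqrt ^ k \<le> leb I}" for k j :: nat
  obtain H where H: "H > 0" "\<And>F. F \<in> sets \<mu> \<Longrightarrow> prob F \<le> H * leb F"
    using density_bounded_above by metis
  \<comment> \<open>Here \<open>q = 1\<close>: the estimate does not count branches, so all times up
    to \<open>k\<close> can be treated.\<close>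
  have "AE z in \<mu>. eventually (\<lambda>k. \<forall>j\<in>{1..k div 1}. \<forall>I\<in>\<I> k j. z \<notin> near_returns j ((1 / 2) ^ k) I) sequentially"
  proof (rule AE_no_near_returns[where c = "\<kappa>r * len_X"])
    show sub: "\<I> k j \<subseteq> branches j" for k j by (auto simp: \<I>_def)
    show "0 \<le> \<kappa>r * len_X" using \<kappa>r_pos by (simp add: len_X_def)
    fix k j :: nat assume j: "1 \<le> j"
    let ?u = "half_sqrt ^ k"
    have u: "?u > 0" using half_sqrt_bounds by simp
    have UX: "(\<Union>I\<in>\<I> k j. I) \<subseteq> X" using sub branch_subset by blast
    have count: "countable (\<I> k j)" using countable_subset[OF sub countable_branches] .
    have "emeasure lborel (\<Union>I\<in>\<I> k j. near_returns j ((1 / 2) ^ k) I) \<le> ennreal (\<kappa>r * ?u) * emeasure lborel (\<Union>I\<in>\<I> k j. I)"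
    proof (rule emeasure_UN_le_cmult[OF count])
      show "disjoint_family_on (\<lambda>I. I) (\<I> k j)"
        using disjoint_branches[of j] sub[of k j] unfolding disjoint_family_on_def by blast
      fix I assume I: "I \<in> \<I> k j"
      then have I': "I \<in> branches j" "?u \<le> leb I" by (auto simp: \<I>_def)
      show "near_returns j ((1 / 2) ^ k) I \<in> sets lborel" using near_returns_open by (simp add: borel_open)
      show "I \<in> sets lborel" using branch_borel[OF I'(1)] by simp
      have "emeasure lborel (near_returns j ((1 / 2) ^ k) I) \<le> ennreal (\<kappa>r * (1 / 2) ^ k)"
        by (rule near_returns_measure[OF I'(1) j]) simp
      also have "\<kappa>r * (1 / 2) ^ k \<le> \<kappa>r * ?u * leb I"
        unfolding half_sqrt_power2[symmetric] mult.assoc using I'(2) u \<kappa>r_pos by (intro mult_left_mono) auto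
      also have "ennreal (\<kappa>r * ?u * leb I) = ennreal (\<kappa>r * ?u) * emeasure lborel I"
        using emeasure_leb[OF branch_subset[OF I'(1)]] u \<kappa>r_pos by (simp add: ennreal_mult)
      finally show "emeasure lborel (near_returns j ((1 / 2) ^ k) I) \<le> ennreal (\<kappa>r * ?u) * emeasure lborel I"
        by (simp add: ennreal_leI)
    qed
    also have "\<dots> \<le> ennreal (\<kappa>r * ?u) * ennreal len_X"
      unfolding len_X_def emeasure_leb[OF order.refl, symmetric] using UX X_borel
      by (intro mult_left_mono emeasure_mono) auto
    also have "\<dots> = ennreal (\<kappa>r * len_X * ?u)"
      using u \<kappa>r_pos by (simp add: ennreal_mult[symmetric] len_X_def mult_ac)
    finally show "emeasure lborel (\<Union>I\<in>\<I> k j. near_returns j ((1 / 2) ^ k) I) \<le> ennreal (\<kappa>r * len_X * ?u)" .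
  qed
  then show ?thesis using AE_small_balls AE_bounded_below_near
  proof eventually_elim
    case (elim z)
    obtain \<epsilon> \<eta> where e: "\<epsilon> > 0" "\<eta> > 0" "\<And>F. F \<in> sets \<mu> \<Longrightarrow> F \<subseteq> ball z \<epsilon> \<Longrightarrow> \<eta> * leb F \<le> prob F"
      using elim(3) by (auto simp: bounded_below_near_def)
    have "eventually (\<lambda>k. (1 / 2) ^ k < \<epsilon>) sequentially" using e(1) by real_asymp
    then have "eventually (\<lambda>k. \<forall>j\<in>{1..k div 1}. \<forall>G\<in>sets \<mu>. G \<subseteq> ball z ((1 / 2) ^ k) \<inter> X \<longrightarrow>
       prob (ball z ((1 / 2) ^ k) \<inter> X \<inter> pre j G) \<le> H * (C\<^sup>2 / \<delta> * 4) / \<eta> * half_sqrt ^ k * prob G) sequentially"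
      using elim(1)
    proof eventually_elim
      case (elim k)
      let ?u = "half_sqrt ^ k" and ?r = "(1 / 2 :: real) ^ k"
      have u: "?u > 0" using half_sqrt_bounds by simp
      have ru: "?r \<le> ?u" using half_sqrt_bounds unfolding half_sqrt_power2[symmetric]
        by (intro mult_left_le) (auto simp: power_le_one)
      show ?case
      proof (intro ballI impI)
        fix j G assume j: "j \<in> {1..k div 1}" and G: "G \<in> sets \<mu>" "G \<subseteq> ball z ?r \<inter> X"
        then have j1: "j \<ge> 1" by simp
        define \<J> where "\<J> = {I \<in> branches j. I \<inter> ball z ?r \<noteq> {} \<and> leb I < ?u}"
        have sub: "\<J> \<subseteq> branches j" by (auto simp: \<J>_def)
        let ?A = "ball z ?r \<inter> X \<inter> pre j G"
        have A_sub: "?A \<subseteq> (\<Union>I\<in>\<J>. I \<inter> pre j G)"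
        proof
          fix x assume x: "x \<in> ?A"
          then obtain I where I: "I \<in> branches j" "x \<in> I" using Union_branches[of j] by auto
          have "(f ^^ j) x \<in> ball z ?r" using x G(2) by auto
          then have "z \<in> near_returns j ?r I"
            using x I(2) by (auto simp: near_returns_def dist_real_def abs_minus_commute)
          then have "I \<notin> \<I> k j" using elim(2) j by auto
          then have "leb I < ?u" using I(1) by (auto simp: \<I>_def)
          then have "I \<in> \<J>" using I x by (auto simp: \<J>_def)
          then show "x \<in> (\<Union>I\<in>\<J>. I \<inter> pre j G)" using I x by auto
        qed
        have J_sub: "\<Union>\<J> \<subseteq> ball z (2 * ?u)"
        proof
          fix y assume "y \<in> \<Union>\<J>"
          then obtain I where I: "I \<in> branches j" "y \<in> I" "I \<inter> ball z ?r \<noteq> {}" "leb I < ?u" by (auto simp: \<J>_def)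
          then obtain x where x: "x \<in> I" "dist z x < ?r" by auto
          have mm: "min x y \<in> I" "max x y \<in> I" using x(1) I(2) by (auto simp: min_def max_def)
          then have "{min x y..max x y} \<subseteq> I" using mem_is_interval_1_I[OF branch_interval[OF I(1)] mm] by auto
          then have "leb {min x y..max x y} \<le> leb I"
            using branch_borel[OF I(1)] branch_subset[OF I(1)] by (intro leb_mono) auto
          then have "\<bar>x - y\<bar> < ?u" using I(4) by (auto simp: min_def max_def split: if_splits)
          then show "y \<in> ball z (2 * ?u)" using x(2) ru by (auto simp: dist_real_def)
        qed
        have A_sets: "?A \<in> sets \<mu>"
          using pre_borel[OF G(1), of "ball z ?r \<inter> X" j] X_borel
          unfolding sets_\<mu>_iff by (simp add: borel_open sets.Int le_infI1)
        have UJ_borel: "\<Union>\<J> \<in> sets borel" "(\<Union>I\<in>\<J>. I \<inter> pre j G) \<in> sets borel"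
        proof -
          have count: "countable \<J>" using countable_subset[OF sub countable_branches] .
          have J: "I \<in> sets borel" "I \<inter> pre j G \<in> sets borel" if "I \<in> \<J>" for I
          proof -
            have "I \<in> branches j" using that sub by auto
            then show I: "I \<in> sets borel" and "I \<inter> pre j G \<in> sets borel"
              using branch_borel branch_subset pre_borel[OF G(1)] by simp_all
          qed
          show "\<Union>\<J> \<in> sets borel" using count J(1) by (intro sets.countable_Union) auto
          show "(\<Union>I\<in>\<J>. I \<inter> pre j G) \<in> sets borel" using count J(2) by (intro sets.countable_UN') auto
        qed
        have "leb (\<Union>\<J>) \<le> leb (ball z (2 * ?u))"
          using J_sub UJ_borel emeasure_bounded_finite[of "ball z (2 * ?u)"]
          by (intro measure_mono_fmeasurable) (auto simp: fmeasurable_def)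
        also have "leb (ball z (2 * ?u)) = 4 * ?u" using u by (simp add: ball_eq_greaterThanLessThan)
        finally have J_le: "leb (\<Union>\<J>) \<le> 4 * ?u" .
        have "leb ?A \<le> leb (\<Union>I\<in>\<J>. I \<inter> pre j G)"
        proof (rule leb_mono[OF _ UJ_borel(2) A_sub])
          show "?A \<in> sets borel" using A_sets by (simp add: sets_\<mu>_iff)
          show "(\<Union>I\<in>\<J>. I \<inter> pre j G) \<subseteq> X" using sub branch_subset by blast
        qed
        also have "\<dots> \<le> C\<^sup>2 / \<delta> * leb G * leb (\<Union>\<J>)" by (rule pre_upper[OF j1 G(1) sub])
        also have "\<dots> \<le> C\<^sup>2 / \<delta> * leb G * (4 * ?u)"
          using \<delta> by (intro mult_left_mono J_le) auto
        finally have A_le: "leb ?A \<le> C\<^sup>2 / \<delta> * leb G * (4 * ?u)" .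
        \<comment> \<open>The target bound is relative to \<open>prob G\<close>. The lower density
          bound at the centre converts \<open>leb G\<close>, which is possible since
          \<open>G\<close> lies in the small ball.\<close>
        have Gp: "leb G \<le> prob G / \<eta>"
        proof -
          have "ball z ?r \<subseteq> ball z \<epsilon>" using elim(1) by (intro subset_ball) simp
          then have "\<eta> * leb G \<le> prob G" using G by (intro e(3)) auto
          then show ?thesis using e(2) by (simp add: pos_le_divide_eq mult.commute)
        qed
        have "prob ?A \<le> H * leb ?A" using H(2) A_sets by blast
        also have "\<dots> \<le> H * (C\<^sup>2 / \<delta> * leb G * (4 * ?u))" using A_le H(1) by (intro mult_left_mono) auto
        also have "\<dots> = H * (C\<^sup>2 / \<delta> * 4) * ?u * leb G" by simp
        also have "\<dots> \<le> H * (C\<^sup>2 / \<delta> * 4) * ?u * (prob G / \<eta>)"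
          using Gp H(1) \<delta> u by (intro mult_left_mono) auto
        finally show "prob ?A \<le> H * (C\<^sup>2 / \<delta> * 4) / \<eta> * ?u * prob G" by simp
      qed
    qed
    then show ?case
      by (rule rare_returnsI[OF elim(2), of 1, rotated 2]) (use H(1) e(2) \<delta> in auto)
  qed
qed

end

section \<open>The dichotomy for interval maps\<close>

lemma dyadic_scale:
  fixes r :: real assumes "0 < r" "r \<le> 1"
  obtains k :: nat where "(1 / 2) ^ Suc k < r" "r \<le> (1 / 2) ^ k"
proof -
  obtain k0 :: nat where k0: "(1 / 2) ^ k0 < r" using real_arch_pow_inv[of r "1 / 2"] assms by auto
  define m where "m = (LEAST k. (1 / 2 :: real) ^ k < r)"
  have m: "(1 / 2) ^ m < r" unfolding m_def using k0 by (rule LeastI)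
  then have "m \<noteq> 0" using assms by (intro notI) simp
  then obtain k where k: "m = Suc k" by (cases m) auto
  have "\<not> (1 / 2) ^ k < r" using not_less_Least[of k "\<lambda>k. (1 / 2 :: real) ^ k < r"] k by (simp add: m_def)
  then show ?thesis using that[of k] m k by simp
qed

lemma psi_le_iff:
  fixes \<psi> :: "real \<Rightarrow> ereal"
  assumes "\<And>y z. 0 \<le> y \<Longrightarrow> y < z \<Longrightarrow> \<psi> z < \<psi> y" "0 \<le> d" "0 \<le> r"
  shows "\<psi> r \<le> \<psi> d \<longleftrightarrow> d \<le> r"
  using assms(1)[of d r] assms(1)[of r d] assms(2,3) by (cases d r rule: linorder_cases) auto

section \<open>Eventual hitting as a measurable event\<close>

context measure_preserving_system
begin

lemma eventually_hits_sets:
  assumes C: "\<And>n. C n \<in> sets M"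
  shows "{x \<in> space M. eventually (\<lambda>n. x \<notin> avoids (C n) n) sequentially} \<in> sets M"
proof -
  have "{x \<in> space M. eventually (\<lambda>n. x \<notin> avoids (C n) n) sequentially}
      = (\<Union>N. space M - (\<Union>n\<in>{N..}. avoids (C n) n))"
    by (auto simp: eventually_sequentially)
  moreover have "(\<Union>n\<in>{N..}. avoids (C n) n) \<in> sets M" for N
    using C by (intro sets.countable_UN') auto
  ultimately show ?thesis by auto
qed

end

context mixing_interval_map
begin

lemma eah_set_eq:
  "eah_set X f r z = {x \<in> space \<mu>. eventually (\<lambda>n. x \<notin> avoids (ball_in X z (r n)) n) sequentially}"
proof -
  have "x \<in> eah_set X f r z \<longleftrightarrow> x \<in> X \<and> (\<exists>N\<ge>1. \<forall>n\<ge>N. x \<notin> avoids (ball_in X z (r n)) n)" for x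
  proof -
    have hit: "(x \<in> (\<Union>k\<in>{0..n-1}. (f ^^ k) -` ball_in X z (r n) \<inter> X)) \<longleftrightarrow>
        x \<in> X \<and> x \<notin> avoids (ball_in X z (r n)) n" if "n \<ge> 1" for n
    proof -
      \<comment> \<open>This needs \<open>n \<ge> 1\<close>: for \<open>n = 0\<close> truncated
        subtraction makes the left side \<open>{0}\<close>.\<close>
      have "{0..n-1} = {..<n}" using that by auto
      then show ?thesis by (auto simp: avoids_def space_\<mu>)
    qed
    have "x \<in> eah_set X f r z \<longleftrightarrow> (\<exists>N\<ge>1. \<forall>n\<ge>N. x \<in> (\<Union>k\<in>{0..n-1}. (f ^^ k) -` ball_in X z (r n) \<inter> X))"
      by (simp only: eah_set_def UN_iff INT_iff atLeast_iff) blast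
    also have "\<dots> \<longleftrightarrow> (\<exists>N\<ge>1. \<forall>n\<ge>N. x \<in> X \<and> x \<notin> avoids (ball_in X z (r n)) n)"
      using hit by (meson order.trans)
    also have "\<dots> \<longleftrightarrow> x \<in> X \<and> (\<exists>N\<ge>1. \<forall>n\<ge>N. x \<notin> avoids (ball_in X z (r n)) n)"
      by blast
    finally show ?thesis .
  qed
  moreover have "(\<exists>N\<ge>1. \<forall>n\<ge>N. Q n) \<longleftrightarrow> eventually Q sequentially" for Q :: "nat \<Rightarrow> bool"
  proof
    assume "eventually Q sequentially"
    then obtain N where "\<forall>n\<ge>N. Q n" by (auto simp: eventually_sequentially)
    then show "\<exists>N\<ge>1. \<forall>n\<ge>N. Q n" by (intro exI[of _ "max 1 N"]) auto
  qed (auto simp: eventually_sequentially)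
  ultimately show ?thesis by (auto simp: space_\<mu>)
qed

text \<open>The maximum reaches \<open>\<psi> (r n)\<close> when the orbit meets the closed ball, whereas \<open>eah_set\<close> uses
  open balls; the boundaries are null.\<close>
lemma max_event_eq:
  assumes \<psi>: "\<And>y z. 0 \<le> y \<Longrightarrow> y < z \<Longrightarrow> \<psi> z < \<psi> y" and r: "\<And>n. n \<ge> 1 \<Longrightarrow> r n > 0"
  shows "max_event X f \<psi> r z = {x \<in> space \<mu>. eventually (\<lambda>n. x \<notin> avoids (cball z (r n) \<inter> X) n) sequentially}"
proof -
  have "\<psi> (r n) \<le> running_max f (observable \<psi> z) n x \<longleftrightarrow> x \<notin> avoids (cball z (r n) \<inter> X) n"
    if n: "n \<ge> 1" and x: "x \<in> X" for n x
  proof -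
    have "\<psi> (r n) \<le> running_max f (observable \<psi> z) n x \<longleftrightarrow>
        (\<exists>i\<in>{1..n}. \<psi> (r n) \<le> \<psi> (dist ((f ^^ (i - 1)) x) z))"
      using n by (simp add: running_max_def obs_process_def observable_def Max_ge_iff)
    also have "\<dots> \<longleftrightarrow> (\<exists>i\<in>{1..n}. dist ((f ^^ (i - 1)) x) z \<le> r n)"
      using psi_le_iff[of \<psi>, OF \<psi>] r[OF n] by simp
    also have "\<dots> \<longleftrightarrow> (\<exists>k<n. dist ((f ^^ k) x) z \<le> r n)"
    proof
      assume "\<exists>i\<in>{1..n}. dist ((f ^^ (i - 1)) x) z \<le> r n"
      then obtain i where "i \<in> {1..n}" "dist ((f ^^ (i - 1)) x) z \<le> r n" by blast
      then show "\<exists>k<n. dist ((f ^^ k) x) z \<le> r n" by (intro exI[of _ "i - 1"]) auto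
    next
      assume "\<exists>k<n. dist ((f ^^ k) x) z \<le> r n"
      then obtain k where "k < n" "dist ((f ^^ k) x) z \<le> r n" by blast
      then show "\<exists>i\<in>{1..n}. dist ((f ^^ (i - 1)) x) z \<le> r n" by (intro bexI[of _ "Suc k"]) auto
    qed
    also have "\<dots> \<longleftrightarrow> x \<notin> avoids (cball z (r n) \<inter> X) n"
      using x funpow_space[of x] by (auto simp: avoids_def space_\<mu> dist_commute)
    finally show ?thesis .
  qed
  then have "eventually (\<lambda>n. \<psi> (r n) \<le> running_max f (observable \<psi> z) n x) sequentially \<longleftrightarrow>
      eventually (\<lambda>n. x \<notin> avoids (cball z (r n) \<inter> X) n) sequentially" if "x \<in> X" for x
    using that by (intro eventually_cong eventually_mono[OF eventually_ge_at_top[of 1]]) auto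
  then show ?thesis by (auto simp: max_event_def space_\<mu>)
qed

text \<open>A centre with a null ball lies in one of countably many null intervals with rational
  endpoints. This provides the positive measure of the first target.\<close>

lemma AE_positive_balls: "AE z in \<mu>. \<forall>\<epsilon>>0. prob (ball z \<epsilon> \<inter> X) > 0"
proof -
  have sets: "{a<..<b} \<inter> X \<in> sets \<mu>" for a b by (simp add: sets_\<mu>_iff X_borel sets.Int)
  have "AE z in \<mu>. prob ({real_of_rat a<..<real_of_rat b} \<inter> X) = 0 \<longrightarrow> z \<notin> {real_of_rat a<..<real_of_rat b}" for a b
  proof (cases "prob ({real_of_rat a<..<real_of_rat b} \<inter> X) = 0")
    case True
    then have "AE z in \<mu>. z \<notin> {real_of_rat a<..<real_of_rat b} \<inter> X" using sets prob_eq_0 by blast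
    then show ?thesis using AE_space by eventually_elim (auto simp: space_\<mu>)
  qed simp
  then have "AE z in \<mu>. \<forall>a b. prob ({real_of_rat a<..<real_of_rat b} \<inter> X) = 0 \<longrightarrow> z \<notin> {real_of_rat a<..<real_of_rat b}"
    by (simp only: AE_all_countable) auto
  then show ?thesis
  proof eventually_elim
    case (elim z)
    show ?case
    proof (intro allI impI)
      fix \<epsilon> :: real assume "\<epsilon> > 0"
      then obtain a b where ab: "z - \<epsilon> < real_of_rat a" "real_of_rat a < z" "z < real_of_rat b" "real_of_rat b < z + \<epsilon>"
        using of_rat_dense[of "z - \<epsilon>" z] of_rat_dense[of z "z + \<epsilon>"] by auto
      have "{real_of_rat a<..<real_of_rat b} \<subseteq> ball z \<epsilon>" using ab by (auto simp: dist_real_def)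
      then have "prob ({real_of_rat a<..<real_of_rat b} \<inter> X) \<le> prob (ball z \<epsilon> \<inter> X)"
        by (intro finite_measure_mono) (auto simp: sets_\<mu>_iff X_borel borel_open sets.Int)
      moreover have "prob ({real_of_rat a<..<real_of_rat b} \<inter> X) \<noteq> 0" using elim ab by auto
      ultimately show "prob (ball z \<epsilon> \<inter> X) > 0" by (smt (verit) measure_nonneg)
    qed
  qed
qed

lemma AE_orbit_avoids_countable:
  assumes "countable S"
  shows "AE x in \<mu>. \<forall>k. (f ^^ k) x \<notin> S"
  using assms by (intro AE_all_funpow AE_transfer AE_not_in countable_imp_null_set_lborel)

end

context expanding_interval_map
begin

text \<open>The ball of radius \<open>r n\<close> lies in a dyadic ball of less than twice its
  radius, and \<open>\<rho> ^ k\<close> is the power \<open>s\<close> of the dyadic radius.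
  Polynomial decay of \<open>r\<close> then becomes the factor
  \<open>n powr (- (\<sigma> * s))\<close>.\<close>

lemma rare_returns_short_returns:
  assumes rare: "rare_returns z" and r_pos: "\<And>n. n \<ge> 1 \<Longrightarrow> r n > 0" and \<sigma>: "\<sigma> > 0"
    and r_bigo: "r \<in> O(\<lambda>n. real n powr (- \<sigma>))"
  obtains D \<theta> where "D \<ge> 0" "\<theta> > 0"
    "eventually (\<lambda>n. \<forall>j\<ge>1. \<forall>G\<in>sets \<mu>. G \<subseteq> ball_in X z (r n) \<longrightarrow>
       prob (ball_in X z (r n) \<inter> pre j G) \<le> D * real n powr (- \<theta>) * prob G) sequentially"
proof -
  obtain A \<rho> where A: "0 \<le> A" "0 < \<rho>" "\<rho> < 1" and
    ev: "eventually (\<lambda>k. \<forall>j\<ge>1. \<forall>G\<in>sets \<mu>. G \<subseteq> ball z ((1 / 2) ^ k) \<inter> X \<longrightarrow>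
       prob (ball z ((1 / 2) ^ k) \<inter> X \<inter> pre j G) \<le> A * \<rho> ^ k * prob G) sequentially"
    using rare by (auto simp: rare_returns_def)
  obtain k0 where k0: "\<And>k j G. k \<ge> k0 \<Longrightarrow> j \<ge> 1 \<Longrightarrow> G \<in> sets \<mu> \<Longrightarrow> G \<subseteq> ball z ((1 / 2) ^ k) \<inter> X \<Longrightarrow>
       prob (ball z ((1 / 2) ^ k) \<inter> X \<inter> pre j G) \<le> A * \<rho> ^ k * prob G"
    using ev unfolding eventually_sequentially by blast
  define s where "s = - log 2 \<rho>"
  have s: "s > 0" using A by (simp add: s_def)
  have \<rho>k: "\<rho> ^ k = ((1 / 2) ^ k) powr s" for k
  proof -
    have "(1 / 2 :: real) powr s = 2 powr log 2 \<rho>"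
      by (simp add: s_def powr_divide powr_minus_divide)
    also have "\<dots> = \<rho>" using A by simp
    finally have half: "(1 / 2 :: real) powr s = \<rho>" .
    have "((1 / 2 :: real) ^ k) powr s = (1 / 2) powr (real k * s)"
      by (subst powr_realpow[symmetric]) (auto simp: powr_powr)
    also have "\<dots> = ((1 / 2) powr s) powr real k" by (simp add: powr_powr mult.commute)
    also have "\<dots> = \<rho> ^ k" unfolding half using A by (simp add: powr_realpow)
    finally show ?thesis by simp
  qed
  obtain c where c: "c > 0" "eventually (\<lambda>n. norm (r n) \<le> c * norm (real n powr (- \<sigma>))) sequentially"
    using r_bigo by (elim landau_o.bigE)
  have "eventually (\<lambda>n::nat. c * real n powr (- \<sigma>) < (1 / 2) ^ k0) sequentially"
  proof -
    have "eventually (\<lambda>n::nat. c * real n powr (- \<sigma>) < \<epsilon>) sequentially" if "\<epsilon> > 0" for \<epsilon>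
      using that c(1) \<sigma> by real_asymp
    then show ?thesis by simp
  qed
  then have "eventually (\<lambda>n. \<forall>j\<ge>1. \<forall>G\<in>sets \<mu>. G \<subseteq> ball_in X z (r n) \<longrightarrow>
       prob (ball_in X z (r n) \<inter> pre j G) \<le> A * (2 * c) powr s * real n powr (- (\<sigma> * s)) * prob G) sequentially"
    using c(2) eventually_ge_at_top[of 1]
  proof eventually_elim
    case (elim n)
    have rn: "0 < r n" "r n \<le> c * real n powr (- \<sigma>)" using elim r_pos[of n] by auto
    have "r n < (1 / 2) ^ k0" using rn elim by linarith
    moreover have "(1 / 2 :: real) ^ k0 \<le> 1" by (simp add: power_le_one)
    ultimately obtain k where k: "(1 / 2) ^ Suc k < r n" "r n \<le> (1 / 2) ^ k"
      using dyadic_scale[of "r n"] rn by (metis less_imp_le order.trans)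
    have "k \<ge> k0"
    proof (rule ccontr)
      assume "\<not> k \<ge> k0"
      then have "(1 / 2 :: real) ^ k0 \<le> (1 / 2) ^ Suc k" by (intro power_decreasing) auto
      then show False using k \<open>r n < (1 / 2) ^ k0\<close> by linarith
    qed
    have sub: "ball_in X z (r n) \<subseteq> ball z ((1 / 2) ^ k) \<inter> X"
      using k(2) by (auto simp: ball_in_def)
    have "\<rho> ^ k \<le> (2 * c * real n powr (- \<sigma>)) powr s"
      unfolding \<rho>k using k(1) rn s by (intro powr_mono2) auto
    also have "\<dots> = (2 * c) powr s * real n powr (- (\<sigma> * s))"
      using c(1) by (simp add: powr_mult powr_powr)
    finally have \<rho>le: "\<rho> ^ k \<le> (2 * c) powr s * real n powr (- (\<sigma> * s))" .
    show ?case
    proof (intro allI ballI impI)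
      fix j :: nat and G assume j: "1 \<le> j" and G: "G \<in> sets \<mu>" "G \<subseteq> ball_in X z (r n)"
      have "prob (ball_in X z (r n) \<inter> pre j G) \<le> prob (ball z ((1 / 2) ^ k) \<inter> X \<inter> pre j G)"
        using sub pre_sets[OF G(1)] X_borel by (intro finite_measure_mono) (auto simp: sets_\<mu>_iff borel_open)
      also have "\<dots> \<le> A * \<rho> ^ k * prob G" using G sub by (intro k0 \<open>k \<ge> k0\<close> j) auto
      also have "\<dots> \<le> A * ((2 * c) powr s * real n powr (- (\<sigma> * s))) * prob G"
        using A(1) \<rho>le by (intro mult_right_mono mult_left_mono) auto
      finally show "prob (ball_in X z (r n) \<inter> pre j G) \<le> A * (2 * c) powr s * real n powr (- (\<sigma> * s)) * prob G"
        by (simp add: mult.assoc)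
    qed
  qed
  then show ?thesis using A(1) \<sigma> s by (intro that[of "A * (2 * c) powr s" "\<sigma> * s"]) auto
qed

theorem dichotomy:
  assumes rare: "AE z in \<mu>. rare_returns z"
    and \<psi>_decr: "\<And>y z. 0 \<le> y \<Longrightarrow> y < z \<Longrightarrow> \<psi> z < \<psi> y"
    and r_pos: "\<And>n. n \<ge> 1 \<Longrightarrow> r n > 0" and r_decr: "antimono_on {1..} r"
    and \<sigma>: "\<sigma> > 0" and r_bigo: "r \<in> O(\<lambda>n. real n powr (- \<sigma>))"
  shows "AE z in \<mu>. mono_on {1..} (\<lambda>n. real n * prob (ball_in X z (r n))) \<longrightarrow>
    (summable (\<lambda>n. prob (ball_in X z (r n)) * exp (- (real n * prob (ball_in X z (r n))))) \<longrightarrow>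
       prob (eah_set X f r z) = 1 \<and> prob (max_event X f \<psi> r z) = 1) \<and>
    (\<not> summable (\<lambda>n. prob (ball_in X z (r n)) * exp (- (real n * prob (ball_in X z (r n))))) \<longrightarrow>
       prob (eah_set X f r z) = 0 \<and> prob (max_event X f \<psi> r z) = 0)"
  using rare AE_positive_balls
proof eventually_elim
  case (elim z)
  let ?B = "\<lambda>n. ball_in X z (r n)"
  have B_sets: "?B n \<in> sets \<mu>" "cball z (r n) \<inter> X \<in> sets \<mu>" for n
    by (auto simp: ball_in_def sets_\<mu>_iff X_borel borel_open borel_closed sets.Int)
  have r_lim: "r \<longlonglongrightarrow> 0"
  proof -
    obtain c where "eventually (\<lambda>n. norm (r n) \<le> c * norm (real n powr (- \<sigma>))) sequentially"
      using r_bigo by (elim landau_o.bigE)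
    moreover have "(\<lambda>n. real n powr (- \<sigma>)) \<longlonglongrightarrow> 0" using \<sigma> by real_asymp
    then have "(\<lambda>n. c * norm (real n powr (- \<sigma>))) \<longlonglongrightarrow> 0"
      by (intro tendsto_mult_right_zero tendsto_norm_zero)
    ultimately show ?thesis by (rule Lim_null_comparison)
  qed
  have eah: "eah_set X f r z \<in> sets \<mu>" unfolding eah_set_eq by (rule eventually_hits_sets) (rule B_sets)
  have max_eq: "max_event X f \<psi> r z = {x \<in> space \<mu>. eventually (\<lambda>n. x \<notin> avoids (cball z (r n) \<inter> X) n) sequentially}"
    using \<psi>_decr r_pos by (intro max_event_eq)
  have max: "max_event X f \<psi> r z \<in> sets \<mu>" unfolding max_eq
    by (rule eventually_hits_sets) (rule B_sets)
  have "AE x in \<mu>. \<forall>k. (f ^^ k) x \<notin> (\<Union>n. {z - r n, z + r n})"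
    by (rule AE_orbit_avoids_countable) auto
  then have same: "AE x in \<mu>. x \<in> eah_set X f r z \<longleftrightarrow> x \<in> max_event X f \<psi> r z"
  proof eventually_elim
    case (elim x)
    have "(f ^^ k) x \<in> ?B n \<longleftrightarrow> (f ^^ k) x \<in> cball z (r n) \<inter> X" for k n
    proof -
      have "dist z ((f ^^ k) x) \<noteq> r n"
      proof
        assume "dist z ((f ^^ k) x) = r n"
        then have "(f ^^ k) x \<in> {z - r n, z + r n}" by (auto simp: dist_real_def abs_if split: if_splits)
        then show False using elim by blast
      qed
      then show ?thesis by (auto simp: ball_in_def)
    qed
    then have "x \<in> avoids (?B n) n \<longleftrightarrow> x \<in> avoids (cball z (r n) \<inter> X) n" for n
      by (simp add: avoids_def)
    then show ?case unfolding eah_set_eq max_eq by simp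
  qed
  show ?case
  proof
    assume mono: "mono_on {1..} (\<lambda>n. real n * prob (?B n))"
    obtain D \<theta> where D: "D \<ge> 0" "\<theta> > 0" and
      short: "eventually (\<lambda>n. \<forall>j\<ge>1. \<forall>G\<in>sets \<mu>. G \<subseteq> ?B n \<longrightarrow>
       prob (?B n \<inter> pre j G) \<le> D * real n powr (- \<theta>) * prob G) sequentially"
      by (rule rare_returns_short_returns[OF elim(1) r_pos \<sigma> r_bigo])
    interpret targets: shrinking_targets \<mu> f ?B K \<tau> D \<theta>
    proof
      show "exp_mixing_set K \<tau> (?B n)" for n
        using X_interval by (intro interval_mixing) (auto simp: ball_in_def is_interval_ball_real intro!: is_interval_Int)
      show "?B n \<subseteq> ?B m" if "1 \<le> m" "m \<le> n" for m n
      proof -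
        have "r n \<le> r m" using r_decr that by (simp add: monotone_on_def)
        then show ?thesis by (auto simp: ball_in_def)
      qed
      show "prob (?B 1) > 0" using elim(2) r_pos[of 1] by (simp add: ball_in_def)
    qed (use D short mono K_pos \<tau>_pos in auto)
    \<comment> \<open>As \<open>r\<close> tends to 0, only the centre can belong to all targets, and
      a single point is a null set.\<close>
    have "AE x in \<mu>. \<forall>k. (f ^^ k) x \<notin> {z}" by (rule AE_orbit_avoids_countable) simp
    then have shrink: "AE x in \<mu>. \<exists>n\<ge>1. x \<notin> ?B n"
    proof eventually_elim
      case (elim x)
      then have "x \<noteq> z" by (auto dest: spec[of _ 0])
      then have "eventually (\<lambda>n. r n < dist z x) sequentially"
        using r_lim by (intro order_tendstoD(2)) auto
      then have "eventually (\<lambda>n. n \<ge> 1 \<and> x \<notin> ?B n) sequentially"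
        using eventually_ge_at_top[of 1] by eventually_elim (auto simp: ball_in_def)
      then show "\<exists>n\<ge>1. x \<notin> ?B n" using eventually_happens'[OF sequentially_bot] by blast
    qed
    have fun_eq: "(\<lambda>n. prob (?B n) * exp (- (real n * prob (?B n)))) = (\<lambda>n. targets.b n * exp (- targets.c n))"
      by (simp add: targets.b_def targets.c_def)
    show "(summable (\<lambda>n. prob (?B n) * exp (- (real n * prob (?B n)))) \<longrightarrow>
         prob (eah_set X f r z) = 1 \<and> prob (max_event X f \<psi> r z) = 1) \<and>
      (\<not> summable (\<lambda>n. prob (?B n) * exp (- (real n * prob (?B n)))) \<longrightarrow>
         prob (eah_set X f r z) = 0 \<and> prob (max_event X f \<psi> r z) = 0)"
      unfolding fun_eq
    proof (intro conjI impI)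
      assume "summable (\<lambda>n. targets.b n * exp (- targets.c n))"
      from targets.eventually_hits[OF this] have "AE x in \<mu>. x \<in> eah_set X f r z"
        unfolding eah_set_eq using AE_space by eventually_elim simp
      moreover from this same have "AE x in \<mu>. x \<in> max_event X f \<psi> r z" by eventually_elim simp
      ultimately show "prob (eah_set X f r z) = 1" "prob (max_event X f \<psi> r z) = 1"
        using eah max by (simp_all add: prob_eq_1)
    next
      assume not_sum: "\<not> summable (\<lambda>n. targets.b n * exp (- targets.c n))"
      have "AE x in \<mu>. frequently (\<lambda>n. x \<in> avoids (?B n) n) sequentially"
        by (rule targets.infinitely_often_avoids[OF not_sum _ shrink]) (rule ergodic)
      then have "AE x in \<mu>. x \<notin> eah_set X f r z"
        unfolding eah_set_eq by eventually_elim (simp add: frequently_def)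
      moreover from this same have "AE x in \<mu>. x \<notin> max_event X f \<psi> r z" by eventually_elim simp
      ultimately show "prob (eah_set X f r z) = 0" "prob (max_event X f \<psi> r z) = 0"
        using eah max by (simp_all add: prob_eq_0)
    qed
  qed
qed

end

section \<open>Passage from the hypotheses to the abstract setting\<close>

lemma exp_decay_interval:
  assumes "prob_space \<mu>" and space: "space \<mu> = X" "sets \<mu> = sets (restrict_space borel X)"
    and X: "is_interval X" and f: "f \<in> measurable \<mu> \<mu>" and inv: "distr \<mu> \<mu> f = \<mu>"
    and decay: "exp_decay_BV_L1 X \<mu> f"
  obtains K \<tau> where "K > 0" "\<tau> > 0"
    "\<And>A. is_interval A \<Longrightarrow> A \<subseteq> X \<Longrightarrow> measure_preserving_system.exp_mixing_set \<mu> f K \<tau> A"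
proof -
  interpret measure_preserving_system \<mu> f
    using assms(1) f inv by (intro measure_preserving_system.intro) (auto simp: measure_preserving_system_axioms_def)
  obtain C \<tau> where C: "C > 0" "\<tau> > 0" and dec: "\<And>g h j. bounded_variation X g \<Longrightarrow> integrable \<mu> h \<Longrightarrow>
      \<bar>(\<integral>x. g x * h ((f ^^ j) x) \<partial>\<mu>) - (\<integral>x. g x \<partial>\<mu>) * (\<integral>x. h x \<partial>\<mu>)\<bar>
        \<le> C * exp (- \<tau> * real j) * BV_norm X g * (\<integral>x. \<bar>h x\<bar> \<partial>\<mu>)"
    using decay unfolding exp_decay_BV_L1_def by blast
  have X_ne: "X \<noteq> {}" using not_empty space by simp
  show ?thesis
  \<comment> \<open>The 3 bounds the BV norm of the indicator of an interval: variation at most 2,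
    supremum at most 1.\<close>
  proof (rule that[of "3 * C" \<tau>])
    fix A assume A: "is_interval A" "A \<subseteq> X"
    have X_borel: "X \<in> sets borel" by (rule real_interval_borel_measurable[OF X])
    have A_sets: "A \<in> sets \<mu>"
      unfolding space using A real_interval_borel_measurable X_borel by (subst sets_restrict_space_iff) auto
    show "exp_mixing_set (3 * C) \<tau> A"
      unfolding exp_mixing_set_def
    proof (intro conjI ballI allI A_sets)
      fix H and j :: nat assume H: "H \<in> sets \<mu>"
      have 1: "(\<integral>x. indicat_real A x * indicator H ((f ^^ j) x) \<partial>\<mu>) = prob (A \<inter> pre j H)"
      proof -
        have "(\<integral>x. indicat_real A x * indicator H ((f ^^ j) x) \<partial>\<mu>) = (\<integral>x. indicat_real (A \<inter> pre j H) x \<partial>\<mu>)"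
          by (intro Bochner_Integration.integral_cong) (auto split: split_indicator)
        then show ?thesis using A_sets H by simp
      qed
      have "\<bar>prob (A \<inter> pre j H) - prob A * prob H\<bar> \<le> C * exp (- \<tau> * real j) * BV_norm X (indicator A) * prob H"
        using dec[OF BV_indicator_interval(1)[OF A(1) X_ne], of "indicator H" j] A_sets H
        unfolding 1 by (simp add: emeasure_eq_measure)
      also have "\<dots> \<le> C * exp (- \<tau> * real j) * 3 * prob H"
        using BV_indicator_interval(2)[OF A(1) X_ne] C
        by (intro mult_right_mono mult_left_mono) auto
      finally show "\<bar>prob (A \<inter> pre j H) - prob A * prob H\<bar> \<le> 3 * C * exp (- \<tau> * real j) * prob H"
        by (simp add: mult_ac)
    qed
  qed (use C in auto)
qed

theorem theorem2p1:
  fixes X :: "real set" and f :: "real \<Rightarrow> real" and \<mu> :: "real measure"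
    and \<psi> :: "real \<Rightarrow> ereal" and r :: "nat \<Rightarrow> real" and \<sigma> :: real
  assumes X: "is_interval X" "bounded X"
    and f: "piecewise_expanding X f"
    and \<mu>_space: "space \<mu> = X" "sets \<mu> = sets (restrict_space borel X)"
    and \<mu>_erg: "ergodic_measure \<mu> f"
    and \<mu>_ac: "absolutely_continuous (restrict_space lborel X) \<mu>"
    and \<mu>_decay: "exp_decay_BV_L1 X \<mu> f"
    and \<psi>_val: "\<And>y. y \<ge> 0 \<Longrightarrow> \<psi> y \<noteq> -\<infinity>"
    and \<psi>_decr: "\<And>y z. 0 \<le> y \<Longrightarrow> y < z \<Longrightarrow> \<psi> z < \<psi> y"
    and \<psi>_cont: "continuous_on {0..} \<psi>"
    and \<psi>_lim: "(\<psi> \<longlongrightarrow> \<infinity>) (at_right 0)"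
    and r_pos: "\<And>n. n \<ge> 1 \<Longrightarrow> r n > 0"
    and r_decr: "antimono_on {1..} r"
    and \<sigma>: "\<sigma> > 4 / 5"
    and r_bigo: "r \<in> O(\<lambda>n. real n powr (- \<sigma>))"
    and r_limsup: "\<And>t::real. t > 0 \<Longrightarrow>
      limsup (\<lambda>k::nat. ereal (r (nat \<lfloor>real k powr t\<rfloor>) / r (nat \<lfloor>real (k + 1) powr t\<rfloor>))) < \<infinity>"
  shows "AE xt in \<mu>. mono_on {1..} (\<lambda>n. real n * measure \<mu> (ball_in X xt (r n))) \<longrightarrow>
    (summable (\<lambda>i. let n = Suc i; b = measure \<mu> (ball_in X xt (r n)) in b * exp (- (real n * b))) \<and>
     \<not> summable (\<lambda>i. measure \<mu> (ball_in X xt (r (Suc i)))) \<longrightarrow>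
       measure \<mu> (eah_set X f r xt) = 1 \<and> measure \<mu> (max_event X f \<psi> r xt) = 1) \<and>
    (\<not> summable (\<lambda>i. let n = Suc i; b = measure \<mu> (ball_in X xt (r n)) in b * exp (- (real n * b))) \<longrightarrow>
       measure \<mu> (eah_set X f r xt) = 0 \<and> measure \<mu> (max_event X f \<psi> r xt) = 0)"
proof -
  have prob: "prob_space \<mu>" and f_meas: "f \<in> measurable \<mu> \<mu>" and f_inv: "distr \<mu> \<mu> f = \<mu>"
    and erg: "\<And>A. A \<in> sets \<mu> \<Longrightarrow> f -` A \<inter> space \<mu> = A \<Longrightarrow> measure \<mu> A = 0 \<or> measure \<mu> A = 1"
    using \<mu>_erg by (auto simp: ergodic_measure_def invariant_measure_def)
  from conjunct2[OF f[unfolded piecewise_expanding_def]]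
  obtain P where "partition_on X P \<and>
      (\<forall>I\<in>P. is_interval I \<and> f differentiable_on I \<and> (mono_on I f \<or> antimono_on I f)) \<and>
      (finite P \<or> countable P \<and>
        (\<exists>\<delta>>0. \<forall>n\<ge>1. \<forall>I\<in>iterated_partition X f P n. measure lborel ((f ^^ n) ` I) \<ge> \<delta>)) \<and>
      (\<exists>\<Lambda>>1. \<forall>I\<in>P. expanding_on f \<Lambda> I) \<and>
      (\<exists>C>0. \<forall>n\<ge>1. \<forall>I\<in>iterated_partition X f P n. distortion_bounded_on (f ^^ n) C I)"
    by (rule exE)
  note P_all = this
  note P = conjunct1[OF P_all] and P_rest = conjunct2[OF P_all]
  note P_intervals = conjunct1[OF P_rest] and P_rest = conjunct2[OF P_rest]
  note size = conjunct1[OF P_rest] and P_rest = conjunct2[OF P_rest]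
  from P_rest obtain \<Lambda> C where \<Lambda>: "\<Lambda> > 1" "\<forall>I\<in>P. expanding_on f \<Lambda> I"
    and C: "C > 0" "\<forall>n\<ge>1. \<forall>I\<in>iterated_partition X f P n. distortion_bounded_on (f ^^ n) C I"
    by metis
  have P_countable: "countable P" using size countable_finite by blast
  obtain K \<tau> where K: "K > 0" "\<tau> > 0"
    "\<And>A. is_interval A \<Longrightarrow> A \<subseteq> X \<Longrightarrow> measure_preserving_system.exp_mixing_set \<mu> f K \<tau> A"
    using exp_decay_interval[OF prob \<mu>_space X(1) f_meas f_inv \<mu>_decay] by metis
  interpret measure_preserving_system \<mu> f
    using prob f_meas f_inv by (intro measure_preserving_system.intro) (auto simp: measure_preserving_system_axioms_def)
  interpret expanding_interval_map \<mu> f X K \<tau> P \<Lambda>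
    by unfold_locales (use X \<mu>_space \<mu>_ac erg K P P_intervals P_countable \<Lambda> in simp_all)
  \<comment> \<open>An infinite partition comes with the lower bound \<open>\<delta>\<close> on
    image lengths; a finite one has a bounded number of branches instead.\<close>
  have "AE z in \<mu>. rare_returns z"
  proof (cases "finite P")
    case True
    then show ?thesis by (rule AE_rare_returns_finite)
  next
    case False
    then obtain \<delta> where \<delta>: "\<delta> > 0" "\<forall>n\<ge>1. \<forall>I\<in>branches n. measure lborel ((f ^^ n) ` I) \<ge> \<delta>"
      using size by auto
    interpret large_image_map \<mu> f X K \<tau> P \<Lambda> \<delta> C
      by unfold_locales (use \<delta> C in simp_all)
    show ?thesis by (rule AE_rare_returns_countable)
  qed
  moreover have "\<sigma> > 0" using \<sigma> by simp
  ultimately have main: "AE z in \<mu>. mono_on {1..} (\<lambda>n. real n * prob (ball_in X z (r n))) \<longrightarrow>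
    (summable (\<lambda>n. prob (ball_in X z (r n)) * exp (- (real n * prob (ball_in X z (r n))))) \<longrightarrow>
       prob (eah_set X f r z) = 1 \<and> prob (max_event X f \<psi> r z) = 1) \<and>
    (\<not> summable (\<lambda>n. prob (ball_in X z (r n)) * exp (- (real n * prob (ball_in X z (r n))))) \<longrightarrow>
       prob (eah_set X f r z) = 0 \<and> prob (max_event X f \<psi> r z) = 0)"
    using \<psi>_decr r_pos r_decr r_bigo by (intro dichotomy[where \<sigma> = \<sigma>])
  \<comment> \<open>The series of the theorem start at \<open>n = 1\<close>, those of
    \<open>dichotomy\<close> at 0; the one extra term, which involves the unrestricted value
    \<open>r 0\<close>, does not affect summability.\<close>
  have sum_eq: "summable (\<lambda>i. let n = Suc i; b = prob (ball_in X z (r n)) in b * exp (- (real n * b))) \<longleftrightarrow>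
      summable (\<lambda>n. prob (ball_in X z (r n)) * exp (- (real n * prob (ball_in X z (r n)))))" for z
    unfolding Let_def by (rule summable_Suc_iff)
  show ?thesis unfolding sum_eq using main by eventually_elim blast
qed

end
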